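(* The number of pairwise non-isomorphic $\mathcal{R}$-cross-sections of $\mathcal{IS}_m\wr_p\mathcal{IS}_n$ (i.e. the number of isomorphism classes, as semigroups, of $\mathcal{R}$-cross-sections) is equal to $$\sum_{\substack{j_1,j_2,\dots,j_n\ge 0\\ j_1+2j_2+\dots+nj_n=n}}\ \prod_{i=1}^{n}\binom{p_m+j_i-1}{j_i},$$ where $p_m$ denotes the number of decompositions of $m$ into a sum of positive integers, the order of summands being unimportant. The number of pairwise non-isomorphic $\mathcal{L}$-cross-sections of $\mathcal{IS}_m\wr_p\mathcal{IS}_n$ is given by the same formula.
   Context: $m,n$ are positive integers. $\mathcal{IS}_n$ is the finite inverse symmetric semigroup: the set of all partial bijections of $\{1,\dots,n\}$ (injective maps from a subset of $\{1,\dots,n\}$ to $\{1,\dots,n\}$, including the empty map), with maps written on the right and composed from left to right: $x(ab)=(xa)b$, $\operatorname{dom}(ab)=\{x\in\operatorname{dom}(a): xa\in\operatorname{dom}(b)\}$. The partial wreath product $\mathcal{IS}_m\wr_p\mathcal{IS}_n$ is the set of pairs $(f,a)$ with $a\in\mathcal{IS}_n$ and $f\colon\operatorname{dom}(a)\to\mathcal{IS}_m$ a function, with product $(f,a)(g,b)=(fg^a,ab)$, where $(fg^a)(x)=f(x)g(xa)$ for $x\in\operatorname{dom}(ab)$. It is an inverse semigroup with identity. On an inverse semigroup $S$ with identity, Green's relations are $a\,\mathcal{R}\,b\Leftrightarrow aS=bS$ and $a\,\mathcal{L}\,b\Leftrightarrow Sa=Sb$. An $\mathcal{R}$- (respectively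 $\mathcal{L}$-) cross-section of $S$ is a subsemigroup of $S$ containing exactly one element from each $\mathcal{R}$- (respectively $\mathcal{L}$-) class. *)

theory Defs
  imports "HOL-Algebra.Coset" "HOL-Library.Multiset"
begin

(* Semigroups are HOL-Algebra monoid records; all the notions below except the two
   monoids themselves ignore the unit field. *)

(* Maps act on the right and compose from left to right, so the product of a and b is
   "first a, then b", whereas (\<circ>\<^sub>m) composes from right to left. *)
definition IS :: "nat \<Rightarrow> (nat \<rightharpoonup> nat) monoid" where
  "IS n =
     \<lparr>carrier = {a. dom a \<subseteq> {1..n} \<and> ran a \<subseteq> {1..n} \<and> inj_on a (dom a)},
      monoid.mult = (\<lambda>a b. b \<circ>\<^sub>m a),
      one = (\<lambda>x. if x \<in> {1..n} then Some x else None)\<rparr>"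

(* A function from dom a to S is a map f with dom f = dom a and ran f in the carrier of S. *)
definition partial_wreath ::
    "('s, 'b) monoid_scheme \<Rightarrow> nat \<Rightarrow> ((nat \<rightharpoonup> 's) \<times> (nat \<rightharpoonup> nat)) monoid" where
  "partial_wreath S n =
     \<lparr>carrier = {(f, a). a \<in> carrier (IS n) \<and> dom f = dom a \<and> ran f \<subseteq> carrier S},
      monoid.mult = (\<lambda>(f, a) (g, b).
        (\<lambda>x. if x \<in> dom (a \<otimes>\<^bsub>IS n\<^esub> b)
             then Some (the (f x) \<otimes>\<^bsub>S\<^esub> the (g (the (a x)))) else None,
         a \<otimes>\<^bsub>IS n\<^esub> b)),
      one = (\<lambda>x. if x \<in> {1..n} then Some \<one>\<^bsub>S\<^esub> else None, \<one>\<^bsub>IS n\<^esub>)\<rparr>"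

definition green_R :: "('s, 'b) monoid_scheme \<Rightarrow> ('s \<times> 's) set" where
  "green_R S = {(a, b). a \<in> carrier S \<and> b \<in> carrier S \<and>
                        a <#\<^bsub>S\<^esub> carrier S = b <#\<^bsub>S\<^esub> carrier S}"

definition green_L :: "('s, 'b) monoid_scheme \<Rightarrow> ('s \<times> 's) set" where
  "green_L S = {(a, b). a \<in> carrier S \<and> b \<in> carrier S \<and>
                        carrier S #>\<^bsub>S\<^esub> a = carrier S #>\<^bsub>S\<^esub> b}"

definition subsemigroup :: "'s set \<Rightarrow> ('s, 'b) monoid_scheme \<Rightarrow> bool" where
  "subsemigroup T S \<longleftrightarrow>
     T \<noteq> {} \<and> T \<subseteq> carrier S \<and> (\<forall>x\<in>T. \<forall>y\<in>T. x \<otimes>\<^bsub>S\<^esub> y \<in> T)"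

definition R_cross_sections :: "('s, 'b) monoid_scheme \<Rightarrow> 's set set" where
  "R_cross_sections S =
     {T. subsemigroup T S \<and> (\<forall>C \<in> carrier S // green_R S. \<exists>!x. x \<in> T \<inter> C)}"

definition L_cross_sections :: "('s, 'b) monoid_scheme \<Rightarrow> 's set set" where
  "L_cross_sections S =
     {T. subsemigroup T S \<and> (\<forall>C \<in> carrier S // green_L S. \<exists>!x. x \<in> T \<inter> C)}"

(* The relation is_iso of HOL-Algebra asks for a bijection of the carriers preserving the
   product only, i.e. a semigroup isomorphism; T and U need not contain the unit of S. *)
definition iso_classes :: "('s, 'b) monoid_scheme \<Rightarrow> 's set set \<Rightarrow> 's set set set" where
  "iso_classes S A =
     A // {(T, U). T \<in> A \<and> U \<in> A \<and> S\<lparr>carrier := T\<rparr> \<cong> S\<lparr>carrier := U\<rparr>}"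

definition num_partitions :: "nat \<Rightarrow> nat" where
  "num_partitions m = card {M :: nat multiset. (\<forall>k \<in># M. 0 < k) \<and> \<Sum>\<^sub># M = m}"

end

theory Submission
  imports Defs
begin

text \<open>
Elements of the wreath product act on the two-level forest whose roots are \<open>1, ..., n\<close>, each
carrying the leaves \<open>1, ..., m\<close>: a pair \<open>(f, a)\<close> moves the root \<open>x\<close> to \<open>x a\<close> and the leaf \<open>y\<close>
over \<open>x\<close> to the leaf \<open>y f(x)\<close> over \<open>x a\<close>. This identifies the wreath product with the semigroup
\<open>forest_maps\<close> of all isomorphisms between downsets of the forest (\<open>forest_act_iso\<close>). There two
elements are \<open>\<R>\<close>-related iff they have the same domain, so an \<open>\<R>\<close>-cross-section is a
subsemigroup containing exactly one map for each downset. Inversion is an anti-automorphism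
exchanging \<open>\<R>\<close> with \<open>\<L>\<close>, so both counts agree (\<open>card_cross_sections_forest\<close>).

Such a family of maps must be a family of compressions. In the one-level case, write \<open>r D\<close>
for the map with domain \<open>D\<close>. Restricting to singletons splits the points into blocks, each with
a root. The sets \<open>D\<close> with \<open>r D = id\<close> form, inside one block, a chain with one member of each
size (\<open>levels_chain\<close>, \<open>ex_lower_level\<close>), hence they order the block linearly, and \<open>r D\<close> pushes
each \<open>D\<close> down to an initial segment of every block while preserving order (\<open>key_compress\<close>).
In the two-level case the roots form one such system, every fibre carries a system of its own,
and the maps with full fibres identify the fibre over \<open>x\<close> with the fibre over the root of the
block of \<open>x\<close>, carrying one system to the other (\<open>cross_section_compressions\<close>). Conversely,
compressions always form a cross-section (\<open>compressions_cross_section\<close>).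

A cross-section therefore amounts to a partition of the roots into linearly ordered blocks and,
for each block, a partition of the leaves into linearly ordered blocks. Only the sizes matter up
to isomorphism: the shape is the multiset of pairs (size of a block, partition of \<open>m\<close>). Equal
shapes give cross-sections conjugate under an automorphism of the forest (\<open>same_shape_iso\<close>).
Conversely the shape can be read off from the abstract semigroup: blocks correspond to minimal
nonzero idempotents, leaf blocks over them to certain idempotents directly above, and sizes
to numbers of elements with a given right identity (\<open>semigroup_shape_compressions\<close>). So the
isomorphism classes are counted by the multisets of pairs \<open>(i, \<lambda>)\<close> with \<open>\<lambda>\<close> a partition
of \<open>m\<close> and first components summing to \<open>n\<close>; sorting a multiset by first components, \<open>j\<^sub>i\<close> of
which equal \<open>i\<close>, gives the stated sum of products of multiset coefficients
(\<open>card_forest_shapes\<close>).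
\<close>

section \<open>Transporting cross-sections along isomorphisms\<close>

text \<open>Classes of an equivalence that is the kernel of a map correspond to the values of the map.\<close>
lemma card_quotient_by_map:
  assumes "finite (f ` A)"
    and "\<And>x y. x \<in> A \<Longrightarrow> y \<in> A \<Longrightarrow> R x y \<longleftrightarrow> f x = f y"
  shows "card (A // {(x, y). x \<in> A \<and> y \<in> A \<and> R x y}) = card (f ` A)"
proof -
  let ?E = "{(x, y). x \<in> A \<and> y \<in> A \<and> R x y}"
  have cls: "?E `` {x} = {y \<in> A. f y = f x}" if "x \<in> A" for x
    using that assms(2) by auto
  have "A // ?E = (\<lambda>v. {y \<in> A. f y = v}) ` (f ` A)"
    unfolding quotient_def using cls by (auto simp: image_iff)
  moreover have "inj_on (\<lambda>v. {y \<in> A. f y = v}) (f ` A)"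
    by (intro inj_onI) blast
  ultimately show ?thesis by (simp add: card_image)
qed

lemma card_quotient_transfer:
  assumes "bij_betw F A B"
    and "\<And>x y. x \<in> A \<Longrightarrow> y \<in> A \<Longrightarrow> R x y \<longleftrightarrow> R' (F x) (F y)"
  shows "card (A // {(x, y). x \<in> A \<and> y \<in> A \<and> R x y}) =
         card (B // {(x, y). x \<in> B \<and> y \<in> B \<and> R' x y})"
proof -
  let ?E = "{(x, y). x \<in> A \<and> y \<in> A \<and> R x y}"
  let ?E' = "{(x, y). x \<in> B \<and> y \<in> B \<and> R' x y}"
  have B: "B = F ` A" and inj: "inj_on F A"
    using assms(1) by (auto simp: bij_betw_def)
  have cls: "?E' `` {F x} = F ` (?E `` {x})" if "x \<in> A" for x
    using that assms(2) by (auto simp: B image_iff)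
  have "B // ?E' = (\<lambda>x. ?E' `` {F x}) ` A"
    unfolding quotient_def B by blast
  also have "\<dots> = (\<lambda>x. F ` (?E `` {x})) ` A"
    by (rule image_cong[OF refl cls])
  also have "\<dots> = (`) F ` (A // ?E)"
    unfolding quotient_def by blast
  finally have "B // ?E' = (`) F ` (A // ?E)" .
  moreover have "inj_on ((`) F) (A // ?E)"
  proof (rule inj_on_subset)
    show "inj_on ((`) F) (Pow A)" by (rule inj_on_image_Pow[OF inj])
    show "A // ?E \<subseteq> Pow A" by (auto simp: quotient_def)
  qed
  ultimately show ?thesis by (simp add: card_image)
qed

text \<open>Stating the condition for elements instead of classes avoids transporting quotients.\<close>
lemma R_cross_sections_iff:
  "T \<in> R_cross_sections S \<longleftrightarrow>
     subsemigroup T S \<and> (\<forall>a\<in>carrier S. \<exists>!x. x \<in> T \<and> x <#\<^bsub>S\<^esub> carrier S = a <#\<^bsub>S\<^esub> carrier S)"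
proof (cases "subsemigroup T S")
  case True
  then have "T \<subseteq> carrier S" by (simp add: subsemigroup_def)
  then have "(x \<in> T \<inter> green_R S `` {a}) \<longleftrightarrow>
      (x \<in> T \<and> x <#\<^bsub>S\<^esub> carrier S = a <#\<^bsub>S\<^esub> carrier S)" if "a \<in> carrier S" for x a
    using that by (auto simp: green_R_def)
  then show ?thesis
    unfolding R_cross_sections_def quotient_def using True by auto
qed (simp add: R_cross_sections_def)

text \<open>Reversing the product turns \<open>\<L>\<close> into \<open>\<R>\<close>, so every statement about \<open>\<R>\<close>-cross-sections
  has its \<open>\<L>\<close>-version for free.\<close>
definition opposite :: "('s, 'b) monoid_scheme \<Rightarrow> ('s, 'b) monoid_scheme" where
  "opposite S = S\<lparr>monoid.mult := \<lambda>x y. y \<otimes>\<^bsub>S\<^esub> x\<rparr>"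

lemma opposite_simps [simp]:
  "carrier (opposite S) = carrier S"
  "x \<otimes>\<^bsub>opposite S\<^esub> y = y \<otimes>\<^bsub>S\<^esub> x"
  by (simp_all add: opposite_def)

lemma L_cross_sections_opposite: "L_cross_sections S = R_cross_sections (opposite S)"
proof -
  have "green_L S = green_R (opposite S)"
    by (simp add: green_L_def green_R_def l_coset_def r_coset_def)
  moreover have "subsemigroup T S \<longleftrightarrow> subsemigroup T (opposite S)" for T
    by (auto simp: subsemigroup_def)
  ultimately show ?thesis
    by (simp add: L_cross_sections_def R_cross_sections_def)
qed

lemma iso_opposite_iff:
  "h \<in> iso (opposite G) (opposite H) \<longleftrightarrow> h \<in> iso G H"
  by (auto simp: iso_def hom_def)

lemma iso_classes_opposite: "iso_classes (opposite S) A = iso_classes S A"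
proof -
  have "(opposite S)\<lparr>carrier := T\<rparr> \<cong> (opposite S)\<lparr>carrier := U\<rparr> \<longleftrightarrow>
        S\<lparr>carrier := T\<rparr> \<cong> S\<lparr>carrier := U\<rparr>" for T U
  proof -
    have "(opposite S)\<lparr>carrier := V\<rparr> = opposite (S\<lparr>carrier := V\<rparr>)" for V
      by (simp add: opposite_def)
    then show ?thesis by (simp only: is_iso_def ex_in_conv[symmetric] iso_opposite_iff)
  qed
  then show ?thesis by (simp add: iso_classes_def)
qed

lemma iso_set_sym_closed:
  assumes "h \<in> iso G H" and closed: "\<And>x y. x \<in> carrier G \<Longrightarrow> y \<in> carrier G \<Longrightarrow> x \<otimes>\<^bsub>G\<^esub> y \<in> carrier G"
  shows "inv_into (carrier G) h \<in> iso H G"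
proof -
  let ?k = "inv_into (carrier G) h"
  have bij: "bij_betw h (carrier G) (carrier H)"
    and hom: "\<And>x y. x \<in> carrier G \<Longrightarrow> y \<in> carrier G \<Longrightarrow> h (x \<otimes>\<^bsub>G\<^esub> y) = h x \<otimes>\<^bsub>H\<^esub> h y"
    using assms(1) by (auto simp: iso_def hom_def)
  have bij': "bij_betw ?k (carrier H) (carrier G)"
    by (rule bij_betw_inv_into[OF bij])
  have "?k (u \<otimes>\<^bsub>H\<^esub> v) = ?k u \<otimes>\<^bsub>G\<^esub> ?k v" if uv: "u \<in> carrier H" "v \<in> carrier H" for u v
  proof -
    obtain x y where xy: "x \<in> carrier G" "y \<in> carrier G" "u = h x" "v = h y"
      using uv unfolding bij_betw_imp_surj_on[OF bij, symmetric] by blast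
    then show ?thesis
      using bij closed[OF xy(1,2)] hom[OF xy(1,2), symmetric]
      by (simp add: bij_betw_inv_into_left)
  qed
  then show ?thesis
    using bij' by (auto simp: iso_def hom_def bij_betw_def)
qed

lemma iso_image_restrict:
  assumes "h \<in> iso G H" "T \<subseteq> carrier G"
  shows "h \<in> iso (G\<lparr>carrier := T\<rparr>) (H\<lparr>carrier := h ` T\<rparr>)"
  using assms by (auto simp: iso_def hom_def bij_betw_def inj_on_subset subset_iff)

lemma is_iso_image_iff:
  assumes h: "h \<in> iso G H" and T: "subsemigroup T G" and U: "subsemigroup U G"
  shows "H\<lparr>carrier := h ` T\<rparr> \<cong> H\<lparr>carrier := h ` U\<rparr> \<longleftrightarrow> G\<lparr>carrier := T\<rparr> \<cong> G\<lparr>carrier := U\<rparr>"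
proof -
  have to: "G\<lparr>carrier := V\<rparr> \<cong> H\<lparr>carrier := h ` V\<rparr>" if "subsemigroup V G" for V
    using is_isoI[OF iso_image_restrict[OF h]] that unfolding subsemigroup_def by blast
  have from_: "H\<lparr>carrier := h ` V\<rparr> \<cong> G\<lparr>carrier := V\<rparr>" if V: "subsemigroup V G" for V
  proof -
    have "h \<in> iso (G\<lparr>carrier := V\<rparr>) (H\<lparr>carrier := h ` V\<rparr>)"
      using iso_image_restrict[OF h] V unfolding subsemigroup_def by blast
    then show ?thesis
      by (rule is_isoI[OF iso_set_sym_closed]) (use V in \<open>simp add: subsemigroup_def\<close>)
  qed
  show ?thesis
    proof
    assume "H\<lparr>carrier := h ` T\<rparr> \<cong> H\<lparr>carrier := h ` U\<rparr>"
    from iso_trans[OF iso_trans[OF to[OF T] this] from_[OF U]]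
    show "G\<lparr>carrier := T\<rparr> \<cong> G\<lparr>carrier := U\<rparr>" .
  next
    assume "G\<lparr>carrier := T\<rparr> \<cong> G\<lparr>carrier := U\<rparr>"
    from iso_trans[OF iso_trans[OF from_[OF T] this] to[OF U]]
    show "H\<lparr>carrier := h ` T\<rparr> \<cong> H\<lparr>carrier := h ` U\<rparr>" .
  qed
qed

lemma R_cross_section_image:
  assumes h: "h \<in> iso G H" and closed: "\<And>x y. x \<in> carrier G \<Longrightarrow> y \<in> carrier G \<Longrightarrow> x \<otimes>\<^bsub>G\<^esub> y \<in> carrier G"
    and T: "T \<in> R_cross_sections G"
  shows "h ` T \<in> R_cross_sections H"
proof -
  have inj: "inj_on h (carrier G)" and surj: "h ` carrier G = carrier H"
    and hom: "\<And>x y. x \<in> carrier G \<Longrightarrow> y \<in> carrier G \<Longrightarrow> h (x \<otimes>\<^bsub>G\<^esub> y) = h x \<otimes>\<^bsub>H\<^esub> h y"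
    using h by (auto simp: iso_def hom_def bij_betw_def)
  have T': "T \<subseteq> carrier G" "T \<noteq> {}" "\<And>x y. x \<in> T \<Longrightarrow> y \<in> T \<Longrightarrow> x \<otimes>\<^bsub>G\<^esub> y \<in> T"
    and ex1: "\<And>a. a \<in> carrier G \<Longrightarrow> \<exists>!x. x \<in> T \<and> x <#\<^bsub>G\<^esub> carrier G = a <#\<^bsub>G\<^esub> carrier G"
    using T by (auto simp: R_cross_sections_iff subsemigroup_def)
  have coset: "h a <#\<^bsub>H\<^esub> carrier H = h ` (a <#\<^bsub>G\<^esub> carrier G)" if "a \<in> carrier G" for a
  proof -
    have "h a <#\<^bsub>H\<^esub> carrier H = (\<lambda>x. h a \<otimes>\<^bsub>H\<^esub> h x) ` carrier G"
      unfolding l_coset_def surj[symmetric] by blast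
    also have "\<dots> = (\<lambda>x. h (a \<otimes>\<^bsub>G\<^esub> x)) ` carrier G"
      by (rule image_cong[OF refl]) (simp add: hom that)
    finally show ?thesis unfolding l_coset_def by blast
  qed
  have sub: "a <#\<^bsub>G\<^esub> carrier G \<subseteq> carrier G" if "a \<in> carrier G" for a
    using that closed by (auto simp: l_coset_def)
  have eq: "h a <#\<^bsub>H\<^esub> carrier H = h b <#\<^bsub>H\<^esub> carrier H \<longleftrightarrow> a <#\<^bsub>G\<^esub> carrier G = b <#\<^bsub>G\<^esub> carrier G"
    if "a \<in> carrier G" "b \<in> carrier G" for a b
    unfolding coset[OF that(1)] coset[OF that(2)]
    by (rule inj_on_image_eq_iff[OF inj sub[OF that(1)] sub[OF that(2)]])
  have "\<exists>!y. y \<in> h ` T \<and> y <#\<^bsub>H\<^esub> carrier H = b <#\<^bsub>H\<^esub> carrier H" if b: "b \<in> carrier H" for b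
  proof -
    obtain a where a: "a \<in> carrier G" "b = h a" using b surj by auto
    obtain x where x: "x \<in> T" "x <#\<^bsub>G\<^esub> carrier G = a <#\<^bsub>G\<^esub> carrier G"
      and uniq: "\<And>x'. x' \<in> T \<Longrightarrow> x' <#\<^bsub>G\<^esub> carrier G = a <#\<^bsub>G\<^esub> carrier G \<Longrightarrow> x' = x"
      using ex1[OF a(1)] by blast
    show ?thesis
    proof (rule ex1I[of _ "h x"])
      show "h x \<in> h ` T \<and> h x <#\<^bsub>H\<^esub> carrier H = b <#\<^bsub>H\<^esub> carrier H"
        using x a T'(1) eq[of x a] by blast
      show "y = h x" if y: "y \<in> h ` T \<and> y <#\<^bsub>H\<^esub> carrier H = b <#\<^bsub>H\<^esub> carrier H" for y
      proof -
        obtain x' where x': "x' \<in> T" "y = h x'" using y by auto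
        have "x' <#\<^bsub>G\<^esub> carrier G = a <#\<^bsub>G\<^esub> carrier G"
          using y x' a T'(1) eq[of x' a] by auto
        with x' uniq show ?thesis by simp
      qed
    qed
  qed
  moreover have "subsemigroup (h ` T) H"
    unfolding subsemigroup_def
  proof (intro conjI ballI)
    show "h ` T \<noteq> {}" using T'(2) by blast
    show "h ` T \<subseteq> carrier H" unfolding surj[symmetric] using T'(1) by blast
    fix u v assume "u \<in> h ` T" "v \<in> h ` T"
    then obtain x y where "x \<in> T" "y \<in> T" "u = h x" "v = h y" by auto
    moreover from this have "h (x \<otimes>\<^bsub>G\<^esub> y) = u \<otimes>\<^bsub>H\<^esub> v" using T'(1) hom[of x y] by blast
    ultimately show "u \<otimes>\<^bsub>H\<^esub> v \<in> h ` T" using T'(3)[of x y] by (metis imageI)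
  qed
  ultimately show ?thesis by (simp add: R_cross_sections_iff)
qed

lemma card_iso_classes_transfer:
  assumes h: "h \<in> iso G H" and closed: "\<And>x y. x \<in> carrier G \<Longrightarrow> y \<in> carrier G \<Longrightarrow> x \<otimes>\<^bsub>G\<^esub> y \<in> carrier G"
  shows "card (iso_classes G (R_cross_sections G)) = card (iso_classes H (R_cross_sections H))"
proof -
  have inj: "inj_on h (carrier G)" and surj: "h ` carrier G = carrier H"
    and hom: "\<And>x y. x \<in> carrier G \<Longrightarrow> y \<in> carrier G \<Longrightarrow> h (x \<otimes>\<^bsub>G\<^esub> y) = h x \<otimes>\<^bsub>H\<^esub> h y"
    using h by (auto simp: iso_def hom_def bij_betw_def)
  let ?k = "inv_into (carrier G) h"
  have k: "?k \<in> iso H G" by (rule iso_set_sym_closed[OF h closed])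
  have closedH: "u \<otimes>\<^bsub>H\<^esub> v \<in> carrier H" if uv: "u \<in> carrier H" "v \<in> carrier H" for u v
  proof -
    obtain x y where xy: "x \<in> carrier G" "y \<in> carrier G" "u = h x" "v = h y"
      using uv unfolding surj[symmetric] by blast
    then have "u \<otimes>\<^bsub>H\<^esub> v = h (x \<otimes>\<^bsub>G\<^esub> y)" by (simp add: hom)
    then show ?thesis using closed[OF xy(1,2)] surj by blast
  qed
  have "(`) h ` R_cross_sections G = R_cross_sections H"
  proof
    show "(`) h ` R_cross_sections G \<subseteq> R_cross_sections H"
      using R_cross_section_image[OF h closed] by blast
    show "R_cross_sections H \<subseteq> (`) h ` R_cross_sections G"
    proof
      fix U assume U: "U \<in> R_cross_sections H"
      then have "U \<subseteq> h ` carrier G" using surj by (auto simp: R_cross_sections_def subsemigroup_def)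
      then have "h ` ?k ` U = U" by (rule image_inv_into_cancel[OF refl])
      moreover have "?k ` U \<in> R_cross_sections G"
        by (rule R_cross_section_image[OF k closedH U])
      ultimately show "U \<in> (`) h ` R_cross_sections G" by (metis imageI)
    qed
  qed
  moreover have "inj_on ((`) h) (R_cross_sections G)"
  proof (rule inj_on_subset[OF inj_on_image_Pow[OF inj]])
    show "R_cross_sections G \<subseteq> Pow (carrier G)"
      by (auto simp: R_cross_sections_def subsemigroup_def)
  qed
  ultimately have "bij_betw ((`) h) (R_cross_sections G) (R_cross_sections H)"
    by (simp add: bij_betw_def)
  then show ?thesis
    unfolding iso_classes_def
    by (rule card_quotient_transfer)
      (rule is_iso_image_iff[OF h, symmetric]; simp add: R_cross_sections_def)
qed

section \<open>The forest model of the wreath product\<close>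

(* In this section quantifiers over points of the forest range over single variables. *)
declare split_paired_All [simp del] split_paired_Ex [simp del]

type_synonym point = "nat \<times> nat option"

text \<open>\<open>(x, None)\<close> is the root \<open>x\<close>, and \<open>(x, Some y)\<close> is the leaf \<open>y\<close> over \<open>x\<close>. Roots need points of
  their own: a pair \<open>(f, a)\<close> with \<open>f(x)\<close> empty differs from one with \<open>x\<close> outside \<open>dom a\<close>, and only
  the root can tell them apart.\<close>
definition points :: "nat \<Rightarrow> nat \<Rightarrow> point set" where
  "points m n = {1..n} \<times> insert None (Some ` {1..m})"

definition forest_maps :: "nat \<Rightarrow> nat \<Rightarrow> (point \<rightharpoonup> point) monoid" where
  "forest_maps m n =
     \<lparr>carrier = {\<alpha>. dom \<alpha> \<subseteq> points m n \<and> ran \<alpha> \<subseteq> points m n \<and>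
        (\<forall>p p' q. \<alpha> p = Some q \<longrightarrow> \<alpha> p' = Some q \<longrightarrow> p = p') \<and>
        (\<forall>x z x' z'. \<alpha> (x, z) = Some (x', z') \<longrightarrow>
           \<alpha> (x, None) = Some (x', None) \<and> (z' = None \<longleftrightarrow> z = None))},
      monoid.mult = (\<lambda>a b. b \<circ>\<^sub>m a),
      one = (\<lambda>p. if p \<in> points m n then Some p else None)\<rparr>"

lemma forest_mult [simp]: "a \<otimes>\<^bsub>forest_maps m n\<^esub> b = b \<circ>\<^sub>m a"
  by (simp add: forest_maps_def)

lemma forest_carrierD:
  assumes "\<alpha> \<in> carrier (forest_maps m n)"
  shows "\<alpha> p = Some q \<Longrightarrow> p \<in> points m n"
    and "\<alpha> p = Some q \<Longrightarrow> q \<in> points m n"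
    and "\<alpha> p = Some q \<Longrightarrow> \<alpha> p' = Some q \<Longrightarrow> p = p'"
    and "\<alpha> (x, z) = Some (x', z') \<Longrightarrow> \<alpha> (x, None) = Some (x', None)"
    and "\<alpha> (x, z) = Some (x', z') \<Longrightarrow> z' = None \<longleftrightarrow> z = None"
  using assms unfolding forest_maps_def by (simp_all add: dom_def ran_def subset_iff) blast+

lemma forest_carrierI:
  assumes "\<And>p q. \<alpha> p = Some q \<Longrightarrow> p \<in> points m n \<and> q \<in> points m n"
    and "\<And>p p' q. \<alpha> p = Some q \<Longrightarrow> \<alpha> p' = Some q \<Longrightarrow> p = p'"
    and "\<And>x z x' z'. \<alpha> (x, z) = Some (x', z') \<Longrightarrow>
           \<alpha> (x, None) = Some (x', None) \<and> (z' = None \<longleftrightarrow> z = None)"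
  shows "\<alpha> \<in> carrier (forest_maps m n)"
  unfolding forest_maps_def using assms by (auto simp: dom_def ran_def)

lemma forest_closed:
  assumes "\<alpha> \<in> carrier (forest_maps m n)" "\<beta> \<in> carrier (forest_maps m n)"
  shows "\<beta> \<circ>\<^sub>m \<alpha> \<in> carrier (forest_maps m n)"
proof (rule forest_carrierI)
  show "p \<in> points m n \<and> q \<in> points m n" if "(\<beta> \<circ>\<^sub>m \<alpha>) p = Some q" for p q
    using that forest_carrierD(1)[OF assms(1)] forest_carrierD(2)[OF assms(2)]
    unfolding map_comp_Some_iff by blast
  show "p = p'" if "(\<beta> \<circ>\<^sub>m \<alpha>) p = Some q" "(\<beta> \<circ>\<^sub>m \<alpha>) p' = Some q" for p p' q
    using that forest_carrierD(3)[OF assms(1)] forest_carrierD(3)[OF assms(2)]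
    unfolding map_comp_Some_iff by blast
  fix x z x' z' assume "(\<beta> \<circ>\<^sub>m \<alpha>) (x, z) = Some (x', z')"
  then obtain u w where "\<alpha> (x, z) = Some (u, w)" "\<beta> (u, w) = Some (x', z')"
    by (auto simp: map_comp_Some_iff)
  then show "(\<beta> \<circ>\<^sub>m \<alpha>) (x, None) = Some (x', None) \<and> (z' = None \<longleftrightarrow> z = None)"
    using forest_carrierD(4,5)[OF assms(1)] forest_carrierD(4,5)[OF assms(2)]
    unfolding map_comp_Some_iff by blast
qed

lemma map_eqI: "(\<And>p q. a p = Some q \<longleftrightarrow> b p = Some q) \<Longrightarrow> a = b"
  by (rule ext) (metis option.exhaust)

text \<open>\<open>the (f x)\<close> is meaningful because \<open>f\<close> and \<open>a\<close> have the same domain and \<open>a x\<close> is examined first.\<close>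
definition forest_act :: "(nat \<rightharpoonup> (nat \<rightharpoonup> nat)) \<times> (nat \<rightharpoonup> nat) \<Rightarrow> point \<rightharpoonup> point" where
  "forest_act = (\<lambda>(f, a) (x, z). case a x of None \<Rightarrow> None
     | Some x' \<Rightarrow> (case z of None \<Rightarrow> Some (x', None)
         | Some y \<Rightarrow> map_option (\<lambda>y'. (x', Some y')) (the (f x) y)))"

lemma forest_act_None [simp]:
  "forest_act (f, a) (x, None) = Some q \<longleftrightarrow> (\<exists>x'. a x = Some x' \<and> q = (x', None))"
  by (auto simp: forest_act_def split: option.splits)

lemma forest_act_Some [simp]:
  "forest_act (f, a) (x, Some y) = Some q \<longleftrightarrow>
     (\<exists>x' y'. a x = Some x' \<and> the (f x) y = Some y' \<and> q = (x', Some y'))"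
  by (auto simp: forest_act_def split: option.splits)

text \<open>The action is faithful since \<open>a\<close> is visible on the roots and \<open>f(x)\<close> on the leaves over \<open>x\<close>; it
  reaches every forest map since such a map determines an \<open>a\<close> and an \<open>f\<close> in the same way.\<close>
lemma forest_act_iso: "forest_act \<in> iso (partial_wreath (IS m) n) (forest_maps m n)"
proof -
  let ?S = "partial_wreath (IS m) n" and ?F = "forest_maps m n"
  have IS_D: "x \<in> {1..k} \<and> x' \<in> {1..k}" "a u = Some x' \<Longrightarrow> u = x"
    if "a \<in> carrier (IS k)" "a x = Some x'" for a x x' u k
    using that by (auto simp: IS_def dom_def ran_def inj_on_def)
  have f_D: "\<exists>g \<in> carrier (IS m). f x = Some g"
    if "(f, a) \<in> carrier ?S" "a x = Some x'" for f a x x'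
  proof -
    have "x \<in> dom f" using that by (auto simp: partial_wreath_def)
    moreover have "ran f \<subseteq> carrier (IS m)" using that by (auto simp: partial_wreath_def)
    ultimately show ?thesis by (auto simp: ran_def)
  qed
  have a_D: "a \<in> carrier (IS n)" "dom f = dom a" if "(f, a) \<in> carrier ?S" for f a
    using that by (auto simp: partial_wreath_def)
  have mem: "forest_act s \<in> carrier ?F" if "s \<in> carrier ?S" for s
  proof -
    obtain f a where s: "s = (f, a)" by (cases s)
    note fa = that[unfolded s]
    show ?thesis unfolding s
    proof (rule forest_carrierI)
      fix p q assume pq: "forest_act (f, a) p = Some q"
      obtain x z where p: "p = (x, z)" by (cases p)
      show "p \<in> points m n \<and> q \<in> points m n"
      proof (cases z)
        case None
        then show ?thesis using pq p IS_D(1)[OF a_D(1)[OF fa]] by (auto simp: points_def)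
      next
        case (Some y)
        then obtain x' y' where xy: "a x = Some x'" "the (f x) y = Some y'" "q = (x', Some y')"
          using pq p by auto
        then show ?thesis using f_D[OF fa xy(1)] p Some IS_D(1)[OF a_D(1)[OF fa] xy(1)] IS_D(1)[of _ m y y']
          by (auto simp: points_def)
      qed
    next
      fix p p' q assume pq: "forest_act (f, a) p = Some q" "forest_act (f, a) p' = Some q"
      obtain x z u w where p: "p = (x, z)" "p' = (u, w)" by (cases p, cases p')
      have "a x = Some (fst q)" "a u = Some (fst q)"
        using pq unfolding p by (cases z; cases w; auto)+
      then have xu: "x = u" using IS_D(2)[OF a_D(1)[OF fa]] by blast
      show "p = p'"
      proof (cases z)
        case None
        then show ?thesis using pq p xu by (cases w) auto
      next
        case (Some y)
        obtain g where g: "g \<in> carrier (IS m)" "f x = Some g" using f_D[OF fa \<open>a x = _\<close>] by blast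
        from Some show ?thesis using pq p xu g IS_D(2)[OF g(1)] by (cases w) auto
      qed
    next
      show "forest_act (f, a) (x, None) = Some (x', None) \<and> (z' = None \<longleftrightarrow> z = None)"
        if "forest_act (f, a) (x, z) = Some (x', z')" for x z x' z'
        using that by (cases z) auto
    qed
  qed
  have hom: "forest_act (s \<otimes>\<^bsub>?S\<^esub> t) = forest_act s \<otimes>\<^bsub>?F\<^esub> forest_act t"
    if "s \<in> carrier ?S" "t \<in> carrier ?S" for s t
  proof -
    obtain f a g b where s: "s = (f, a)" "t = (g, b)" by (cases s, cases t)
    have "forest_act (s \<otimes>\<^bsub>?S\<^esub> t) p = Some q \<longleftrightarrow> (forest_act s \<otimes>\<^bsub>?F\<^esub> forest_act t) p = Some q" for p q
    proof -
      obtain x z where p: "p = (x, z)" by (cases p)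
      show ?thesis
        by (cases z) (auto simp: s p partial_wreath_def IS_def map_comp_Some_iff domIff)
    qed
    then show ?thesis by (rule map_eqI)
  qed
  have inj: "inj_on forest_act (carrier ?S)"
  proof (rule inj_onI)
    fix s t assume st: "s \<in> carrier ?S" "t \<in> carrier ?S" and eq: "forest_act s = forest_act t"
    obtain f a g b where s: "s = (f, a)" "t = (g, b)" by (cases s, cases t)
    have "a x = Some x' \<longleftrightarrow> b x = Some x'" for x x'
      using forest_act_None[of f a x "(x', None)"] forest_act_None[of g b x "(x', None)"] eq[unfolded s]
      by simp
    then have ab: "a = b" by (rule map_eqI)
    have doms: "dom f = dom a" "dom g = dom a" using a_D st[unfolded s] ab by auto
    have "f x = g x" for x
    proof (cases "a x")
      case None
      then show ?thesis using doms by (metis domIff)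
    next
      case (Some x')
      have "the (f x) y = Some y' \<longleftrightarrow> the (g x) y = Some y'" for y y'
      proof -
        have "forest_act (f, a) (x, Some y) = forest_act (g, b) (x, Some y)" using eq s by simp
        then have "map_option (\<lambda>u. (x', Some u)) (the (f x) y) = map_option (\<lambda>u. (x', Some u)) (the (g x) y)"
          using Some ab by (simp add: forest_act_def)
        then show ?thesis by (cases "the (f x) y"; cases "the (g x) y") auto
      qed
      then have "the (f x) = the (g x)" by (rule map_eqI)
      then show ?thesis using Some doms by (metis domD domI option.sel)
    qed
    then show "s = t" using ab s by auto
  qed
  have surj: "\<alpha> \<in> forest_act ` carrier ?S" if \<alpha>: "\<alpha> \<in> carrier ?F" for \<alpha>
  proof -
    define a where "a x = map_option fst (\<alpha> (x, None))" for x
    define f where "f x = map_option (\<lambda>_ y. Option.bind (\<alpha> (x, Some y)) snd) (\<alpha> (x, None))" for x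
    note D = forest_carrierD[OF \<alpha>]
    have a_iff: "a x = Some x' \<longleftrightarrow> \<alpha> (x, None) = Some (x', None)" for x x'
      using D(5)[of x None] by (auto simp: a_def)
    have f_iff: "(\<exists>g. f x = Some g \<and> g y = Some y') \<longleftrightarrow> (\<exists>x'. \<alpha> (x, Some y) = Some (x', Some y'))"
      for x y y'
      using D(4)[of x "Some y"] by (fastforce simp: f_def bind_eq_Some_conv)
    have a1: "x \<in> {1..n} \<and> x' \<in> {1..n}" if "a x = Some x'" for x x'
      using that D(1,2)[of "(x, None)" "(x', None)"] by (simp add: a_iff points_def)
    have a2: "x = u" if "a x = Some x'" "a u = Some x'" for x u x'
      using that D(3)[of "(x, None)" "(x', None)" "(u, None)"] by (simp add: a_iff)
    have a: "a \<in> carrier (IS n)"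
      unfolding IS_def using a1 a2 by (auto simp: dom_def ran_def inj_on_def)
    have g: "g \<in> carrier (IS m)" if "f x = Some g" for g x
    proof -
      have *: "\<exists>x'. \<alpha> (x, Some y) = Some (x', Some y') \<and> \<alpha> (x, None) = Some (x', None)" if "g y = Some y'" for y y'
        using f_iff[of x y y'] that \<open>f x = Some g\<close> D(4) by blast
      have 1: "y \<in> {1..m} \<and> y' \<in> {1..m}" if "g y = Some y'" for y y'
        using *[OF that] D(1,2) by (fastforce simp: points_def)
      have 2: "y = u" if "g y = Some y'" "g u = Some y'" for y u y'
        using *[OF that(1)] *[OF that(2)] D(3) by fastforce
      show ?thesis unfolding IS_def using 1 2 by (auto simp: dom_def ran_def inj_on_def)
    qed
    have "(f, a) \<in> carrier ?S"
      using a g by (auto simp: partial_wreath_def ran_def f_def a_def dom_def)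
    moreover have "forest_act (f, a) = \<alpha>"
    proof (rule map_eqI)
      fix p q :: point
      obtain x z x' z' where p: "p = (x, z)" "q = (x', z')" by (cases p, cases q)
      show "forest_act (f, a) p = Some q \<longleftrightarrow> \<alpha> p = Some q"
      proof (cases z)
        case None
        then show ?thesis using D(5)[of x None x' z'] by (auto simp: p a_iff)
      next
        case (Some y)
        have "\<alpha> (x, None) = Some (x', None) \<Longrightarrow> f x \<noteq> None" by (simp add: f_def)
        then show ?thesis using Some f_iff[of x y] D(4,5)[of x "Some y"]
          by (fastforce simp: p a_iff)
      qed
    qed
    ultimately show ?thesis by (metis image_eqI)
  qed
  show ?thesis
    using mem hom inj surj by (auto simp: iso_def hom_def bij_betw_def)
qed

definition map_inverse :: "('a \<rightharpoonup> 'a) \<Rightarrow> 'a \<rightharpoonup> 'a" where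
  "map_inverse \<alpha> q = (if \<exists>p. \<alpha> p = Some q then Some (SOME p. \<alpha> p = Some q) else None)"

lemma map_inverse_iff:
  assumes "\<alpha> \<in> carrier (forest_maps m n)"
  shows "map_inverse \<alpha> q = Some p \<longleftrightarrow> \<alpha> p = Some q"
proof
  assume "map_inverse \<alpha> q = Some p"
  then show "\<alpha> p = Some q"
    unfolding map_inverse_def by (auto split: if_splits intro: someI)
next
  assume "\<alpha> p = Some q"
  moreover have "(SOME p. \<alpha> p = Some q) = p"
    using \<open>\<alpha> p = Some q\<close> forest_carrierD(3)[OF assms] by blast
  ultimately show "map_inverse \<alpha> q = Some p" unfolding map_inverse_def by auto
qed

lemma map_inverse_closed:
  assumes "\<alpha> \<in> carrier (forest_maps m n)"
  shows "map_inverse \<alpha> \<in> carrier (forest_maps m n)"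
proof (rule forest_carrierI, unfold map_inverse_iff[OF assms])
  note D = forest_carrierD[OF assms]
  show "p \<in> points m n \<and> q \<in> points m n" if "\<alpha> q = Some p" for p q
    using that D(1,2) by blast
  show "p = p'" if "\<alpha> q = Some p" "\<alpha> q = Some p'" for p p' q
    using that by simp
  show "\<alpha> (x', None) = Some (x, None) \<and> (z' = None \<longleftrightarrow> z = None)"
    if "\<alpha> (x', z') = Some (x, z)" for x z x' z'
    using D(4,5)[OF that] by simp
qed

text \<open>Inversion reverses products, so it identifies the semigroup with its opposite.\<close>
lemma map_inverse_iso: "map_inverse \<in> iso (opposite (forest_maps m n)) (forest_maps m n)"
proof -
  let ?F = "forest_maps m n"
  have inv_inv: "map_inverse (map_inverse \<alpha>) = \<alpha>" if "\<alpha> \<in> carrier ?F" for \<alpha>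
    by (rule map_eqI)
      (simp add: map_inverse_iff[OF that] map_inverse_iff[OF map_inverse_closed[OF that]])
  have "bij_betw map_inverse (carrier ?F) (carrier ?F)"
    by (rule bij_betw_byWitness[where f' = map_inverse])
      (auto simp: inv_inv map_inverse_closed)
  moreover have "map_inverse (\<beta> \<circ>\<^sub>m \<alpha>) = map_inverse \<alpha> \<circ>\<^sub>m map_inverse \<beta>"
    if "\<alpha> \<in> carrier ?F" "\<beta> \<in> carrier ?F" for \<alpha> \<beta>
    by (rule map_eqI)
      (auto simp: map_inverse_iff[OF forest_closed[OF that]] map_comp_Some_iff
        map_inverse_iff[OF that(1)] map_inverse_iff[OF that(2)])
  ultimately show ?thesis
    by (auto simp: iso_def hom_def map_inverse_closed)
qed

text \<open>If \<open>dom \<alpha> \<subseteq> dom \<beta>\<close>, then \<open>\<beta>\<close> followed by its inverse and \<open>\<alpha>\<close> is \<open>\<alpha>\<close>, so \<open>\<alpha>\<close> is a right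
  multiple of \<open>\<beta>\<close>; a product never has a larger domain than its first factor.\<close>
lemma forest_coset_eq_iff:
  assumes "\<alpha> \<in> carrier (forest_maps m n)" "\<beta> \<in> carrier (forest_maps m n)"
  shows "\<alpha> <#\<^bsub>forest_maps m n\<^esub> carrier (forest_maps m n) =
           \<beta> <#\<^bsub>forest_maps m n\<^esub> carrier (forest_maps m n) \<longleftrightarrow> dom \<alpha> = dom \<beta>"
proof -
  let ?F = "forest_maps m n"
  have one: "(\<lambda>p. if p \<in> points m n then Some p else None) \<in> carrier ?F"
    by (rule forest_carrierI) (auto simp: points_def split: if_splits)
  have self: "\<alpha> \<in> \<alpha> <#\<^bsub>?F\<^esub> carrier ?F" if "\<alpha> \<in> carrier ?F" for \<alpha>
  proof -
    have "\<alpha> = (\<lambda>p. if p \<in> points m n then Some p else None) \<circ>\<^sub>m \<alpha>"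
      by (rule map_eqI) (auto simp: map_comp_Some_iff dest: forest_carrierD(2)[OF that])
    then show ?thesis using one by (auto simp: l_coset_def)
  qed
  have dom_le: "dom \<gamma> \<subseteq> dom \<alpha>" if "\<gamma> \<in> \<alpha> <#\<^bsub>?F\<^esub> carrier ?F" for \<alpha> \<gamma>
    using that by (auto simp: l_coset_def map_comp_Some_iff)
  have le: "\<alpha> <#\<^bsub>?F\<^esub> carrier ?F \<subseteq> \<beta> <#\<^bsub>?F\<^esub> carrier ?F"
    if "\<alpha> \<in> carrier ?F" "\<beta> \<in> carrier ?F" "dom \<alpha> \<subseteq> dom \<beta>" for \<alpha> \<beta>
  proof
    fix \<gamma> assume "\<gamma> \<in> \<alpha> <#\<^bsub>?F\<^esub> carrier ?F"
    then obtain \<delta> where \<delta>: "\<delta> \<in> carrier ?F" "\<gamma> = \<delta> \<circ>\<^sub>m \<alpha>" by (auto simp: l_coset_def)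
    have "\<gamma> = (\<delta> \<circ>\<^sub>m (\<alpha> \<circ>\<^sub>m map_inverse \<beta>)) \<circ>\<^sub>m \<beta>"
    proof (rule map_eqI)
      fix p q
      show "\<gamma> p = Some q \<longleftrightarrow> ((\<delta> \<circ>\<^sub>m (\<alpha> \<circ>\<^sub>m map_inverse \<beta>)) \<circ>\<^sub>m \<beta>) p = Some q"
        using that(3) forest_carrierD(3)[OF that(2)]
        by (fastforce simp: \<delta> map_comp_Some_iff map_inverse_iff[OF that(2)])
    qed
    moreover have "\<delta> \<circ>\<^sub>m (\<alpha> \<circ>\<^sub>m map_inverse \<beta>) \<in> carrier ?F"
      by (intro forest_closed map_inverse_closed that \<delta>)
    ultimately show "\<gamma> \<in> \<beta> <#\<^bsub>?F\<^esub> carrier ?F" by (auto simp: l_coset_def)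
  qed
  show ?thesis
    using le[OF assms] le[OF assms(2,1)] self[OF assms(1)] self[OF assms(2)] dom_le by blast
qed

definition downsets :: "nat \<Rightarrow> nat \<Rightarrow> point set set" where
  "downsets m n = {D. D \<subseteq> points m n \<and> (\<forall>(x, z)\<in>D. (x, None) \<in> D)}"

lemma dom_downset: "\<alpha> \<in> carrier (forest_maps m n) \<Longrightarrow> dom \<alpha> \<in> downsets m n"
  unfolding downsets_def using forest_carrierD(1,4) by fastforce

definition id_map :: "'a set \<Rightarrow> 'a \<rightharpoonup> 'a" where
  "id_map D p = (if p \<in> D then Some p else None)"

lemma id_map_iff [simp]: "id_map D p = Some q \<longleftrightarrow> p \<in> D \<and> q = p"
  by (auto simp: id_map_def)

lemma dom_id_map [simp]: "dom (id_map D) = D"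
  by (auto simp: id_map_def dom_def)

lemma id_map_closed: "D \<in> downsets m n \<Longrightarrow> id_map D \<in> carrier (forest_maps m n)"
  by (rule forest_carrierI) (auto simp: downsets_def)

lemma forest_R_cross_sections:
  "T \<in> R_cross_sections (forest_maps m n) \<longleftrightarrow>
     T \<subseteq> carrier (forest_maps m n) \<and> (\<forall>\<alpha>\<in>T. \<forall>\<beta>\<in>T. \<beta> \<circ>\<^sub>m \<alpha> \<in> T) \<and>
     (\<forall>D\<in>downsets m n. \<exists>!\<alpha>. \<alpha> \<in> T \<and> dom \<alpha> = D)"
proof (cases "T \<subseteq> carrier (forest_maps m n)")
  case True
  let ?F = "forest_maps m n"
  have 1: "(\<forall>a\<in>carrier ?F. \<exists>!x. x \<in> T \<and> x <#\<^bsub>?F\<^esub> carrier ?F = a <#\<^bsub>?F\<^esub> carrier ?F) \<longleftrightarrow>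
        (\<forall>a\<in>carrier ?F. \<exists>!x. x \<in> T \<and> dom x = dom a)"
    using True forest_coset_eq_iff by (intro ball_cong refl arg_cong[of _ _ Ex1] ext) blast
  also have "\<dots> \<longleftrightarrow> (\<forall>D\<in>downsets m n. \<exists>!\<alpha>. \<alpha> \<in> T \<and> dom \<alpha> = D)"
  proof
    assume *: "\<forall>a\<in>carrier ?F. \<exists>!x. x \<in> T \<and> dom x = dom a"
    show "\<forall>D\<in>downsets m n. \<exists>!\<alpha>. \<alpha> \<in> T \<and> dom \<alpha> = D"
      using *[rule_format, OF id_map_closed] by simp
  qed (simp add: dom_downset)
  finally have 2: "(\<forall>a\<in>carrier ?F. \<exists>!x. x \<in> T \<and> x <#\<^bsub>?F\<^esub> carrier ?F = a <#\<^bsub>?F\<^esub> carrier ?F) \<longleftrightarrow>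
     (\<forall>D\<in>downsets m n. \<exists>!\<alpha>. \<alpha> \<in> T \<and> dom \<alpha> = D)" .
  have "{} \<in> downsets m n" by (simp add: downsets_def)
  then have "T \<noteq> {}" if "\<forall>D\<in>downsets m n. \<exists>!\<alpha>. \<alpha> \<in> T \<and> dom \<alpha> = D"
    using that by blast
  then show ?thesis
    unfolding R_cross_sections_iff subsemigroup_def 2 using True by auto
qed (auto simp: R_cross_sections_iff subsemigroup_def)

text \<open>For \<open>\<L>\<close> the identification runs through the opposite of the wreath product, the opposite
  of the forest semigroup, and inversion.\<close>
lemma card_cross_sections_forest:
  "card (iso_classes (partial_wreath (IS m) n) (R_cross_sections (partial_wreath (IS m) n))) =
     card (iso_classes (forest_maps m n) (R_cross_sections (forest_maps m n)))" (is ?R)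
  "card (iso_classes (partial_wreath (IS m) n) (L_cross_sections (partial_wreath (IS m) n))) =
     card (iso_classes (forest_maps m n) (R_cross_sections (forest_maps m n)))" (is ?L)
proof -
  let ?S = "partial_wreath (IS m) n" and ?F = "forest_maps m n"
  have h: "inv_into (carrier ?S) forest_act \<in> iso ?F ?S" if "\<And>x y. x \<in> carrier ?S \<Longrightarrow> y \<in> carrier ?S \<Longrightarrow> x \<otimes>\<^bsub>?S\<^esub> y \<in> carrier ?S"
    by (rule iso_set_sym_closed[OF forest_act_iso that])
  have IS_closed: "b \<circ>\<^sub>m a \<in> carrier (IS k)" if "a \<in> carrier (IS k)" "b \<in> carrier (IS k)" for a b k
    using that by (fastforce simp: IS_def dom_def ran_def inj_on_def map_comp_Some_iff)
  have S_closed: "x \<otimes>\<^bsub>?S\<^esub> y \<in> carrier ?S" if xy: "x \<in> carrier ?S" "y \<in> carrier ?S" for x y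
  proof -
    obtain f a g b where s: "x = (f, a)" "y = (g, b)" by (cases x, cases y)
    have ab: "a \<in> carrier (IS n)" "b \<in> carrier (IS n)" "dom f = dom a" "dom g = dom b"
      "ran f \<subseteq> carrier (IS m)" "ran g \<subseteq> carrier (IS m)"
      using xy s by (auto simp: partial_wreath_def)
    have el: "the (g (the (a u))) \<circ>\<^sub>m the (f u) \<in> carrier (IS m)" if uv: "(b \<circ>\<^sub>m a) u = Some v" for u v
    proof -
      obtain w where w: "a u = Some w" "b w = Some v" using uv by (auto simp: map_comp_Some_iff)
      then have "u \<in> dom f" "w \<in> dom g" using ab(3,4) by auto
      then obtain f' g' where "f u = Some f'" "g w = Some g'" by blast
      then show ?thesis using w ab(5,6) by (auto simp: ran_def intro!: IS_closed)
    qed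
    let ?h = "\<lambda>u. if u \<in> dom (b \<circ>\<^sub>m a) then Some (the (g (the (a u))) \<circ>\<^sub>m the (f u)) else None"
    have "a' \<otimes>\<^bsub>IS k\<^esub> b' = b' \<circ>\<^sub>m a'" for a' b' k by (simp add: IS_def)
    then have "x \<otimes>\<^bsub>?S\<^esub> y = (?h, b \<circ>\<^sub>m a)"
      by (simp add: s partial_wreath_def cong: if_cong)
    moreover have "dom ?h = dom (b \<circ>\<^sub>m a)" by (auto simp: dom_def)
    moreover have "ran ?h \<subseteq> carrier (IS m)"
      using el by (auto simp: ran_def domIff split: if_splits)
    ultimately show ?thesis
      using IS_closed[OF ab(1,2)] by (simp add: partial_wreath_def)
  qed
  show ?R by (rule card_iso_classes_transfer[OF forest_act_iso S_closed])
  have op: "forest_act \<in> iso (opposite ?S) (opposite ?F)"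
    by (simp add: iso_opposite_iff forest_act_iso)
  have "card (iso_classes ?S (L_cross_sections ?S)) =
        card (iso_classes (opposite ?S) (R_cross_sections (opposite ?S)))"
    by (simp add: L_cross_sections_opposite iso_classes_opposite)
  also have "\<dots> = card (iso_classes (opposite ?F) (R_cross_sections (opposite ?F)))"
    by (rule card_iso_classes_transfer[OF op]) (simp add: S_closed)
  also have "\<dots> = card (iso_classes ?F (R_cross_sections ?F))"
    by (rule card_iso_classes_transfer[OF map_inverse_iso]) (simp add: forest_closed)
  finally show ?L .
qed

declare split_paired_All [simp] split_paired_Ex [simp]

section \<open>One level: families of compressions of a finite set\<close>

text \<open>A key \<open>\<kappa> x = (b, j)\<close> places \<open>x\<close> in the block \<open>b\<close> at position \<open>j\<close>; the rank is the position that
  \<open>x\<close> takes when \<open>D\<close> is pushed down to an initial segment of its block.\<close>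
definition rank :: "('a \<Rightarrow> 'c \<times> nat) \<Rightarrow> 'a set \<Rightarrow> 'a \<Rightarrow> nat" where
  "rank \<kappa> D x = card {y \<in> D. fst (\<kappa> y) = fst (\<kappa> x) \<and> snd (\<kappa> y) < snd (\<kappa> x)}"

text \<open>The positions in a block fill an initial segment of the natural numbers.\<close>
definition chart :: "'a set \<Rightarrow> ('a \<Rightarrow> 'c \<times> nat) \<Rightarrow> bool" where
  "chart X \<kappa> \<longleftrightarrow> inj_on \<kappa> X \<and> (\<forall>x\<in>X. \<forall>j < snd (\<kappa> x). (fst (\<kappa> x), j) \<in> \<kappa> ` X)"

text \<open>This is an \<open>\<R>\<close>-cross-section of the partial injections of \<open>X\<close>, written as the family of its
  members \<open>r D\<close> indexed by their domains: the composite of \<open>r D\<close> and \<open>r E\<close> has to be the member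
  with the same domain. Values of \<open>r D\<close> outside \<open>D\<close> are arbitrary.\<close>
locale compression_system =
  fixes X :: "'a set" and r :: "'a set \<Rightarrow> 'a \<Rightarrow> 'a"
  assumes finite_X: "finite X"
    and inj: "D \<subseteq> X \<Longrightarrow> inj_on (r D) D"
    and into: "D \<subseteq> X \<Longrightarrow> x \<in> D \<Longrightarrow> r D x \<in> X"
    and comp: "D \<subseteq> X \<Longrightarrow> E \<subseteq> X \<Longrightarrow> x \<in> D \<Longrightarrow> r D x \<in> E \<Longrightarrow> r E (r D x) = r {y \<in> D. r D y \<in> E} x"
begin

definition fixed :: "'a set set" where
  "fixed = {D. D \<subseteq> X \<and> (\<forall>x\<in>D. r D x = x)}"

definition root :: "'a \<Rightarrow> 'a" where
  "root x = r {x} x"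

definition levels :: "'a \<Rightarrow> 'a set set" where
  "levels b = {D \<in> fixed. \<forall>x\<in>D. root x = b}"

text \<open>A member of the family that maps its domain to itself equals its own square, because both have
  the same domain. Being injective, it is then the identity.\<close>
lemma fixedI:
  assumes "D \<subseteq> X" "\<And>x. x \<in> D \<Longrightarrow> r D x \<in> D"
  shows "D \<in> fixed"
proof -
  have "r D x = x" if x: "x \<in> D" for x
  proof -
    have "{y \<in> D. r D y \<in> D} = D" using assms(2) by blast
    then have "r D (r D x) = r D x" using comp[OF assms(1,1) x assms(2)[OF x]] by simp
    then show ?thesis using inj_onD[OF inj[OF assms(1)]] assms(2)[OF x] x by blast
  qed
  then show ?thesis using assms(1) by (simp add: fixed_def)
qed

lemma restrict_fixed:
  assumes "F \<in> fixed" "D \<subseteq> X" "x \<in> F" "x \<in> D"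
  shows "r (F \<inter> D) x = r D x"
proof -
  have F: "F \<subseteq> X" "\<And>y. y \<in> F \<Longrightarrow> r F y = y" using assms(1) by (auto simp: fixed_def)
  have "{y \<in> F. r F y \<in> D} = F \<inter> D" using F(2) by auto
  then show ?thesis using comp[OF F(1) assms(2,3)] F(2)[OF assms(3)] assms(4) by simp
qed

text \<open>Restricting \<open>r D\<close> to \<open>C\<close> differs from \<open>r C\<close> only by the member that compresses the image.\<close>
lemma sub_image:
  assumes "C \<subseteq> D" "D \<subseteq> X" "x \<in> C"
  shows "r (r D ` C) (r D x) = r C x"
proof -
  have "{y \<in> D. r D y \<in> r D ` C} = C"
    using assms(1) inj_onD[OF inj[OF assms(2)]] by blast
  moreover have "r D ` C \<subseteq> X" using into assms by blast
  ultimately show ?thesis using comp[of D "r D ` C" x] assms by auto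
qed

lemma image_fixed: "D \<subseteq> X \<Longrightarrow> r D ` D \<in> fixed"
  using sub_image[of D D] into by (auto simp: fixed_def)

lemma root_image: "D \<subseteq> X \<Longrightarrow> x \<in> D \<Longrightarrow> root (r D x) = root x"
  using sub_image[of "{x}" D x] by (simp add: root_def)

lemma image_levels:
  assumes "D \<subseteq> X" "\<And>x. x \<in> D \<Longrightarrow> root x = b"
  shows "r D ` D \<in> levels b"
  using image_fixed[OF assms(1)] root_image[OF assms(1)] assms(2) by (auto simp: levels_def)

lemma finite_levels: "A \<in> levels b \<Longrightarrow> finite A"
  using finite_X by (auto simp: levels_def fixed_def intro: finite_subset)

text \<open>If two fixed sets of one block were incomparable, witnessed by \<open>a\<close> and \<open>c\<close>, then \<open>r {a, c}\<close>
  would have to agree with \<open>r {a}\<close> at \<open>a\<close> and with \<open>r {c}\<close> at \<open>c\<close>. It would send both points to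
  the root of the block and not be injective.\<close>
lemma levels_chain:
  assumes "A \<in> levels b" "B \<in> levels b"
  shows "A \<subseteq> B \<or> B \<subseteq> A"
proof (rule ccontr)
  assume "\<not> ?thesis"
  then obtain a c where ac: "a \<in> A" "a \<notin> B" "c \<in> B" "c \<notin> A" by blast
  have AB: "A \<in> fixed" "B \<in> fixed" "root a = b" "root c = b" using assms ac by (auto simp: levels_def)
  have X: "{a, c} \<subseteq> X" using AB ac by (auto simp: fixed_def)
  have "A \<inter> {a, c} = {a}" "B \<inter> {a, c} = {c}" using ac by auto
  then have "r {a, c} a = root a" "r {a, c} c = root c"
    using restrict_fixed[OF AB(1) X ac(1)] restrict_fixed[OF AB(2) X ac(3)] by (simp_all add: root_def)
  then have "a = c" using inj_onD[OF inj[OF X], of a c] AB by simp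
  then show False using ac by simp
qed

lemma levels_card_subset:
  assumes "A \<in> levels b" "B \<in> levels b" "card A \<le> card B"
  shows "A \<subseteq> B"
  using levels_chain[OF assms(1,2)] assms(3) card_seteq[OF finite_levels[OF assms(1)], of B] by blast

text \<open>Take the smallest fixed set \<open>B\<close> of the block that contains \<open>x\<close>. The image of \<open>B - {x}\<close> is a
  fixed set with one element less; as fixed sets form a chain it is \<open>B - {x}\<close> itself.\<close>
lemma ex_lower_level:
  assumes "x \<in> X"
  shows "\<exists>A. A \<in> levels (root x) \<and> x \<notin> A \<and> insert x A \<in> levels (root x)"
proof -
  let ?M = "{y \<in> X. root y = root x}"
  have "?M \<in> fixed" by (rule fixedI) (auto simp: root_image into)
  then have M: "?M \<in> levels (root x) \<and> x \<in> ?M" using assms by (auto simp: levels_def)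
  obtain B where B: "B \<in> levels (root x) \<and> x \<in> B"
    and min: "\<And>B'. B' \<in> levels (root x) \<and> x \<in> B' \<Longrightarrow> card B \<le> card B'"
    using ex_has_least_nat[of "\<lambda>B. B \<in> levels (root x) \<and> x \<in> B" ?M card, OF M] by auto
  define D where "D = B - {x}"
  have fB: "finite B" using B finite_levels by blast
  have D: "D \<subseteq> X" "\<And>y. y \<in> D \<Longrightarrow> root y = root x"
    using B unfolding D_def levels_def fixed_def by blast+
  define A where "A = r D ` D"
  have A: "A \<in> levels (root x)" unfolding A_def by (rule image_levels[OF D])
  have cA: "card A = card B - 1"
    unfolding A_def using card_image[OF inj[OF D(1)]] B fB by (simp add: D_def)
  have cB: "card B > 0" using B fB card_gt_0_iff by blast
  have "x \<notin> A" using min[of A] A cA cB by auto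
  have "A \<subseteq> B" using levels_card_subset[OF A _] B cA by simp
  then have "insert x A = B"
    using \<open>x \<notin> A\<close> B cA cB fB by (intro card_seteq) (auto simp: finite_subset)
  then show ?thesis using A B \<open>x \<notin> A\<close> by blast
qed

text \<open>The points strictly below \<open>x\<close> in the linear order that the chain of fixed sets puts on its block.\<close>
definition lower :: "'a \<Rightarrow> 'a set" where
  "lower x = (SOME A. A \<in> levels (root x) \<and> x \<notin> A \<and> insert x A \<in> levels (root x))"

lemma lower:
  assumes "x \<in> X"
  shows "lower x \<in> levels (root x)" "x \<notin> lower x" "insert x (lower x) \<in> levels (root x)"
  using someI_ex[OF ex_lower_level[OF assms]] unfolding lower_def by auto

lemma lower_unique:
  assumes "x \<in> X" "A \<in> levels (root x)" "x \<notin> A" "insert x A \<in> levels (root x)"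
  shows "A = lower x"
  using levels_chain[OF assms(2) lower(3)[OF assms(1)]] levels_chain[OF lower(1)[OF assms(1)] assms(4)]
    assms(3) lower(2)[OF assms(1)] by blast

lemma in_lower_iff:
  assumes "x \<in> X" "y \<in> X" "root y = root x"
  shows "y \<in> lower x \<longleftrightarrow> card (lower y) < card (lower x)"
proof
  note lx = lower[OF assms(1)] and ly = lower[OF assms(2), unfolded assms(3)]
  {
    assume "y \<in> lower x"
    then have "lower y \<subset> lower x" using levels_chain[OF lx(1) ly(1)] ly(2) by blast
    then show "card (lower y) < card (lower x)" by (rule psubset_card_mono[OF finite_levels[OF lx(1)]])
  next
    assume "card (lower y) < card (lower x)"
    then have "card (insert y (lower y)) \<le> card (lower x)"
      using ly(2) finite_levels[OF ly(1)] by simp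
    then show "y \<in> lower x" using levels_card_subset[OF ly(3) lx(1)] by blast
  }
qed

definition key :: "'a \<Rightarrow> 'a \<times> nat" where
  "key x = (root x, card (lower x))"

lemma inj_key: "inj_on key X"
proof (rule inj_onI)
  fix x y assume xy: "x \<in> X" "y \<in> X" and eq: "key x = key y"
  have r: "root y = root x" and c: "card (lower y) = card (lower x)" using eq by (auto simp: key_def)
  note lx = lower[OF xy(1)] and ly = lower[OF xy(2), unfolded r]
  have "lower x = lower y"
    using levels_card_subset[OF lx(1) ly(1)] levels_card_subset[OF ly(1) lx(1)] c by simp
  moreover have "insert x (lower x) \<subseteq> insert y (lower y)"
    using levels_card_subset[OF lx(3) ly(3)] lx(2) ly(2) c finite_levels[OF lx(1)] finite_levels[OF ly(1)]
    by simp
  ultimately show "x = y" using lx(2) by blast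
qed

lemma chart_key: "chart X key"
  unfolding chart_def
proof (intro conjI ballI allI impI inj_key)
  fix x j assume x: "x \<in> X" and j: "j < snd (key x)"
  note lx = lower[OF x]
  have sub: "lower x \<subseteq> X" and r: "\<And>y. y \<in> lower x \<Longrightarrow> root y = root x"
    using lx(1) by (auto simp: levels_def fixed_def)
  let ?c = "\<lambda>y. card (lower y)"
  have "inj_on ?c (lower x)"
  proof (rule inj_onI)
    fix u v assume uv: "u \<in> lower x" "v \<in> lower x" "?c u = ?c v"
    then have "key u = key v" using r by (simp add: key_def)
    then show "u = v" using inj_onD[OF inj_key] uv sub by blast
  qed
  moreover have "?c ` lower x \<subseteq> {..<card (lower x)}" using in_lower_iff[OF x] sub r by blast
  ultimately have "?c ` lower x = {..<card (lower x)}"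
    by (intro card_seteq) (simp_all add: card_image)
  moreover have "j \<in> {..<card (lower x)}" using j by (simp add: key_def)
  ultimately obtain y where y: "y \<in> lower x" "card (lower y) = j" by (metis imageE)
  then show "(fst (key x), j) \<in> key ` X"
    using sub r[OF y(1)] by (intro image_eqI[of _ _ y]) (auto simp: key_def)
qed

text \<open>Since \<open>lower x\<close> and \<open>insert x (lower x)\<close> are fixed, \<open>r D\<close> maps the part of \<open>D\<close> inside each of
  them onto a fixed set. These images differ by the single point \<open>r D x\<close>, whose position is hence
  the size of the smaller one.\<close>
lemma key_compress:
  assumes "D \<subseteq> X" "x \<in> D"
  shows "key (r D x) = (fst (key x), rank key D x)"
proof -
  have x: "x \<in> X" using assms by blast
  note lx = lower[OF x]
  define D1 where "D1 = lower x \<inter> D"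
  have f: "lower x \<in> fixed" "insert x (lower x) \<in> fixed" using lx(1,3) by (auto simp: levels_def)
  have sub: "D1 \<subseteq> D" "D1 \<subseteq> X" "x \<notin> D1" using assms lx(2) by (auto simp: D1_def)
  have r: "\<And>y. y \<in> lower x \<Longrightarrow> root y = root x" and lX: "lower x \<subseteq> X"
    using lx(1) by (auto simp: levels_def fixed_def)
  have D2: "insert x (lower x) \<inter> D = insert x D1" using assms(2) by (auto simp: D1_def)
  have e1: "r D1 y = r D y" if "y \<in> D1" for y
    using restrict_fixed[OF f(1) assms(1), of y] that by (simp add: D1_def)
  have e2: "r (insert x D1) y = r D y" if "y \<in> insert x D1" for y
    using restrict_fixed[OF f(2) assms(1), of y, unfolded D2] that assms(2) sub(1)
    by (auto simp: D1_def)
  have "r D1 ` D1 \<in> levels (root x)" by (rule image_levels[OF sub(2)]) (simp add: D1_def r)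
  then have l1: "r D ` D1 \<in> levels (root x)" using e1 by simp
  have "r (insert x D1) ` insert x D1 \<in> levels (root x)"
    using sub(2) x by (intro image_levels) (auto simp: D1_def r)
  then have l2: "insert (r D x) (r D ` D1) \<in> levels (root x)"
    using e2 by (metis (no_types, lifting) image_cong image_insert)
  have rt: "root (r D x) = root x" by (rule root_image[OF assms])
  have notin: "r D x \<notin> r D ` D1"
    using inj_onD[OF inj[OF assms(1)]] assms(2) sub by blast
  have "r D ` D1 = lower (r D x)"
    by (rule lower_unique) (use l1 l2 rt notin into[OF assms] in simp_all)
  then have "card (lower (r D x)) = card D1"
    using card_image[OF inj_on_subset[OF inj[OF assms(1)] sub(1)]] by simp
  moreover have "{y \<in> D. fst (key y) = fst (key x) \<and> snd (key y) < snd (key x)} = D1"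
    using in_lower_iff[OF x] r assms(1) lX by (auto simp: key_def D1_def)
  ultimately show ?thesis by (simp add: key_def rt rank_def)
qed

end

section \<open>Two levels: every cross-section consists of compressions\<close>

(* Keeps the intervals {1..n} in the form in which they are written. *)
declare One_nat_def [simp del]

definition base :: "point set \<Rightarrow> nat set" where
  "base D = {x. (x, None) \<in> D}"

definition fibre :: "point set \<Rightarrow> nat \<Rightarrow> nat set" where
  "fibre D x = {y. (x, Some y) \<in> D}"

text \<open>\<open>\<kappa>\<close> orders the roots in blocks and \<open>\<nu> x\<close> orders the leaves over \<open>x\<close>. Inside a block of roots the
  leaf charts have the same image, which identifies the fibres with each other.\<close>
definition forest_chart :: "nat \<Rightarrow> nat \<Rightarrow> (nat \<Rightarrow> nat \<times> nat) \<Rightarrow> (nat \<Rightarrow> nat \<Rightarrow> nat \<times> nat) \<Rightarrow> bool" where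
  "forest_chart m n \<kappa> \<nu> \<longleftrightarrow> chart {1..n} \<kappa> \<and> (\<forall>x\<in>{1..n}. chart {1..m} (\<nu> x)) \<and>
     (\<forall>x\<in>{1..n}. \<forall>x'\<in>{1..n}. fst (\<kappa> x) = fst (\<kappa> x') \<longrightarrow> \<nu> x ` {1..m} = \<nu> x' ` {1..m})"

text \<open>The maps that push roots, and leaves over each root, down to initial segments of their blocks.
  The leaves move from the fibre over \<open>x\<close> to the fibre over \<open>x'\<close>, so their keys are compared
  across the charts \<open>\<nu> x\<close> and \<open>\<nu> x'\<close>.\<close>
definition compressions :: "nat \<Rightarrow> nat \<Rightarrow> (nat \<Rightarrow> nat \<times> nat) \<Rightarrow> (nat \<Rightarrow> nat \<Rightarrow> nat \<times> nat) \<Rightarrow> (point \<rightharpoonup> point) set" where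
  "compressions m n \<kappa> \<nu> = {\<alpha> \<in> carrier (forest_maps m n).
     (\<forall>x x'. \<alpha> (x, None) = Some (x', None) \<longrightarrow> \<kappa> x' = (fst (\<kappa> x), rank \<kappa> (base (dom \<alpha>)) x)) \<and>
     (\<forall>x y x' y'. \<alpha> (x, Some y) = Some (x', Some y') \<longrightarrow>
        \<nu> x' y' = (fst (\<nu> x y), rank (\<nu> x) (fibre (dom \<alpha>) x) y))}"

locale forest_cross_section =
  fixes m n :: nat and T :: "(point \<rightharpoonup> point) set"
  assumes T: "T \<in> R_cross_sections (forest_maps m n)"
begin

abbreviation "N \<equiv> {1..n}"
abbreviation "M \<equiv> {1..m}"
abbreviation "P \<equiv> points m n"
abbreviation "\<D> \<equiv> downsets m n"

lemma T_sub: "\<alpha> \<in> T \<Longrightarrow> \<alpha> \<in> carrier (forest_maps m n)"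
  and T_closed: "\<alpha> \<in> T \<Longrightarrow> \<beta> \<in> T \<Longrightarrow> \<beta> \<circ>\<^sub>m \<alpha> \<in> T"
  and T_ex1: "D \<in> \<D> \<Longrightarrow> \<exists>!\<alpha>. \<alpha> \<in> T \<and> dom \<alpha> = D"
  using T unfolding forest_R_cross_sections by auto

definition t :: "point set \<Rightarrow> point \<rightharpoonup> point" where
  "t D = (THE \<alpha>. \<alpha> \<in> T \<and> dom \<alpha> = D)"

definition r :: "point set \<Rightarrow> point \<Rightarrow> point" where
  "r D p = the (t D p)"

lemma t: "D \<in> \<D> \<Longrightarrow> t D \<in> T" "D \<in> \<D> \<Longrightarrow> dom (t D) = D"
  using theI'[OF T_ex1] unfolding t_def by auto

lemma t_unique: "\<alpha> \<in> T \<Longrightarrow> t (dom \<alpha>) = \<alpha>"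
  unfolding t_def using T_ex1[OF dom_downset[OF T_sub]] by (intro the1_equality) auto

lemma t_eq: "D \<in> \<D> \<Longrightarrow> p \<in> D \<Longrightarrow> t D p = Some (r D p)"
  using t(2)[of D] domD[of p "t D"] unfolding r_def by auto

lemma r_inj: "D \<in> \<D> \<Longrightarrow> inj_on (r D) D"
  using forest_carrierD(3)[OF T_sub[OF t(1)]] t_eq by (metis inj_onI)

lemma r_points: "D \<in> \<D> \<Longrightarrow> p \<in> D \<Longrightarrow> r D p \<in> P"
  using forest_carrierD(2)[OF T_sub[OF t(1)]] t_eq by blast

lemma r_fst:
  assumes "D \<in> \<D>" "(x, z) \<in> D"
  shows "r D (x, None) = (fst (r D (x, z)), None)"
proof -
  have "t D (x, z) = Some (fst (r D (x, z)), snd (r D (x, z)))" using t_eq[OF assms] by simp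
  from forest_carrierD(4)[OF T_sub[OF t(1)[OF assms(1)]] this] show ?thesis by (simp add: r_def)
qed

lemma r_snd:
  assumes "D \<in> \<D>" "(x, z) \<in> D"
  shows "snd (r D (x, z)) = None \<longleftrightarrow> z = None"
proof -
  have "t D (x, z) = Some (fst (r D (x, z)), snd (r D (x, z)))" using t_eq[OF assms] by simp
  from forest_carrierD(5)[OF T_sub[OF t(1)[OF assms(1)]] this] show ?thesis .
qed

lemma r_comp:
  assumes "D \<in> \<D>" "E \<in> \<D>" "p \<in> D" "r D p \<in> E"
  shows "r E (r D p) = r {q \<in> D. r D q \<in> E} p"
proof -
  let ?\<gamma> = "t E \<circ>\<^sub>m t D"
  have "dom ?\<gamma> = {q \<in> D. r D q \<in> E}"
  proof (rule Set.set_eqI)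
    fix q
    show "q \<in> dom ?\<gamma> \<longleftrightarrow> q \<in> {q \<in> D. r D q \<in> E}"
    proof (cases "q \<in> D")
      case True
      then have "?\<gamma> q = t E (r D q)" using t_eq[OF assms(1)] by (simp add: map_comp_def)
      then show ?thesis using True t(2)[OF assms(2)] by (metis (no_types, lifting) domIff mem_Collect_eq)
    next
      case False
      then have "t D q = None" using t(2)[OF assms(1)] by (metis domIff)
      then show ?thesis using False by (simp add: map_comp_def domIff)
    qed
  qed
  moreover have "t (dom ?\<gamma>) = ?\<gamma>" by (rule t_unique[OF T_closed[OF t(1) t(1)]]) fact+
  ultimately have "r {q \<in> D. r D q \<in> E} p = the (?\<gamma> p)" by (simp add: r_def)
  then show ?thesis using t_eq[OF assms(1,3)] t_eq[OF assms(2,4)] by (simp add: map_comp_def)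
qed

lemma r_fixed:
  assumes "D \<in> \<D>" "\<And>q. q \<in> D \<Longrightarrow> r D q \<in> D" "p \<in> D"
  shows "r D p = p"
proof -
  have "{q \<in> D. r D q \<in> D} = D" using assms(2) by blast
  then have "r D (r D p) = r D p" using r_comp[OF assms(1,1,3) assms(2)[OF assms(3)]] by simp
  then show ?thesis using inj_onD[OF r_inj[OF assms(1)]] assms(2,3) by blast
qed

text \<open>The member with domain \<open>F\<close> is an identity, so multiplying by it restricts domains.\<close>
lemma r_restrict:
  assumes "F \<in> \<D>" "\<And>q. q \<in> F \<Longrightarrow> r F q \<in> F" "D \<in> \<D>" "p \<in> F" "p \<in> D"
  shows "r (F \<inter> D) p = r D p"
proof -
  have id: "r F q = q" if "q \<in> F" for q by (rule r_fixed[OF assms(1) _ that]) (rule assms(2))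
  have "{q \<in> F. r F q \<in> D} = F \<inter> D" using id by auto
  then show ?thesis using r_comp[OF assms(1,3,4)] id[OF assms(4)] assms(5) by simp
qed

text \<open>The map induced on the roots; by \<open>r_base\<close> it depends only on the roots in the domain, because
  the set of all roots is fixed.\<close>
definition a :: "nat set \<Rightarrow> nat \<Rightarrow> nat" where
  "a A x = fst (r (A \<times> {None}) (x, None))"

lemma base_downset: "A \<subseteq> N \<Longrightarrow> A \<times> {None} \<in> \<D>"
  by (auto simp: downsets_def points_def)

lemma r_base:
  assumes "D \<in> \<D>" "(x, None) \<in> D"
  shows "r D (x, None) = (a (base D) x, None)"
proof -
  have N0: "N \<times> {None} \<in> \<D>" by (rule base_downset) simp
  have stay: "r (N \<times> {None}) q \<in> N \<times> {None}" if "q \<in> N \<times> {None}" for q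
    using that r_points[OF N0 that] r_snd[OF N0, of "fst q" "snd q"]
    by (cases "r (N \<times> {None}) q") (auto simp: points_def)
  have "x \<in> N" using assms by (auto simp: downsets_def points_def)
  moreover have "(N \<times> {None}) \<inter> D = base D \<times> {None}"
    using assms(1) by (auto simp: base_def downsets_def points_def)
  ultimately have "r D (x, None) = r (base D \<times> {None}) (x, None)"
    using r_restrict[OF N0 stay assms(1), of "(x, None)"] assms(2) by simp
  then show ?thesis
    using r_snd[OF assms] by (simp add: a_def prod_eq_iff)
qed

lemma base_times [simp]: "base (A \<times> {None}) = A" by (auto simp: base_def)

lemma r_base': "A \<subseteq> N \<Longrightarrow> x \<in> A \<Longrightarrow> r (A \<times> {None}) (x, None) = (a A x, None)"
  using r_base[OF base_downset, of A x] by simp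

lemma r_upper:
  assumes "D \<in> \<D>" "(x, Some y) \<in> D"
  shows "r D (x, Some y) = (a (base D) x, Some (the (snd (r D (x, Some y)))))"
proof -
  have "(x, None) \<in> D" using assms by (auto simp: downsets_def)
  then show ?thesis
    using r_base[OF assms(1)] r_fst[OF assms] r_snd[OF assms] by (auto simp: prod_eq_iff)
qed

lemma compression_a: "compression_system N a"
proof
  show "finite N" by simp
  show "inj_on (a A) A" if "A \<subseteq> N" for A
  proof (rule inj_onI)
    fix u v assume uv: "u \<in> A" "v \<in> A" "a A u = a A v"
    have "r (A \<times> {None}) (u, None) = r (A \<times> {None}) (v, None)" using uv r_base'[OF that] by simp
    then have "(u, None) = (v, None :: nat option)"
      by (rule inj_onD[OF r_inj[OF base_downset[OF that]]]) (use uv in auto)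
    then show "u = v" by simp
  qed
  show into: "a A x \<in> N" if "A \<subseteq> N" "x \<in> A" for A x
    using r_points[OF base_downset[OF that(1)], of "(x, None)"] r_base'[OF that] that(2)
    by (auto simp: points_def)
  fix A E x assume *: "A \<subseteq> N" "E \<subseteq> N" "x \<in> A" "a A x \<in> E"
  let ?C = "{y \<in> A. a A y \<in> E}"
  have "{q \<in> A \<times> {None}. r (A \<times> {None}) q \<in> E \<times> {None}} = ?C \<times> {None}"
    using r_base'[OF *(1)] by auto
  then have "r (E \<times> {None}) (a A x, None) = r (?C \<times> {None}) (x, None)"
    using r_comp[OF base_downset base_downset, OF *(1,2), of "(x, None)"] * r_base'[OF *(1,3)] by simp
  moreover have "?C \<subseteq> N" "x \<in> ?C" using * by auto
  ultimately show "a E (a A x) = a ?C x" using r_base' *(2,4) by simp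
qed

interpretation A: compression_system N a by (rule compression_a)

lemma a_N: "x \<in> N \<Longrightarrow> a N x = x"
  using A.fixedI[of N] A.into[of N] unfolding A.fixed_def by blast

definition N0 :: "point set" where "N0 = N \<times> {None}"

text \<open>The action on the leaves over \<open>x\<close> when all roots are in the domain. Then no root moves, and
  each fibre carries a one-level system.\<close>
definition b :: "nat \<Rightarrow> nat set \<Rightarrow> nat \<Rightarrow> nat" where
  "b x E y = the (snd (r (N0 \<union> {x} \<times> Some ` E) (x, Some y)))"

lemma column_downset: "x \<in> N \<Longrightarrow> E \<subseteq> M \<Longrightarrow> N0 \<union> {x} \<times> Some ` E \<in> \<D>"
  by (auto simp: downsets_def points_def N0_def)

lemma base_N0 [simp]: "D \<subseteq> P \<Longrightarrow> base (N0 \<union> D) = N"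
  by (auto simp: base_def N0_def points_def)

lemma column_points: "x \<in> N \<Longrightarrow> E \<subseteq> M \<Longrightarrow> {x} \<times> Some ` E \<subseteq> P"
  by (auto simp: points_def)

lemma r_column:
  assumes "x \<in> N" "E \<subseteq> M" "y \<in> E"
  shows "r (N0 \<union> {x} \<times> Some ` E) (x, Some y) = (x, Some (b x E y))"
  using r_upper[OF column_downset[OF assms(1,2)], of x y] assms(3)
  by (simp add: b_def base_N0[OF column_points[OF assms(1,2)]] a_N[OF assms(1)])

lemma b_into:
  assumes "x \<in> N" "E \<subseteq> M" "y \<in> E"
  shows "b x E y \<in> M"
  using r_points[OF column_downset[OF assms(1,2)], of "(x, Some y)"] assms
  by (auto simp: r_column points_def)

lemma r_column_base:
  assumes "x \<in> N" "E \<subseteq> M" "u \<in> N"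
  shows "r (N0 \<union> {x} \<times> Some ` E) (u, None) = (u, None)"
  using r_base[OF column_downset[OF assms(1,2)], of u] assms(3)
  by (simp add: base_N0[OF column_points[OF assms(1,2)]] a_N) (simp add: N0_def)

lemma r_over_N0:
  assumes W: "W \<in> \<D>" "N0 \<subseteq> W" and y: "(x, Some y) \<in> W"
  shows "r W (x, Some y) = (x, Some (b x (fibre W x) y))"
proof -
  have x: "x \<in> N" "y \<in> M" and F: "fibre W x \<subseteq> M"
    using W(1) y by (auto simp: downsets_def points_def fibre_def)
  let ?V = "N0 \<union> {x} \<times> Some ` M"
  have "r ?V q \<in> ?V" if "q \<in> ?V" for q
    using that r_column[OF x(1) subset_refl] b_into[OF x(1) subset_refl] r_column_base[OF x(1) subset_refl]
    by (auto simp: N0_def)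
  then have "r (?V \<inter> W) (x, Some y) = r W (x, Some y)"
    using x y by (intro r_restrict[OF column_downset[OF x(1) subset_refl] _ W(1)]) auto
  moreover have "?V \<inter> W = N0 \<union> {x} \<times> Some ` fibre W x"
    using W by (auto simp: fibre_def downsets_def points_def)
  ultimately show ?thesis using r_column[OF x(1) F, of y] y by (simp add: fibre_def)
qed

lemma compression_b:
  assumes "x \<in> N"
  shows "compression_system M (b x)"
proof
  show "finite M" by simp
  show "inj_on (b x E) E" if "E \<subseteq> M" for E
  proof (rule inj_onI)
    fix u v assume uv: "u \<in> E" "v \<in> E" "b x E u = b x E v"
    let ?D = "N0 \<union> {x} \<times> Some ` E"
    have "r ?D (x, Some u) = r ?D (x, Some v)" using uv r_column[OF assms that] by simp
    then have "(x, Some u) = (x, Some v)"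
      by (rule inj_onD[OF r_inj[OF column_downset[OF assms that]]]) (use uv in auto)
    then show "u = v" by simp
  qed
  show "b x E y \<in> M" if "E \<subseteq> M" "y \<in> E" for E y by (rule b_into[OF assms that])
  fix D E y assume *: "D \<subseteq> M" "E \<subseteq> M" "y \<in> D" "b x D y \<in> E"
  let ?C = "{v \<in> D. b x D v \<in> E}" and ?col = "\<lambda>E. N0 \<union> {x} \<times> Some ` E"
  have C: "?C \<subseteq> M" "y \<in> ?C" using * by auto
  have "{q \<in> ?col D. r (?col D) q \<in> ?col E} = ?col ?C"
    using r_column[OF assms *(1)] r_column_base[OF assms *(1)] by (auto simp: N0_def)
  then have "r (?col E) (x, Some (b x D y)) = r (?col ?C) (x, Some y)"
    using r_comp[OF column_downset column_downset, OF assms *(1) assms *(2), of "(x, Some y)"]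
      * r_column[OF assms *(1,3)] by simp
  then show "b x E (b x D y) = b x ?C y"
    using r_column[OF assms C] r_column[OF assms *(2,4)] by simp
qed

definition U :: "nat set \<Rightarrow> point set" where
  "U A = A \<times> insert None (Some ` M)"

text \<open>The bijections between whole fibres given by the members whose domain consists of full fibres.\<close>
definition g :: "nat set \<Rightarrow> nat \<Rightarrow> nat \<Rightarrow> nat" where
  "g A x y = the (snd (r (U A) (x, Some y)))"

lemma U_downset: "A \<subseteq> N \<Longrightarrow> U A \<in> \<D>"
  by (auto simp: downsets_def points_def U_def)

lemma base_U [simp]: "base (U A) = A" by (auto simp: base_def U_def)

lemma r_U:
  assumes "A \<subseteq> N" "x \<in> A"
  shows "r (U A) (x, None) = (a A x, None)"
    and "y \<in> M \<Longrightarrow> r (U A) (x, Some y) = (a A x, Some (g A x y))"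
proof -
  have "(x, None) \<in> U A" "y \<in> M \<Longrightarrow> (x, Some y) \<in> U A" using assms(2) by (simp_all add: U_def)
  then show "r (U A) (x, None) = (a A x, None)"
    and "y \<in> M \<Longrightarrow> r (U A) (x, Some y) = (a A x, Some (g A x y))"
    using r_base[OF U_downset[OF assms(1)], of x] r_upper[OF U_downset[OF assms(1)], of x y]
    by (simp_all add: g_def)
qed

lemma r_U_fst: "A \<subseteq> N \<Longrightarrow> q \<in> U A \<Longrightarrow> fst (r (U A) q) = a A (fst q)"
  using r_U by (auto simp: U_def)

lemma U_Some: "x \<in> A \<Longrightarrow> y \<in> M \<Longrightarrow> (x, Some y) \<in> U A"
  by (simp add: U_def)

lemma g_into:
  assumes "A \<subseteq> N" "x \<in> A" "y \<in> M"
  shows "g A x y \<in> M"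
  using r_points[OF U_downset[OF assms(1)] U_Some[OF assms(2,3)]] r_U(2)[OF assms]
  by (auto simp: points_def)

lemma g_inj:
  assumes "A \<subseteq> N" "x \<in> A"
  shows "inj_on (g A x) M"
proof (rule inj_onI)
  fix u v assume uv: "u \<in> M" "v \<in> M" "g A x u = g A x v"
  have "r (U A) (x, Some u) = r (U A) (x, Some v)" using uv r_U(2)[OF assms] by simp
  then have "(x, Some u) = (x, Some v)"
    by (rule inj_onD[OF r_inj[OF U_downset[OF assms(1)]]]) (use uv U_Some assms in auto)
  then show "u = v" by simp
qed

text \<open>Enlarging the domain by all roots compresses the leaves inside their fibres without moving roots;
  following this by the member with full fibres over the roots of \<open>D\<close> has domain \<open>D\<close> again.\<close>
lemma r_factor:
  assumes D: "D \<in> \<D>" "(x, Some y) \<in> D"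
  shows "r D (x, Some y) = (a (base D) x, Some (g (base D) x (b x (fibre D x) y)))"
proof -
  have DP: "D \<subseteq> P" using D by (auto simp: downsets_def)
  let ?W = "N0 \<union> D" and ?U = "U (base D)"
  have W: "?W \<in> \<D>" using D(1) by (auto simp: downsets_def N0_def points_def)
  have x: "x \<in> N" "x \<in> base D" "y \<in> M" and bN: "base D \<subseteq> N"
    using D by (auto simp: downsets_def points_def base_def)
  have fW: "fibre ?W u = fibre D u" for u by (auto simp: fibre_def N0_def)
  have rW: "r ?W (x, Some y) = (x, Some (b x (fibre D x) y))"
    using r_over_N0[OF W, of x y] D(2) fW by simp
  have bM: "b x (fibre D x) y \<in> M"
    by (rule b_into[OF x(1)]) (use D in \<open>auto simp: fibre_def downsets_def points_def\<close>)
  have fst_W: "fst (r ?W q) = fst q" if "q \<in> ?W" for q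
  proof -
    obtain u z where q: "q = (u, z)" by (cases q)
    have "u \<in> N" "(u, None) \<in> ?W" using that W q by (auto simp: downsets_def points_def)
    then have "r ?W (u, None) = (u, None)" using r_base[OF W] base_N0[OF DP] a_N by simp
    then show ?thesis using r_fst[OF W that[unfolded q]] q by simp
  qed
  have "r ?W q \<in> ?U \<longleftrightarrow> fst q \<in> base D" if "q \<in> ?W" for q
    using fst_W[OF that] r_points[OF W that] by (cases "r ?W q") (auto simp: U_def points_def)
  moreover have "q \<in> D \<longleftrightarrow> fst q \<in> base D" if "q \<in> ?W" for q
    using that D(1) by (auto simp: base_def downsets_def N0_def)
  ultimately have "{q \<in> ?W. r ?W q \<in> ?U} = D" by auto
  then have "r D (x, Some y) = r ?U (x, Some (b x (fibre D x) y))"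
    using r_comp[OF W U_downset[OF bN], of "(x, Some y)"] rW D(2) x bM by (simp add: U_def)
  then show ?thesis using r_U(2)[OF bN x(2) bM] by simp
qed

text \<open>The identification of the fibre over \<open>x\<close> with the fibre over the root of its block. By the next
  lemma every \<open>g A x\<close> is a composite of one identification with the inverse of another, so the fibre
  bijections carry no further information.\<close>
definition h :: "nat \<Rightarrow> nat \<Rightarrow> nat" where
  "h x = g {x} x"

lemma h_g:
  assumes "A \<subseteq> N" "x \<in> A" "y \<in> M"
  shows "h (a A x) (g A x y) = h x y"
proof -
  let ?x' = "a A x"
  have x': "?x' \<in> N" using A.into[OF assms(1,2)] .
  have "{q \<in> U A. r (U A) q \<in> U {?x'}} = U {x}"
  proof -
    have "r (U A) q \<in> U {?x'} \<longleftrightarrow> fst q = x" if "q \<in> U A" for q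
    proof -
      have "r (U A) q \<in> U {?x'} \<longleftrightarrow> a A (fst q) = ?x'"
        using r_U_fst[OF assms(1) that] r_points[OF U_downset[OF assms(1)] that]
        by (cases "r (U A) q") (auto simp: U_def points_def)
      also have "\<dots> \<longleftrightarrow> fst q = x"
        using inj_onD[OF A.inj[OF assms(1)], of "fst q" x] that assms(2) by (auto simp: U_def)
      finally show ?thesis .
    qed
    moreover have "q \<in> U {x} \<longleftrightarrow> q \<in> U A \<and> fst q = x" for q
      using assms(2) by (cases q) (auto simp: U_def)
    ultimately show ?thesis by blast
  qed
  then have "r (U {?x'}) (?x', Some (g A x y)) = r (U {x}) (x, Some y)"
    using r_comp[OF U_downset U_downset, of A "{?x'}" "(x, Some y)"] assms x' r_U(2)[OF assms]
      g_into[OF assms] by (simp add: U_def)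
  then show ?thesis
    using r_U(2)[of "{?x'}" ?x' "g A x y"] r_U(2)[of "{x}" x y] x' g_into[OF assms] assms
    by (auto simp: h_def)
qed

text \<open>The identifications carry the system on the fibre over \<open>x\<close> to the one over the root of its block:
  both sides describe the member with root \<open>x\<close> and leaves \<open>{v. h x v \<in> E}\<close> in its domain.\<close>
lemma h_b:
  assumes "x \<in> N" "E \<subseteq> M" "y \<in> M" "h x y \<in> E"
  shows "h x (b x {v \<in> M. h x v \<in> E} y) = b (A.root x) E (h x y)"
proof -
  let ?\<rho> = "A.root x" and ?U = "U {x}"
  let ?W = "N0 \<union> {?\<rho>} \<times> Some ` E"
  define D where "D = {q \<in> ?U. r ?U q \<in> ?W}"
  have xN: "{x} \<subseteq> N" "x \<in> {x}" using assms by auto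
  have \<rho>: "?\<rho> \<in> N" "a {x} x = ?\<rho>" using A.into[OF xN] by (auto simp: A.root_def)
  have rU: "r ?U (x, None) = (?\<rho>, None)" "\<And>y. y \<in> M \<Longrightarrow> r ?U (x, Some y) = (?\<rho>, Some (h x y))"
    using r_U[OF xN] \<rho> by (auto simp: h_def)
  have D: "D = insert (x, None) ({x} \<times> Some ` {v \<in> M. h x v \<in> E})"
    using rU \<rho> by (auto simp: D_def U_def N0_def)
  have DD: "D \<in> \<D>" using assms(1) by (auto simp: D downsets_def points_def)
  have bD: "base D = {x}" "fibre D x = {v \<in> M. h x v \<in> E}" by (auto simp: D base_def fibre_def)
  have "r ?W (?\<rho>, Some (h x y)) = r D (x, Some y)"
    using r_comp[OF U_downset[OF xN(1)] column_downset[OF \<rho>(1) assms(2)] U_Some[OF xN(2) assms(3)]]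
    unfolding rU(2)[OF assms(3)] D_def using assms(4) by blast
  moreover have "r D (x, Some y) = (?\<rho>, Some (h x (b x {v \<in> M. h x v \<in> E} y)))"
    using r_factor[OF DD, of x y] assms bD \<rho> by (simp add: h_def D)
  ultimately show ?thesis using r_column[OF \<rho>(1) assms(2,4)] by simp
qed

definition \<kappa> :: "nat \<Rightarrow> nat \<times> nat" where "\<kappa> = A.key"

definition \<mu> :: "nat \<Rightarrow> nat \<Rightarrow> nat \<times> nat" where "\<mu> x = compression_system.key M (b x)"

text \<open>The chart of a fibre is pulled back from the fibre over the root of its block, so that fibres in
  one block get charts with the same image.\<close>
definition \<nu> :: "nat \<Rightarrow> nat \<Rightarrow> nat \<times> nat" where "\<nu> x y = \<mu> (A.root x) (h x y)"

lemma h_bij: "x \<in> N \<Longrightarrow> h x ` M = M" "x \<in> N \<Longrightarrow> inj_on (h x) M"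
proof -
  assume x: "x \<in> N"
  then show inj: "inj_on (h x) M" using g_inj[of "{x}" x] by (simp add: h_def)
  show "h x ` M = M"
    by (rule endo_inj_surj[OF _ _ inj]) (use x g_into[of "{x}" x] in \<open>auto simp: h_def\<close>)
qed

lemma root_N: "x \<in> N \<Longrightarrow> A.root x \<in> N"
  using A.into[of "{x}" x] by (simp add: A.root_def)

lemma forest_chart: "forest_chart m n \<kappa> \<nu>"
proof -
  have im: "\<nu> x ` M = \<mu> (A.root x) ` M" if "x \<in> N" for x
    using h_bij(1)[OF that] by (metis (no_types, lifting) \<nu>_def image_cong image_image)
  have "chart M (\<nu> x)" if x: "x \<in> N" for x
  proof -
    have ch: "chart M (\<mu> (A.root x))"
      unfolding \<mu>_def by (rule compression_system.chart_key[OF compression_b[OF root_N[OF x]]])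
    have "\<nu> x = \<mu> (A.root x) \<circ> h x" by (auto simp: \<nu>_def)
    then have "inj_on (\<nu> x) M"
      using comp_inj_on[OF h_bij(2)[OF x], of "\<mu> (A.root x)"] ch h_bij(1)[OF x] by (simp add: chart_def)
    moreover have "(fst (\<nu> x y), j) \<in> \<nu> x ` M" if "y \<in> M" "j < snd (\<nu> x y)" for y j
    proof -
      have "h x y \<in> M" using h_bij(1)[OF x] that by blast
      then show ?thesis unfolding im[OF x] using ch that by (simp add: chart_def \<nu>_def)
    qed
    ultimately show ?thesis by (simp add: chart_def)
  qed
  moreover have "\<nu> x ` M = \<nu> x' ` M" if "x \<in> N" "x' \<in> N" "fst (\<kappa> x) = fst (\<kappa> x')" for x x'
    using that im by (simp add: \<kappa>_def A.key_def)
  moreover have "chart N \<kappa>" unfolding \<kappa>_def by (rule A.chart_key)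
  ultimately show ?thesis unfolding forest_chart_def by blast
qed

lemma upper_key:
  assumes D: "D \<in> \<D>" "(x, Some y) \<in> D" and eq: "r D (x, Some y) = (x', Some y')"
  shows "\<nu> x' y' = (fst (\<nu> x y), rank (\<nu> x) (fibre D x) y)"
proof -
  let ?A = "base D" and ?F = "fibre D x" and ?\<rho> = "A.root x"
  have x: "x \<in> N" "x \<in> ?A" "y \<in> M" "y \<in> ?F" and A: "?A \<subseteq> N" and F: "?F \<subseteq> M"
    using D by (auto simp: downsets_def points_def base_def fibre_def)
  have x': "x' = a ?A x" "y' = g ?A x (b x ?F y)" using r_factor[OF D] eq by auto
  have hF: "h x ` ?F \<subseteq> M" "h x y \<in> h x ` ?F" using h_bij(1)[OF x(1)] F x(4) by auto
  have "{v \<in> M. h x v \<in> h x ` ?F} = ?F"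
    using F inj_onD[OF h_bij(2)[OF x(1)]] by blast
  then have hb: "h x (b x ?F y) = b ?\<rho> (h x ` ?F) (h x y)"
    using h_b[OF x(1) hF(1) x(3) hF(2)] by simp
  have "\<nu> x' y' = \<mu> ?\<rho> (h x (b x ?F y))"
    using A.root_image[OF A x(2)] h_g[OF A x(2) b_into[OF x(1) F x(4)]] by (simp add: \<nu>_def x')
  also have "\<dots> = (fst (\<nu> x y), rank (\<mu> ?\<rho>) (h x ` ?F) (h x y))"
    using compression_system.key_compress[OF compression_b[OF root_N[OF x(1)]] hF]
    by (simp add: hb \<mu>_def \<nu>_def)
  also have "rank (\<mu> ?\<rho>) (h x ` ?F) (h x y) = rank (\<nu> x) ?F y"
  proof -
    have "{u \<in> h x ` ?F. fst (\<mu> ?\<rho> u) = fst (\<mu> ?\<rho> (h x y)) \<and> snd (\<mu> ?\<rho> u) < snd (\<mu> ?\<rho> (h x y))}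
        = h x ` {v \<in> ?F. fst (\<nu> x v) = fst (\<nu> x y) \<and> snd (\<nu> x v) < snd (\<nu> x y)}"
      by (auto simp: \<nu>_def)
    moreover have "inj_on (h x) {v \<in> ?F. fst (\<nu> x v) = fst (\<nu> x y) \<and> snd (\<nu> x v) < snd (\<nu> x y)}"
      by (rule inj_on_subset[OF h_bij(2)[OF x(1)]]) (use F in auto)
    ultimately show ?thesis by (simp add: rank_def card_image)
  qed
  finally show ?thesis .
qed

lemma T_compressions: "T \<subseteq> compressions m n \<kappa> \<nu>"
proof
  fix \<alpha> assume \<alpha>: "\<alpha> \<in> T"
  let ?D = "dom \<alpha>"
  have D: "?D \<in> \<D>" by (rule dom_downset[OF T_sub[OF \<alpha>]])
  have r: "r ?D p = q" if "\<alpha> p = Some q" for p q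
    using that t_unique[OF \<alpha>] by (simp add: r_def)
  have "\<kappa> x' = (fst (\<kappa> x), rank \<kappa> (base ?D) x)" if "\<alpha> (x, None) = Some (x', None)" for x x'
  proof -
    have "(x, None) \<in> ?D" using that by blast
    then have "x' = a (base ?D) x" "x \<in> base ?D" "base ?D \<subseteq> N"
      using r[OF that] r_base[OF D] D by (auto simp: base_def downsets_def points_def)
    then show ?thesis using A.key_compress by (simp add: \<kappa>_def)
  qed
  moreover have "\<nu> x' y' = (fst (\<nu> x y), rank (\<nu> x) (fibre ?D x) y)"
    if "\<alpha> (x, Some y) = Some (x', Some y')" for x y x' y'
    using upper_key[OF D _ r[OF that]] that by blast
  ultimately show "\<alpha> \<in> compressions m n \<kappa> \<nu>"
    using T_sub[OF \<alpha>] unfolding compressions_def by blast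
qed

end

section \<open>Compressions form a cross-section\<close>

lemma chart_inj: "chart X \<kappa> \<Longrightarrow> \<kappa> x = \<kappa> y \<Longrightarrow> x \<in> X \<Longrightarrow> y \<in> X \<Longrightarrow> x = y"
  unfolding chart_def by (meson inj_onD)

lemma rank_less:
  assumes "finite D" "y \<in> D" "fst (\<kappa> y) = fst (\<kappa> x)" "snd (\<kappa> y) < snd (\<kappa> x)"
  shows "rank \<kappa> D y < rank \<kappa> D x"
  unfolding rank_def by (rule psubset_card_mono) (use assms in auto)

lemma rank_eqD:
  assumes "chart X \<kappa>" "finite X" "D \<subseteq> X" "x \<in> D" "y \<in> D"
    and "fst (\<kappa> x) = fst (\<kappa> y)" "rank \<kappa> D x = rank \<kappa> D y"
  shows "x = y"
proof -
  have "snd (\<kappa> x) = snd (\<kappa> y)"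
    using rank_less[of D x \<kappa> y] rank_less[of D y \<kappa> x] assms finite_subset[OF assms(3,2)]
    by (metis less_irrefl linorder_neqE_nat)
  then have "\<kappa> x = \<kappa> y" using assms(6) by (simp add: prod_eq_iff)
  then show ?thesis by (rule chart_inj[OF assms(1)]) (use assms(3,4,5) in auto)
qed

lemma rank_le:
  assumes "chart X \<kappa>" "D \<subseteq> X"
  shows "rank \<kappa> D x \<le> snd (\<kappa> x)"
proof -
  let ?L = "{y \<in> D. fst (\<kappa> y) = fst (\<kappa> x) \<and> snd (\<kappa> y) < snd (\<kappa> x)}"
  have "inj_on (snd \<circ> \<kappa>) ?L"
  proof (rule inj_onI)
    fix u v assume "u \<in> ?L" "v \<in> ?L" "(snd \<circ> \<kappa>) u = (snd \<circ> \<kappa>) v"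
    then have "\<kappa> u = \<kappa> v" "u \<in> X" "v \<in> X" using assms(2) by (auto simp: prod_eq_iff)
    then show "u = v" by (rule chart_inj[OF assms(1)])
  qed
  then have "card ?L \<le> card {..<snd (\<kappa> x)}" by (rule card_inj_on_le) auto
  then show ?thesis by (simp add: rank_def)
qed

text \<open>Ranks never exceed positions, and the positions in a block form an initial segment.\<close>
lemma ex_compressed_point:
  assumes "chart X \<nu>" "\<nu> ` X = \<nu>' ` X'" "D \<subseteq> X" "x \<in> X"
  shows "\<exists>z\<in>X'. \<nu>' z = (fst (\<nu> x), rank \<nu> D x)"
proof -
  have "(fst (\<nu> x), rank \<nu> D x) \<in> \<nu> ` X"
  proof (cases "rank \<nu> D x = snd (\<nu> x)")
    case True
    then show ?thesis using assms(4) by (metis image_eqI prod.collapse)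
  next
    case False
    then show ?thesis using assms(1,4) rank_le[OF assms(1,3), of x] unfolding chart_def by simp
  qed
  then show ?thesis unfolding assms(2) by (metis imageE)
qed

text \<open>A compression maps the elements of \<open>D\<close> below \<open>y\<close> bijectively onto all positions below \<open>f y\<close>: it
  preserves the order, and there are as many of them as there are such positions. So the elements
  of \<open>E\<close> below \<open>f y\<close> are the images of the elements below \<open>y\<close> that reach \<open>E\<close>.\<close>
lemma rank_compose:
  assumes "chart X \<nu>" "chart X' \<nu>'" "finite X" "finite X'" "D \<subseteq> X" "E \<subseteq> X'"
    and f: "\<And>u. u \<in> D \<Longrightarrow> f u \<in> X' \<and> \<nu>' (f u) = (fst (\<nu> u), rank \<nu> D u)"
    and y: "y \<in> D"
  shows "rank \<nu>' E (f y) = rank \<nu> {u \<in> D. f u \<in> E} y"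
proof -
  have fD: "finite D" using assms(3,5) finite_subset by blast
  let ?L = "{u \<in> D. fst (\<nu> u) = fst (\<nu> y) \<and> snd (\<nu> u) < snd (\<nu> y)}"
  let ?B = "{z \<in> X'. fst (\<nu>' z) = fst (\<nu>' (f y)) \<and> snd (\<nu>' z) < snd (\<nu>' (f y))}"
  have inj: "inj_on f D"
  proof (rule inj_onI)
    fix u v assume "u \<in> D" "v \<in> D" "f u = f v"
    then show "u = v" using f rank_eqD[OF assms(1,3,5)] by (metis Pair_inject)
  qed
  have "f ` ?L \<subseteq> ?B"
    using f f[OF y] rank_less[OF fD] by (auto simp: rank_less)
  moreover have "card ?B \<le> card (f ` ?L)"
  proof -
    have "card ?B \<le> snd (\<nu>' (f y))" using rank_le[OF assms(2) subset_refl, of "f y"] by (simp add: rank_def)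
    also have "\<dots> = card ?L" using f[OF y] by (simp add: rank_def)
    also have "\<dots> = card (f ` ?L)"
      by (rule card_image[symmetric]) (rule inj_on_subset[OF inj], auto)
    finally show ?thesis .
  qed
  moreover have "finite ?B" using assms(4) by simp
  ultimately have B: "f ` ?L = ?B" by (intro card_seteq)
  have "{z \<in> E. fst (\<nu>' z) = fst (\<nu>' (f y)) \<and> snd (\<nu>' z) < snd (\<nu>' (f y))} = E \<inter> ?B"
    using assms(6) by blast
  also have "\<dots> = f ` {u \<in> {u \<in> D. f u \<in> E}. fst (\<nu> u) = fst (\<nu> y) \<and> snd (\<nu> u) < snd (\<nu> y)}"
    unfolding B[symmetric] by blast
  finally show ?thesis
    unfolding rank_def by (simp add: card_image[OF inj_on_subset[OF inj]] subset_iff)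
qed

lemma forest_map_None:
  assumes "\<alpha> \<in> carrier (forest_maps m n)" "\<alpha> (x, None) = Some q"
  obtains x' where "q = (x', None)" "\<alpha> (x, None) = Some (x', None)"
proof -
  have "\<alpha> (x, None) = Some (fst q, snd q)" using assms(2) by simp
  then have "snd q = None" using forest_carrierD(5)[OF assms(1)] by blast
  then show thesis using that[of "fst q"] assms(2) by (cases q) simp
qed

lemma forest_map_Some:
  assumes "\<alpha> \<in> carrier (forest_maps m n)" "\<alpha> (x, Some y) = Some q"
  obtains x' y' where "q = (x', Some y')" "\<alpha> (x, None) = Some (x', None)"
    "\<alpha> (x, Some y) = Some (x', Some y')"
proof -
  have *: "\<alpha> (x, Some y) = Some (fst q, snd q)" using assms(2) by simp
  then have "snd q \<noteq> None" using forest_carrierD(5)[OF assms(1)] by blast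
  then obtain y' where "snd q = Some y'" by blast
  then show thesis using that[of "fst q" y'] forest_carrierD(4)[OF assms(1) *] * by (cases q) simp
qed

lemma compressionsD:
  assumes "\<alpha> \<in> compressions m n \<kappa> \<nu>"
  shows "\<alpha> \<in> carrier (forest_maps m n)"
    and "\<alpha> (x, None) = Some (x', None) \<Longrightarrow> \<kappa> x' = (fst (\<kappa> x), rank \<kappa> (base (dom \<alpha>)) x)"
    and "\<alpha> (x, Some y) = Some (x', Some y') \<Longrightarrow>
           \<nu> x' y' = (fst (\<nu> x y), rank (\<nu> x) (fibre (dom \<alpha>) x) y)"
  using assms unfolding compressions_def by blast+

lemma forest_chartD:
  assumes "forest_chart m n \<kappa> \<nu>"
  shows "chart {1..n} \<kappa>" "x \<in> {1..n} \<Longrightarrow> chart {1..m} (\<nu> x)"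
    and "x \<in> {1..n} \<Longrightarrow> x' \<in> {1..n} \<Longrightarrow> fst (\<kappa> x) = fst (\<kappa> x') \<Longrightarrow> \<nu> x ` {1..m} = \<nu> x' ` {1..m}"
  using assms unfolding forest_chart_def by blast+

lemma downset_parts:
  assumes "D \<in> downsets m n"
  shows "base D \<subseteq> {1..n}" "fibre D x \<subseteq> {1..m}" "(x, z) \<in> D \<Longrightarrow> x \<in> base D"
  using assms by (auto simp: downsets_def points_def base_def fibre_def)

text \<open>The rank formula fixes the key of every image, first for roots and then for leaves inside the
  fibre over the image of their root.\<close>
lemma compressions_unique:
  assumes ch: "forest_chart m n \<kappa> \<nu>" and \<alpha>: "\<alpha> \<in> compressions m n \<kappa> \<nu>" and \<beta>: "\<beta> \<in> compressions m n \<kappa> \<nu>"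
    and dom: "dom \<alpha> = dom \<beta>"
  shows "\<alpha> = \<beta>"
proof
  note C = forest_chartD[OF ch]
  note A = compressionsD[OF \<alpha>] and B = compressionsD[OF \<beta>]
  note FA = forest_carrierD[OF A(1)] and FB = forest_carrierD[OF B(1)]
  have base: "\<alpha> (x, None) = \<beta> (x, None)" for x
  proof (cases "\<alpha> (x, None)")
    case None
    then show ?thesis using dom by (metis domIff)
  next
    case (Some q)
    then obtain x' where a: "\<alpha> (x, None) = Some (x', None)"
      using forest_map_None[OF A(1) Some] by metis
    then obtain q' where "\<beta> (x, None) = Some q'" using dom by (metis domD domI)
    then obtain x'' where b: "\<beta> (x, None) = Some (x'', None)"
      using forest_map_None[OF B(1)] by metis
    have "\<kappa> x' = \<kappa> x''" using A(2)[OF a] B(2)[OF b] dom by simp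
    moreover have "x' \<in> {1..n}" "x'' \<in> {1..n}" using FA(2)[OF a] FB(2)[OF b] by (auto simp: points_def)
    ultimately have "x' = x''" by (rule chart_inj[OF C(1)])
    then show ?thesis using a b by simp
  qed
  fix p :: point
  obtain x z where p: "p = (x, z)" by (cases p)
  show "\<alpha> p = \<beta> p"
  proof (cases z)
    case None
    then show ?thesis using base p by simp
  next
    case (Some y)
    show ?thesis
    proof (cases "\<alpha> p")
      case None
      then show ?thesis using dom by (metis domIff)
    next
      case (Some q)
      obtain x' y' where a: "\<alpha> (x, None) = Some (x', None)" "\<alpha> (x, Some y) = Some (x', Some y')"
        using forest_map_Some[OF A(1), of x y q] Some p \<open>z = Some y\<close> by metis
      obtain q' where "\<beta> (x, Some y) = Some q'" using a(2) dom by (metis domD domI)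
      then obtain x'' y'' where b: "\<beta> (x, None) = Some (x'', None)" "\<beta> (x, Some y) = Some (x'', Some y'')"
        using forest_map_Some[OF B(1)] by metis
      have x'': "x'' = x'" using a(1) b(1) base by simp
      have "\<nu> x' y' = \<nu> x' y''" using A(3)[OF a(2)] B(3)[OF b(2)] dom x'' by simp
      moreover have "x' \<in> {1..n}" "y' \<in> {1..m}" "y'' \<in> {1..m}"
        using FA(2)[OF a(2)] FB(2)[OF b(2)] by (auto simp: points_def)
      ultimately have "y' = y''" using chart_inj[OF C(2)] by blast
      then show ?thesis using a b x'' p \<open>z = Some y\<close> by simp
    qed
  qed
qed

lemma compressions_exists:
  assumes ch: "forest_chart m n \<kappa> \<nu>" and D: "D \<in> downsets m n"
  shows "\<exists>\<alpha>\<in>compressions m n \<kappa> \<nu>. dom \<alpha> = D"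
proof -
  note C = forest_chartD[OF ch] and P = downset_parts[OF D]
  have "\<forall>x\<in>base D. \<exists>z. z \<in> {1..n} \<and> \<kappa> z = (fst (\<kappa> x), rank \<kappa> (base D) x)"
    using ex_compressed_point[OF C(1) refl P(1)] P(1) by blast
  then obtain f where f: "\<And>x. x \<in> base D \<Longrightarrow> f x \<in> {1..n} \<and> \<kappa> (f x) = (fst (\<kappa> x), rank \<kappa> (base D) x)"
    by metis
  have "\<forall>x\<in>base D. \<forall>y\<in>fibre D x. \<exists>z. z \<in> {1..m} \<and> \<nu> (f x) z = (fst (\<nu> x y), rank (\<nu> x) (fibre D x) y)"
  proof (intro ballI)
    fix x y assume xy: "x \<in> base D" "y \<in> fibre D x"
    then have "\<nu> x ` {1..m} = \<nu> (f x) ` {1..m}"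
      using f[OF xy(1)] P(1) by (intro C(3)) auto
    then show "\<exists>z. z \<in> {1..m} \<and> \<nu> (f x) z = (fst (\<nu> x y), rank (\<nu> x) (fibre D x) y)"
      using ex_compressed_point[OF C(2) _ P(2), of x "\<nu> (f x)" "{1..m}" y] xy P(1,2) by blast
  qed
  then obtain g where g: "\<And>x y. x \<in> base D \<Longrightarrow> y \<in> fibre D x \<Longrightarrow>
      g x y \<in> {1..m} \<and> \<nu> (f x) (g x y) = (fst (\<nu> x y), rank (\<nu> x) (fibre D x) y)"
    by metis
  define \<alpha> where "\<alpha> p = (if p \<in> D then Some (f (fst p), map_option (g (fst p)) (snd p)) else None)" for p
  have f_inj: "x = u" if "x \<in> base D" "u \<in> base D" "f x = f u" for x u
    using rank_eqD[OF C(1) _ P(1) that(1,2)] f[OF that(1)] f[OF that(2)] that(3) by simp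
  have g_inj: "y = v" if "x \<in> base D" "y \<in> fibre D x" "v \<in> fibre D x" "g x y = g x v" for x y v
    using rank_eqD[OF C(2) _ P(2) that(2,3)] g[OF that(1,2)] g[OF that(1,3)] that(1,4) P(1) by auto
  have fib: "y \<in> fibre D x" if "(x, Some y) \<in> D" for x y using that by (simp add: fibre_def)
  have \<alpha>_iff: "\<alpha> (x, z) = Some q \<longleftrightarrow> (x, z) \<in> D \<and> q = (f x, map_option (g x) z)" for x z q
    by (auto simp: \<alpha>_def)
  have dom: "dom \<alpha> = D" by (auto simp: \<alpha>_def dom_def)
  have "\<alpha> \<in> carrier (forest_maps m n)"
  proof (rule forest_carrierI)
    fix p q assume "\<alpha> p = Some q"
    then have p: "(fst p, snd p) \<in> D" "q = (f (fst p), map_option (g (fst p)) (snd p))"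
      using \<alpha>_iff[of "fst p" "snd p" q] by auto
    have "q \<in> points m n"
      using f[OF P(3)[OF p(1)]] g[OF P(3)[OF p(1)]] p fib[of "fst p"]
      by (cases "snd p") (auto simp: points_def)
    then show "p \<in> points m n \<and> q \<in> points m n" using p(1) D by (auto simp: downsets_def)
  next
    fix p p' q assume "\<alpha> p = Some q" "\<alpha> p' = Some q"
    then have p: "(fst p, snd p) \<in> D" "q = (f (fst p), map_option (g (fst p)) (snd p))"
      "(fst p', snd p') \<in> D" "q = (f (fst p'), map_option (g (fst p')) (snd p'))"
      using \<alpha>_iff[of "fst p" "snd p" q] \<alpha>_iff[of "fst p'" "snd p'" q] by auto
    have x: "fst p = fst p'" using f_inj[OF P(3)[OF p(1)] P(3)[OF p(3)]] p(2,4) by simp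
    have "snd p = snd p'"
      using g_inj[OF P(3)[OF p(1)]] p x fib[of "fst p"] by (cases "snd p"; cases "snd p'") auto
    then show "p = p'" using x by (simp add: prod_eq_iff)
  next
    fix x z x' z' assume "\<alpha> (x, z) = Some (x', z')"
    then show "\<alpha> (x, None) = Some (x', None) \<and> (z' = None \<longleftrightarrow> z = None)"
      using D by (auto simp: \<alpha>_iff downsets_def)
  qed
  moreover have "\<kappa> x' = (fst (\<kappa> x), rank \<kappa> (base (dom \<alpha>)) x)" if "\<alpha> (x, None) = Some (x', None)" for x x'
    using that f P(3) by (auto simp: \<alpha>_iff dom)
  moreover have "\<nu> x' y' = (fst (\<nu> x y), rank (\<nu> x) (fibre (dom \<alpha>) x) y)"
    if "\<alpha> (x, Some y) = Some (x', Some y')" for x y x' y'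
    using that g P(3) fib by (auto simp: \<alpha>_iff dom)
  ultimately have "\<alpha> \<in> compressions m n \<kappa> \<nu>" unfolding compressions_def by blast
  then show ?thesis using dom by blast
qed

lemma compressions_closed:
  assumes ch: "forest_chart m n \<kappa> \<nu>" and \<alpha>: "\<alpha> \<in> compressions m n \<kappa> \<nu>" and \<beta>: "\<beta> \<in> compressions m n \<kappa> \<nu>"
  shows "\<beta> \<circ>\<^sub>m \<alpha> \<in> compressions m n \<kappa> \<nu>"
proof -
  note C = forest_chartD[OF ch]
  note A = compressionsD[OF \<alpha>] and B = compressionsD[OF \<beta>]
  note FA = forest_carrierD[OF A(1)] and FB = forest_carrierD[OF B(1)]
  note PA = downset_parts[OF dom_downset[OF A(1)]] and PB = downset_parts[OF dom_downset[OF B(1)]]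
  let ?\<gamma> = "\<beta> \<circ>\<^sub>m \<alpha>"
  have "\<kappa> x'' = (fst (\<kappa> x), rank \<kappa> (base (dom ?\<gamma>)) x)" if \<gamma>: "?\<gamma> (x, None) = Some (x'', None)" for x x''
  proof -
    define f where "f u = fst (the (\<alpha> (u, None)))" for u
    have f: "\<alpha> (u, None) = Some (f u, None)" if u: "u \<in> base (dom \<alpha>)" for u
    proof -
      obtain q where "\<alpha> (u, None) = Some q" using u by (auto simp: base_def)
      then obtain u' where "\<alpha> (u, None) = Some (u', None)" by (rule forest_map_None[OF A(1)])
      then show ?thesis by (simp add: f_def)
    qed
    have f': "f u \<in> {1..n} \<and> \<kappa> (f u) = (fst (\<kappa> u), rank \<kappa> (base (dom \<alpha>)) u)" if "u \<in> base (dom \<alpha>)" for u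
      using FA(2)[OF f[OF that]] A(2)[OF f[OF that]] by (auto simp: points_def)
    have x: "x \<in> base (dom \<alpha>)" using \<gamma> by (auto simp: base_def map_comp_Some_iff)
    then have b: "\<beta> (f x, None) = Some (x'', None)" using f[OF x] \<gamma> by (simp add: map_comp_def)
    have "{u \<in> base (dom \<alpha>). f u \<in> base (dom \<beta>)} = base (dom ?\<gamma>)"
    proof -
      have "u \<in> base (dom \<alpha>) \<Longrightarrow> u \<in> base (dom ?\<gamma>) \<longleftrightarrow> f u \<in> base (dom \<beta>)" for u
        using f[of u] by (simp add: base_def map_comp_def dom_def)
      moreover have "base (dom ?\<gamma>) \<subseteq> base (dom \<alpha>)" by (auto simp: base_def map_comp_Some_iff)
      ultimately show ?thesis by blast
    qed
    then show ?thesis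
      using B(2)[OF b] f'[OF x] rank_compose[OF C(1) C(1) _ _ PA(1) PB(1) f' x] by simp
  qed
  moreover have "\<nu> x'' y'' = (fst (\<nu> x y), rank (\<nu> x) (fibre (dom ?\<gamma>) x) y)"
    if \<gamma>: "?\<gamma> (x, Some y) = Some (x'', Some y'')" for x y x'' y''
  proof -
    obtain q where q: "\<alpha> (x, Some y) = Some q" "\<beta> q = Some (x'', Some y'')"
      using \<gamma> by (auto simp: map_comp_Some_iff)
    obtain x' where x': "\<alpha> (x, None) = Some (x', None)"
      using forest_map_Some[OF A(1) q(1)] by metis
    define f where "f v = the (snd (the (\<alpha> (x, Some v))))" for v
    have f: "\<alpha> (x, Some v) = Some (x', Some (f v))" if v: "v \<in> fibre (dom \<alpha>) x" for v
    proof -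
      obtain q where "\<alpha> (x, Some v) = Some q" using v by (auto simp: fibre_def)
      then obtain u v' where "\<alpha> (x, None) = Some (u, None)" "\<alpha> (x, Some v) = Some (u, Some v')"
        by (rule forest_map_Some[OF A(1)])
      then show ?thesis using x' by (simp add: f_def)
    qed
    have f': "f v \<in> {1..m} \<and> \<nu> x' (f v) = (fst (\<nu> x v), rank (\<nu> x) (fibre (dom \<alpha>) x) v)"
      if "v \<in> fibre (dom \<alpha>) x" for v
      using FA(2)[OF f[OF that]] A(3)[OF f[OF that]] by (auto simp: points_def)
    have y: "y \<in> fibre (dom \<alpha>) x" using q by (auto simp: fibre_def)
    then have b: "\<beta> (x', Some (f y)) = Some (x'', Some y'')" using f[OF y] q by simp
    have xN: "x \<in> {1..n}" "x' \<in> {1..n}" using FA(1,2)[OF x'] by (auto simp: points_def)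
    have "{v \<in> fibre (dom \<alpha>) x. f v \<in> fibre (dom \<beta>) x'} = fibre (dom ?\<gamma>) x"
    proof -
      have "v \<in> fibre (dom \<alpha>) x \<Longrightarrow> v \<in> fibre (dom ?\<gamma>) x \<longleftrightarrow> f v \<in> fibre (dom \<beta>) x'" for v
        using f[of v] by (simp add: fibre_def map_comp_def dom_def)
      moreover have "fibre (dom ?\<gamma>) x \<subseteq> fibre (dom \<alpha>) x" by (auto simp: fibre_def map_comp_Some_iff)
      ultimately show ?thesis by blast
    qed
    then show ?thesis
      using B(3)[OF b] f'[OF y] rank_compose[OF C(2)[OF xN(1)] C(2)[OF xN(2)] _ _ PA(2) PB(2) f' y] by simp
  qed
  ultimately show ?thesis
    unfolding compressions_def using forest_closed[OF A(1) B(1)] by blast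
qed

lemma compressions_cross_section:
  assumes "forest_chart m n \<kappa> \<nu>"
  shows "compressions m n \<kappa> \<nu> \<in> R_cross_sections (forest_maps m n)"
  unfolding forest_R_cross_sections
  using compressionsD(1) compressions_closed[OF assms] compressions_exists[OF assms]
    compressions_unique[OF assms] by blast

text \<open>The cross-section lies among the compressions for its own charts, and both have exactly one
  element for each domain.\<close>
lemma cross_section_compressions:
  assumes "T \<in> R_cross_sections (forest_maps m n)"
  shows "\<exists>\<kappa> \<nu>. forest_chart m n \<kappa> \<nu> \<and> T = compressions m n \<kappa> \<nu>"
proof -
  interpret forest_cross_section m n T by (unfold_locales) (rule assms)
  let ?C = "compressions m n \<kappa> \<nu>"
  have "?C \<subseteq> T"
  proof
    fix \<alpha> assume \<alpha>: "\<alpha> \<in> ?C"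
    have "dom \<alpha> \<in> downsets m n" by (rule dom_downset[OF compressionsD(1)[OF \<alpha>]])
    then obtain \<beta> where "\<beta> \<in> T" "dom \<beta> = dom \<alpha>" using T_ex1 by blast
    then show "\<alpha> \<in> T"
      using compressions_unique[OF forest_chart \<alpha>, of \<beta>] T_compressions by auto
  qed
  then show ?thesis using T_compressions forest_chart by blast
qed

section \<open>Shapes\<close>

text \<open>The image of a chart is a set of cells \<open>(b, j)\<close>, in which each block \<open>b\<close> is a column.\<close>
definition column :: "('c \<times> nat) set \<Rightarrow> 'c \<Rightarrow> nat" where
  "column Z b = card {j. (b, j) \<in> Z}"

definition shape :: "('c \<times> nat) set \<Rightarrow> nat multiset" where
  "shape Z = image_mset (column Z) (mset_set (fst ` Z))"

text \<open>The common image of the leaf charts in a block of roots; the union avoids choosing a root.\<close>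
definition cells :: "nat \<Rightarrow> nat \<Rightarrow> (nat \<Rightarrow> nat \<times> nat) \<Rightarrow> (nat \<Rightarrow> nat \<Rightarrow> nat \<times> nat) \<Rightarrow> nat \<Rightarrow> (nat \<times> nat) set" where
  "cells m n \<kappa> \<nu> b = (\<Union>x\<in>{x \<in> {1..n}. fst (\<kappa> x) = b}. \<nu> x ` {1..m})"

definition forest_shape ::
    "nat \<Rightarrow> nat \<Rightarrow> (nat \<Rightarrow> nat \<times> nat) \<Rightarrow> (nat \<Rightarrow> nat \<Rightarrow> nat \<times> nat) \<Rightarrow> (nat \<times> nat multiset) multiset" where
  "forest_shape m n \<kappa> \<nu> = image_mset (\<lambda>b. (column (\<kappa> ` {1..n}) b, shape (cells m n \<kappa> \<nu> b)))
     (mset_set (fst ` \<kappa> ` {1..n}))"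

lemma cells_eq:
  assumes "forest_chart m n \<kappa> \<nu>" "x \<in> {1..n}"
  shows "cells m n \<kappa> \<nu> (fst (\<kappa> x)) = \<nu> x ` {1..m}"
  using forest_chartD(3)[OF assms(1) _ assms(2)] assms(2) unfolding cells_def by blast

lemma initial_segment:
  assumes "finite A" "\<And>i j. j \<in> A \<Longrightarrow> i < j \<Longrightarrow> i \<in> A"
  shows "A = {..<card (A :: nat set)}"
proof (cases "A = {}")
  case False
  have "A = {..Max A}"
  proof
    show "A \<subseteq> {..Max A}" using assms(1) by auto
    show "{..Max A} \<subseteq> A"
      using Max_in[OF assms(1) False] assms(2) by (auto simp: le_less)
  qed
  then have "A = {..<Suc (Max A)}" by (simp add: lessThan_Suc_atMost)
  then show ?thesis by (metis card_lessThan)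
qed simp

lemma chart_image_iff:
  assumes "chart X \<kappa>" "finite X"
  shows "(b, j) \<in> \<kappa> ` X \<longleftrightarrow> b \<in> fst ` \<kappa> ` X \<and> j < column (\<kappa> ` X) b"
proof -
  let ?A = "{j. (b, j) \<in> \<kappa> ` X}"
  have "?A \<subseteq> snd ` \<kappa> ` X"
  proof
    fix j assume "j \<in> ?A"
    then show "j \<in> snd ` \<kappa> ` X" by (intro image_eqI[of j snd "(b, j)"]) auto
  qed
  then have fin: "finite ?A" using assms(2) finite_subset by blast
  have "i \<in> ?A" if ji: "j \<in> ?A" "i < j" for i j
  proof -
    obtain x where "x \<in> X" "(b, j) = \<kappa> x" using ji(1) by blast
    then show ?thesis using assms(1) ji(2) unfolding chart_def by (metis fst_conv mem_Collect_eq snd_conv)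
  qed
  from initial_segment[OF fin this] have "?A = {..<column (\<kappa> ` X) b}" by (simp add: column_def)
  then have "(b, j) \<in> \<kappa> ` X \<longleftrightarrow> j < column (\<kappa> ` X) b" by blast
  moreover have "(b, j) \<in> \<kappa> ` X \<Longrightarrow> b \<in> fst ` \<kappa> ` X" by (metis fst_conv imageI)
  ultimately show ?thesis by blast
qed

lemma image_mset_eq_bij:
  assumes "finite A" "finite B" "image_mset f (mset_set A) = image_mset g (mset_set B)"
  shows "\<exists>\<gamma>. bij_betw \<gamma> A B \<and> (\<forall>a\<in>A. g (\<gamma> a) = f a)"
  using assms
proof (induction A arbitrary: B rule: finite_induct)
  case empty
  then have "B = {}" by (simp add: mset_set_empty_iff)
  then show ?case by (auto simp: bij_betw_def)
next
  case (insert a A)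
  then have eq: "add_mset (f a) (image_mset f (mset_set A)) = image_mset g (mset_set B)" by simp
  then have "f a \<in># image_mset g (mset_set B)" by (metis union_single_eq_member)
  then obtain c where c: "c \<in> B" "g c = f a" using insert.prems(1) by auto
  have "mset_set B = add_mset c (mset_set (B - {c}))" using mset_set.remove[OF insert.prems(1) c(1)] .
  then have "image_mset f (mset_set A) = image_mset g (mset_set (B - {c}))" using eq c(2) by simp
  then obtain \<gamma> where \<gamma>: "bij_betw \<gamma> A (B - {c})" "\<forall>a\<in>A. g (\<gamma> a) = f a"
    using insert.IH[of "B - {c}"] insert.prems(1) by auto
  have "bij_betw (\<gamma>(a := c)) A (B - {c})"
    using \<gamma>(1) insert.hyps(2) by (subst bij_betw_cong[of A _ \<gamma>]) auto
  then have "bij_betw (\<gamma>(a := c)) (insert a A) (insert ((\<gamma>(a := c)) a) (B - {c}))"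
    using insert.hyps(2) by (subst notIn_Un_bij_betw3[of a A, simplified, symmetric]) auto
  then have "bij_betw (\<gamma>(a := c)) (insert a A) B" using c(1) by (simp add: insert_absorb)
  moreover have "\<forall>u\<in>insert a A. g ((\<gamma>(a := c)) u) = f u" using \<gamma>(2) c(2) by auto
  ultimately show ?case by blast
qed

lemma chart_transport:
  assumes "chart X \<kappa>" "finite X" "chart X' \<kappa>'" "finite X'"
    and \<gamma>: "bij_betw \<gamma> (fst ` \<kappa> ` X) (fst ` \<kappa>' ` X')"
    and col: "\<And>b. b \<in> fst ` \<kappa> ` X \<Longrightarrow> column (\<kappa>' ` X') (\<gamma> b) = column (\<kappa> ` X) b"
  shows "\<exists>w. bij_betw w X X' \<and> (\<forall>x\<in>X. \<kappa>' (w x) = (\<gamma> (fst (\<kappa> x)), snd (\<kappa> x)))"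
proof -
  note I = chart_image_iff[OF assms(1,2)] and I' = chart_image_iff[OF assms(3,4)]
  have "\<exists>z. z \<in> X' \<and> \<kappa>' z = (\<gamma> (fst (\<kappa> x)), snd (\<kappa> x))" if x: "x \<in> X" for x
  proof -
    have "(fst (\<kappa> x), snd (\<kappa> x)) \<in> \<kappa> ` X" using x by simp
    then have "fst (\<kappa> x) \<in> fst ` \<kappa> ` X" "snd (\<kappa> x) < column (\<kappa> ` X) (fst (\<kappa> x))"
      using I by blast+
    then have "(\<gamma> (fst (\<kappa> x)), snd (\<kappa> x)) \<in> \<kappa>' ` X'"
      unfolding I' using col bij_betwE[OF \<gamma>] by metis
    then show ?thesis by (metis imageE)
  qed
  then obtain w where w: "\<And>x. x \<in> X \<Longrightarrow> w x \<in> X' \<and> \<kappa>' (w x) = (\<gamma> (fst (\<kappa> x)), snd (\<kappa> x))"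
    by metis
  have "inj_on w X"
  proof (rule inj_onI)
    fix x y assume xy: "x \<in> X" "y \<in> X" "w x = w y"
    have "\<gamma> (fst (\<kappa> x)) = \<gamma> (fst (\<kappa> y))" "snd (\<kappa> x) = snd (\<kappa> y)"
      using w[OF xy(1)] w[OF xy(2)] xy(3) by simp_all
    moreover have "fst (\<kappa> x) = fst (\<kappa> y)"
      by (rule inj_onD[OF bij_betw_imp_inj_on[OF \<gamma>] calculation(1)]) (use xy in auto)
    ultimately have "\<kappa> x = \<kappa> y" by (simp add: prod_eq_iff)
    then show "x = y" by (rule chart_inj[OF assms(1) _ xy(1,2)])
  qed
  moreover have "z \<in> w ` X" if z: "z \<in> X'" for z
  proof -
    obtain c j where cj: "\<kappa>' z = (c, j)" by (cases "\<kappa>' z")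
    then have "(c, j) \<in> \<kappa>' ` X'" using z by (metis imageI)
    then have c: "c \<in> fst ` \<kappa>' ` X'" "j < column (\<kappa>' ` X') c" using I' by blast+
    then obtain b where b: "b \<in> fst ` \<kappa> ` X" "c = \<gamma> b"
      using bij_betw_imp_surj_on[OF \<gamma>] by (metis imageE)
    then have "(b, j) \<in> \<kappa> ` X" unfolding I using c(2) col[OF b(1)] by simp
    then obtain x where x: "x \<in> X" "\<kappa> x = (b, j)" by (metis imageE)
    then have "\<kappa>' (w x) = \<kappa>' z" using w b cj by simp
    then have "w x = z" by (rule chart_inj[OF assms(3)]) (use w[OF x(1)] z in simp_all)
    then show ?thesis using x(1) by blast
  qed
  ultimately have "bij_betw w X X'" using w unfolding bij_betw_def by blast
  then show ?thesis using w by blast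
qed

lemma rank_transport:
  assumes "inj_on w X" "D \<subseteq> X" "x \<in> X" "inj_on \<gamma> (fst ` \<kappa> ` X)"
    and w: "\<And>u. u \<in> X \<Longrightarrow> \<kappa>' (w u) = (\<gamma> (fst (\<kappa> u)), snd (\<kappa> u))"
  shows "rank \<kappa>' (w ` D) (w x) = rank \<kappa> D x"
proof -
  let ?L = "{u \<in> D. fst (\<kappa> u) = fst (\<kappa> x) \<and> snd (\<kappa> u) < snd (\<kappa> x)}"
  have "fst (\<kappa>' (w u)) = fst (\<kappa>' (w x)) \<longleftrightarrow> fst (\<kappa> u) = fst (\<kappa> x)" if "u \<in> D" for u
  proof -
    have "u \<in> X" using that assms(2) by blast
    then show ?thesis using w assms(3) inj_onD[OF assms(4), of "fst (\<kappa> u)" "fst (\<kappa> x)"] by auto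
  qed
  moreover have "snd (\<kappa>' (w u)) = snd (\<kappa> u)" if "u \<in> X" for u using w[OF that] by simp
  ultimately have "{z \<in> w ` D. fst (\<kappa>' z) = fst (\<kappa>' (w x)) \<and> snd (\<kappa>' z) < snd (\<kappa>' (w x))} = w ` ?L"
    using assms(2,3) by (auto simp: subset_iff)
  moreover have "inj_on w ?L" by (rule inj_on_subset[OF assms(1)]) (use assms(2) in auto)
  ultimately show ?thesis by (simp add: rank_def card_image)
qed

lemma finite_downsets: "finite (downsets m n)"
  by (rule finite_subset[of _ "Pow (points m n)"]) (auto simp: downsets_def points_def)

lemma card_compressions:
  assumes "forest_chart m n \<kappa> \<nu>"
  shows "finite (compressions m n \<kappa> \<nu>)" "card (compressions m n \<kappa> \<nu>) = card (downsets m n)"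
proof -
  have "bij_betw dom (compressions m n \<kappa> \<nu>) (downsets m n)"
    unfolding bij_betw_def
  proof
    show "inj_on dom (compressions m n \<kappa> \<nu>)"
      by (rule inj_onI) (rule compressions_unique[OF assms])
    show "dom ` compressions m n \<kappa> \<nu> = downsets m n"
    proof
      show "dom ` compressions m n \<kappa> \<nu> \<subseteq> downsets m n"
        using dom_downset[OF compressionsD(1)] by (rule image_subsetI)
      show "downsets m n \<subseteq> dom ` compressions m n \<kappa> \<nu>"
        using compressions_exists[OF assms] by (metis imageI subsetI)
    qed
  qed
  then show "finite (compressions m n \<kappa> \<nu>)" "card (compressions m n \<kappa> \<nu>) = card (downsets m n)"
    by (simp_all add: bij_betw_finite finite_downsets bij_betw_same_card)
qed

text \<open>Equal shapes give a bijection \<open>\<gamma>\<close> between blocks of roots and, for each block, a bijection \<open>\<delta>\<close>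
  between blocks of leaves, both preserving sizes. Carrying positions along, they become an
  automorphism \<open>\<omega>\<close> of the forest, and conjugation by \<open>\<omega>\<close> takes one family of compressions to the
  other. It is onto because both families have one element for each downset.\<close>
lemma same_shape_iso:
  assumes ch: "forest_chart m n \<kappa> \<nu>" and ch': "forest_chart m n \<kappa>' \<nu>'"
    and eq: "forest_shape m n \<kappa> \<nu> = forest_shape m n \<kappa>' \<nu>'"
  shows "(forest_maps m n)\<lparr>carrier := compressions m n \<kappa> \<nu>\<rparr> \<cong>
         (forest_maps m n)\<lparr>carrier := compressions m n \<kappa>' \<nu>'\<rparr>"
proof -
  let ?N = "{1..n}" and ?M = "{1..m}"
  let ?T = "compressions m n \<kappa> \<nu>" and ?U = "compressions m n \<kappa>' \<nu>'"
  note C = forest_chartD[OF ch] and C' = forest_chartD[OF ch']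
  obtain \<gamma> where \<gamma>: "bij_betw \<gamma> (fst ` \<kappa> ` ?N) (fst ` \<kappa>' ` ?N)"
    and \<gamma>_col: "\<And>b. b \<in> fst ` \<kappa> ` ?N \<Longrightarrow> column (\<kappa>' ` ?N) (\<gamma> b) = column (\<kappa> ` ?N) b"
    and \<gamma>_shape: "\<And>b. b \<in> fst ` \<kappa> ` ?N \<Longrightarrow> shape (cells m n \<kappa>' \<nu>' (\<gamma> b)) = shape (cells m n \<kappa> \<nu> b)"
    using image_mset_eq_bij[OF _ _ eq[unfolded forest_shape_def]] by auto
  obtain w where w: "bij_betw w ?N ?N" "\<And>x. x \<in> ?N \<Longrightarrow> \<kappa>' (w x) = (\<gamma> (fst (\<kappa> x)), snd (\<kappa> x))"
    using chart_transport[OF C(1) _ C'(1) _ \<gamma> \<gamma>_col] by auto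
  have wN: "w x \<in> ?N" if "x \<in> ?N" for x using bij_betwE[OF w(1)] that by blast
  have cells_fin: "finite (cells m n \<kappa> \<nu> b)" "finite (cells m n \<kappa>' \<nu>' b)" for b
    by (simp_all add: cells_def)
  have "\<forall>b\<in>fst ` \<kappa> ` ?N. \<exists>\<delta>. bij_betw \<delta> (fst ` cells m n \<kappa> \<nu> b) (fst ` cells m n \<kappa>' \<nu>' (\<gamma> b)) \<and>
      (\<forall>c\<in>fst ` cells m n \<kappa> \<nu> b. column (cells m n \<kappa>' \<nu>' (\<gamma> b)) (\<delta> c) = column (cells m n \<kappa> \<nu> b) c)"
    using \<gamma>_shape cells_fin unfolding shape_def by (intro ballI image_mset_eq_bij) auto
  then obtain \<delta> where \<delta>: "\<And>b. b \<in> fst ` \<kappa> ` ?N \<Longrightarrow>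
        bij_betw (\<delta> b) (fst ` cells m n \<kappa> \<nu> b) (fst ` cells m n \<kappa>' \<nu>' (\<gamma> b))"
    and \<delta>_col: "\<And>b c. b \<in> fst ` \<kappa> ` ?N \<Longrightarrow> c \<in> fst ` cells m n \<kappa> \<nu> b \<Longrightarrow>
        column (cells m n \<kappa>' \<nu>' (\<gamma> b)) (\<delta> b c) = column (cells m n \<kappa> \<nu> b) c"
    by metis
  have cl: "cells m n \<kappa> \<nu> (fst (\<kappa> x)) = \<nu> x ` ?M"
      "cells m n \<kappa>' \<nu>' (\<gamma> (fst (\<kappa> x))) = \<nu>' (w x) ` ?M" if x: "x \<in> ?N" for x
    using cells_eq[OF ch x] cells_eq[OF ch' wN[OF x]] w(2)[OF x] by simp_all
  have "\<forall>x\<in>?N. \<exists>v. bij_betw v ?M ?M \<and>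
     (\<forall>y\<in>?M. \<nu>' (w x) (v y) = (\<delta> (fst (\<kappa> x)) (fst (\<nu> x y)), snd (\<nu> x y)))"
  proof
    fix x assume x: "x \<in> ?N"
    then have b: "fst (\<kappa> x) \<in> fst ` \<kappa> ` ?N" by blast
    show "\<exists>v. bij_betw v ?M ?M \<and> (\<forall>y\<in>?M. \<nu>' (w x) (v y) = (\<delta> (fst (\<kappa> x)) (fst (\<nu> x y)), snd (\<nu> x y)))"
      using chart_transport[OF C(2)[OF x] _ C'(2)[OF wN[OF x]] _ \<delta>[OF b, unfolded cl[OF x]]
          \<delta>_col[OF b, unfolded cl[OF x]]] by simp
  qed
  then obtain v where v: "\<And>x. x \<in> ?N \<Longrightarrow> bij_betw (v x) ?M ?M"
    and v': "\<And>x y. x \<in> ?N \<Longrightarrow> y \<in> ?M \<Longrightarrow> \<nu>' (w x) (v x y) = (\<delta> (fst (\<kappa> x)) (fst (\<nu> x y)), snd (\<nu> x y))"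
    by metis
  define \<omega> where "\<omega> p = (w (fst p), map_option (v (fst p)) (snd p))" for p
  have \<omega>_simps [simp]: "\<omega> (x, None) = (w x, None)" "\<omega> (x, Some y) = (w x, Some (v x y))" for x y
    by (simp_all add: \<omega>_def)
  let ?P = "points m n"
  have \<omega>_P: "\<omega> p \<in> ?P" if "p \<in> ?P" for p
    using that wN bij_betwE[OF v] by (fastforce simp: points_def)
  have \<omega>_inj: "inj_on \<omega> ?P"
  proof (rule inj_onI)
    fix p q assume pq: "p \<in> ?P" "q \<in> ?P" "\<omega> p = \<omega> q"
    have "w (fst p) = w (fst q)" "fst p \<in> ?N" "fst q \<in> ?N" using pq by (auto simp: \<omega>_def points_def)
    then have x: "fst p = fst q" using inj_onD[OF bij_betw_imp_inj_on[OF w(1)]] by blast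
    have "snd p = snd q"
    proof (cases "snd p")
      case None
      then show ?thesis using pq(3) by (simp add: \<omega>_def)
    next
      case (Some y)
      then obtain y' where y': "snd q = Some y'" "v (fst p) y = v (fst p) y'"
        using pq(3) x by (cases "snd q") (auto simp: \<omega>_def)
      have "y \<in> ?M" "y' \<in> ?M" using pq(1,2) Some y'(1) by (auto simp: points_def)
      then have "y = y'" using inj_onD[OF bij_betw_imp_inj_on[OF v[OF \<open>fst p \<in> ?N\<close>]]] y'(2) by blast
      then show ?thesis using Some y' by simp
    qed
    then show "p = q" using x by (simp add: prod_eq_iff)
  qed
  have \<omega>_surj: "\<omega> ` ?P = ?P"
  proof (rule endo_inj_surj[OF _ _ \<omega>_inj])
    show "finite ?P" by (simp add: points_def)
    show "\<omega> ` ?P \<subseteq> ?P" using \<omega>_P by (rule image_subsetI)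
  qed
  \<comment> \<open>Conjugation by \<open>\<omega>\<close>.\<close>
  define \<Phi> where "\<Phi> \<alpha> q = (if q \<in> ?P then map_option \<omega> (\<alpha> (inv_into ?P \<omega> q)) else None)" for \<alpha> q
  have \<Phi>_\<omega>: "\<Phi> \<alpha> (\<omega> p) = map_option \<omega> (\<alpha> p)" if "p \<in> ?P" for \<alpha> p
    using that \<omega>_P \<omega>_inj by (simp add: \<Phi>_def)
  have \<Phi>_iff: "\<Phi> \<alpha> q = Some q' \<longleftrightarrow> (\<exists>p p'. p \<in> ?P \<and> q = \<omega> p \<and> q' = \<omega> p' \<and> \<alpha> p = Some p')" for \<alpha> q q'
  proof
    assume *: "\<Phi> \<alpha> q = Some q'"
    then have "q \<in> ?P" by (auto simp: \<Phi>_def split: if_splits)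
    then obtain p where p: "p \<in> ?P" "q = \<omega> p" using \<omega>_surj by blast
    then have "map_option \<omega> (\<alpha> p) = Some q'" using * \<Phi>_\<omega> by simp
    then obtain p' where "\<alpha> p = Some p'" "q' = \<omega> p'" by (cases "\<alpha> p") simp_all
    then show "\<exists>p p'. p \<in> ?P \<and> q = \<omega> p \<and> q' = \<omega> p' \<and> \<alpha> p = Some p'" using p by blast
  next
    assume "\<exists>p p'. p \<in> ?P \<and> q = \<omega> p \<and> q' = \<omega> p' \<and> \<alpha> p = Some p'"
    then show "\<Phi> \<alpha> q = Some q'" using \<Phi>_\<omega> by auto
  qed
  have mem: "\<Phi> \<alpha> \<in> ?U" if \<alpha>: "\<alpha> \<in> ?T" for \<alpha>
  proof -
    note A = compressionsD[OF \<alpha>]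
    note F = forest_carrierD[OF A(1)]
    note DP = downset_parts[OF dom_downset[OF A(1)]]
    have carrier: "\<Phi> \<alpha> \<in> carrier (forest_maps m n)"
    proof (rule forest_carrierI)
      show "p \<in> ?P \<and> q \<in> ?P" if "\<Phi> \<alpha> p = Some q" for p q
        using that F(2) \<omega>_P unfolding \<Phi>_iff by blast
      fix p p' q assume "\<Phi> \<alpha> p = Some q" "\<Phi> \<alpha> p' = Some q"
      then obtain u u' s s' where u: "p = \<omega> u" "q = \<omega> s" "\<alpha> u = Some s" "p' = \<omega> u'" "q = \<omega> s'" "\<alpha> u' = Some s'"
        unfolding \<Phi>_iff by blast
      then have "s = s'" using inj_onD[OF \<omega>_inj] F(2) by metis
      then show "p = p'" using F(3) u by blast
    next
      fix x z x' z' assume "\<Phi> \<alpha> (x, z) = Some (x', z')"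
      then obtain p p' where p: "p \<in> ?P" "(x, z) = \<omega> p" "(x', z') = \<omega> p'" "\<alpha> p = Some p'"
        unfolding \<Phi>_iff by blast
      have "\<alpha> (fst p, snd p) = Some (fst p', snd p')" using p(4) by simp
      from F(4)[OF this] F(5)[OF this] have "\<alpha> (fst p, None) = Some (fst p', None)" "snd p' = None \<longleftrightarrow> snd p = None"
        by auto
      moreover from this(1) have "\<Phi> \<alpha> (\<omega> (fst p, None)) = Some (\<omega> (fst p', None))"
        using \<Phi>_\<omega>[OF F(1), of "(fst p, None)"] by simp
      ultimately show "\<Phi> \<alpha> (x, None) = Some (x', None) \<and> (z' = None \<longleftrightarrow> z = None)"
        using p(2,3) by (simp add: \<omega>_def)
    qed
    have base: "base (dom (\<Phi> \<alpha>)) = w ` base (dom \<alpha>)"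
    proof
      show "base (dom (\<Phi> \<alpha>)) \<subseteq> w ` base (dom \<alpha>)"
      proof
        fix u assume "u \<in> base (dom (\<Phi> \<alpha>))"
        then obtain q where "\<Phi> \<alpha> (u, None) = Some q" by (auto simp: base_def)
        then obtain p p' where p: "(u, None) = \<omega> p" "\<alpha> p = Some p'" unfolding \<Phi>_iff by blast
        then have "u = w (fst p)" "p = (fst p, None)" by (auto simp: \<omega>_def prod_eq_iff)
        then show "u \<in> w ` base (dom \<alpha>)" using p(2) by (auto simp: base_def)
      qed
      show "w ` base (dom \<alpha>) \<subseteq> base (dom (\<Phi> \<alpha>))"
      proof
        fix u assume "u \<in> w ` base (dom \<alpha>)"
        then obtain x q where u: "u = w x" "\<alpha> (x, None) = Some q" by (auto simp: base_def)
        then have "\<Phi> \<alpha> (w x, None) = Some (\<omega> q)" using \<Phi>_\<omega>[OF F(1)[OF u(2)], of \<alpha>] by simp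
        then show "u \<in> base (dom (\<Phi> \<alpha>))" using u by (auto simp: base_def)
      qed
    qed
    have fibre: "fibre (dom (\<Phi> \<alpha>)) (w x) = v x ` fibre (dom \<alpha>) x" if x: "x \<in> ?N" for x
    proof
      show "fibre (dom (\<Phi> \<alpha>)) (w x) \<subseteq> v x ` fibre (dom \<alpha>) x"
      proof
        fix u assume "u \<in> fibre (dom (\<Phi> \<alpha>)) (w x)"
        then obtain q where "\<Phi> \<alpha> (w x, Some u) = Some q" by (auto simp: fibre_def)
        then obtain p p' where p: "p \<in> ?P" "(w x, Some u) = \<omega> p" "\<alpha> p = Some p'" unfolding \<Phi>_iff by blast
        have "fst p \<in> ?N" "w (fst p) = w x" using p(1,2) by (auto simp: points_def \<omega>_def)
        then have "fst p = x" using inj_onD[OF bij_betw_imp_inj_on[OF w(1)]] x by blast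
        then obtain y where "p = (x, Some y)" "u = v x y"
          using p(2) by (cases p; cases "snd p") (auto simp: \<omega>_def)
        then show "u \<in> v x ` fibre (dom \<alpha>) x" using p(3) by (auto simp: fibre_def)
      qed
      show "v x ` fibre (dom \<alpha>) x \<subseteq> fibre (dom (\<Phi> \<alpha>)) (w x)"
      proof
        fix u assume "u \<in> v x ` fibre (dom \<alpha>) x"
        then obtain y q where u: "u = v x y" "\<alpha> (x, Some y) = Some q" by (auto simp: fibre_def)
        then have "\<Phi> \<alpha> (w x, Some u) = Some (\<omega> q)" using \<Phi>_\<omega>[OF F(1)[OF u(2)], of \<alpha>] by simp
        then show "u \<in> fibre (dom (\<Phi> \<alpha>)) (w x)" using u by (auto simp: fibre_def)
      qed
    qed
    have "\<kappa>' x' = (fst (\<kappa>' x), rank \<kappa>' (base (dom (\<Phi> \<alpha>))) x)" if \<Phi>: "\<Phi> \<alpha> (x, None) = Some (x', None)" for x x'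
    proof -
      obtain p p' where p: "(x, None) = \<omega> p" "(x', None) = \<omega> p'" "\<alpha> p = Some p'"
        using \<Phi> unfolding \<Phi>_iff by blast
      define u u' where "u = fst p" "u' = fst p'"
      have u: "\<alpha> (u, None) = Some (u', None)" "x = w u" "x' = w u'"
        using p by (cases p; cases p'; auto simp: \<omega>_def u_u'_def)+
      have uN: "u \<in> ?N" "u' \<in> ?N" using F(1,2)[OF u(1)] by (auto simp: points_def)
      have "rank \<kappa>' (w ` base (dom \<alpha>)) (w u) = rank \<kappa> (base (dom \<alpha>)) u"
        by (rule rank_transport[OF bij_betw_imp_inj_on[OF w(1)] DP(1) uN(1) bij_betw_imp_inj_on[OF \<gamma>] w(2)])
      then show ?thesis using w(2)[OF uN(1)] w(2)[OF uN(2)] A(2)[OF u(1)] by (simp add: base u)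
    qed
    moreover have "\<nu>' x' y' = (fst (\<nu>' x y), rank (\<nu>' x) (fibre (dom (\<Phi> \<alpha>)) x) y)"
      if \<Phi>: "\<Phi> \<alpha> (x, Some y) = Some (x', Some y')" for x y x' y'
    proof -
      obtain p p' where p: "(x, Some y) = \<omega> p" "(x', Some y') = \<omega> p'" "\<alpha> p = Some p'"
        using \<Phi> unfolding \<Phi>_iff by blast
      obtain u s where u: "p = (u, Some s)" using p(1) by (cases p; cases "snd p") (auto simp: \<omega>_def)
      obtain u' s' where u': "p' = (u', Some s')" using p(2) by (cases p'; cases "snd p'") (auto simp: \<omega>_def)
      have xy: "x = w u" "y = v u s" "x' = w u'" "y' = v u' s'" using p u u' by auto
      have a: "\<alpha> (u, Some s) = Some (u', Some s')" using p u u' by simp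
      have uN: "u \<in> ?N" "u' \<in> ?N" "s \<in> ?M" "s' \<in> ?M" using F(1,2)[OF a] by (auto simp: points_def)
      have b: "fst (\<kappa> u') = fst (\<kappa> u)" using A(2)[OF F(4)[OF a]] by simp
      have \<delta>i: "inj_on (\<delta> (fst (\<kappa> u))) (fst ` \<nu> u ` ?M)"
        using bij_betw_imp_inj_on[OF \<delta>] cl(1)[OF uN(1)] uN(1) by (metis imageI)
      have "rank (\<nu>' (w u)) (v u ` fibre (dom \<alpha>) u) (v u s) = rank (\<nu> u) (fibre (dom \<alpha>) u) s"
        by (rule rank_transport[OF bij_betw_imp_inj_on[OF v[OF uN(1)]] DP(2) uN(3) \<delta>i v'[OF uN(1)]])
      then show ?thesis
        using v'[OF uN(1,3)] v'[OF uN(2,4)] A(3)[OF a] b by (simp add: fibre[OF uN(1)] xy)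
    qed
    ultimately show ?thesis using carrier unfolding compressions_def by blast
  qed
  have hom: "\<Phi> (\<beta> \<circ>\<^sub>m \<alpha>) = \<Phi> \<beta> \<circ>\<^sub>m \<Phi> \<alpha>" if \<alpha>: "\<alpha> \<in> ?T" for \<alpha> \<beta>
  proof
    fix q
    note F = forest_carrierD[OF compressionsD(1)[OF \<alpha>]]
    show "\<Phi> (\<beta> \<circ>\<^sub>m \<alpha>) q = (\<Phi> \<beta> \<circ>\<^sub>m \<Phi> \<alpha>) q"
    proof (cases "q \<in> ?P")
      case True
      then obtain p where p: "p \<in> ?P" "q = \<omega> p" using \<omega>_surj by blast
      show ?thesis
        using p \<Phi>_\<omega> F(2)[of p] by (cases "\<alpha> p") (auto simp: map_comp_def)
    next
      case False
      then show ?thesis by (simp add: \<Phi>_def map_comp_def)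
    qed
  qed
  have inj: "inj_on \<Phi> ?T"
  proof (rule inj_onI)
    fix \<alpha> \<beta> assume ab: "\<alpha> \<in> ?T" "\<beta> \<in> ?T" "\<Phi> \<alpha> = \<Phi> \<beta>"
    note FA = forest_carrierD[OF compressionsD(1)[OF ab(1)]] and FB = forest_carrierD[OF compressionsD(1)[OF ab(2)]]
    have "dom \<alpha> = dom \<beta>"
    proof -
      have "p \<in> dom \<alpha> \<longleftrightarrow> p \<in> dom \<beta>" if "p \<in> ?P" for p
        using \<Phi>_\<omega>[OF that, of \<alpha>] \<Phi>_\<omega>[OF that, of \<beta>] ab(3) by (metis domIff option.map_disc_iff)
      then show ?thesis using FA(1) FB(1) by blast
    qed
    then show "\<alpha> = \<beta>" by (rule compressions_unique[OF ch ab(1,2)])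
  qed
  have "\<Phi> ` ?T = ?U"
  proof (rule card_seteq)
    show "finite ?U" by (rule card_compressions[OF ch'])
    show "\<Phi> ` ?T \<subseteq> ?U" using mem by blast
    show "card ?U \<le> card (\<Phi> ` ?T)"
      using card_image[OF inj] card_compressions(2)[OF ch] card_compressions(2)[OF ch'] by simp
  qed
  then have "\<Phi> \<in> iso ((forest_maps m n)\<lparr>carrier := ?T\<rparr>) ((forest_maps m n)\<lparr>carrier := ?U\<rparr>)"
    using inj hom by (auto simp: iso_def hom_def bij_betw_def)
  then show ?thesis by (rule is_isoI)
qed

lemma sum_shape:
  assumes "finite Z"
  shows "sum_mset (shape Z) = card Z"
proof -
  have "Z = (SIGMA b:fst ` Z. {j. (b, j) \<in> Z})" by force
  moreover have "finite {j. (b, j) \<in> Z}" for b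
    by (rule finite_subset[of _ "snd ` Z"]) (use assms in force)+
  ultimately have "card Z = (\<Sum>b\<in>fst ` Z. card {j. (b, j) \<in> Z})"
    using assms card_SigmaI[of "fst ` Z" "\<lambda>b. {j. (b, j) \<in> Z}"] by (metis finite_imageI)
  then show ?thesis by (simp add: shape_def column_def[abs_def] sum_unfold_sum_mset)
qed

lemma column_pos:
  assumes "finite Z" "b \<in> fst ` Z"
  shows "column Z b > 0"
proof -
  have "finite {j. (b, j) \<in> Z}"
    by (rule finite_subset[of _ "snd ` Z"]) (use assms in force)+
  then show ?thesis using assms(2) by (auto simp: column_def card_gt_0_iff)
qed

definition partitions :: "nat \<Rightarrow> nat multiset set" where
  "partitions m = {M. (\<forall>k\<in>#M. 0 < k) \<and> \<Sum>\<^sub># M = m}"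

definition forest_shapes :: "nat \<Rightarrow> nat \<Rightarrow> (nat \<times> nat multiset) multiset set" where
  "forest_shapes m n = {Q. (\<forall>(k, M)\<in>#Q. 0 < k \<and> M \<in> partitions m) \<and> \<Sum>\<^sub># (image_mset fst Q) = n}"

lemma forest_shape_in:
  assumes ch: "forest_chart m n \<kappa> \<nu>"
  shows "forest_shape m n \<kappa> \<nu> \<in> forest_shapes m n"
proof -
  note C = forest_chartD[OF ch]
  have "0 < column (\<kappa> ` {1..n}) b \<and> shape (cells m n \<kappa> \<nu> b) \<in> partitions m"
    if b: "b \<in> fst ` \<kappa> ` {1..n}" for b
  proof -
    obtain x where x: "x \<in> {1..n}" "b = fst (\<kappa> x)" using b by blast
    have cl: "cells m n \<kappa> \<nu> b = \<nu> x ` {1..m}" using cells_eq[OF ch x(1)] x(2) by simp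
    have "inj_on (\<nu> x) {1..m}" using C(2)[OF x(1)] by (simp add: chart_def)
    then have "card (\<nu> x ` {1..m}) = m" by (simp add: card_image)
    then have "sum_mset (shape (\<nu> x ` {1..m})) = m" by (simp add: sum_shape)
    moreover have "\<forall>k\<in>#shape (\<nu> x ` {1..m}). 0 < k" by (auto simp: shape_def column_pos)
    ultimately show ?thesis using b by (simp add: cl partitions_def column_pos)
  qed
  moreover have "sum_mset (image_mset fst (forest_shape m n \<kappa> \<nu>)) = n"
  proof -
    have "image_mset fst (forest_shape m n \<kappa> \<nu>) = shape (\<kappa> ` {1..n})"
      by (simp add: forest_shape_def shape_def image_mset.compositionality comp_def)
    moreover have "inj_on \<kappa> {1..n}" using C(1) by (simp add: chart_def)
    ultimately show ?thesis by (simp add: sum_shape card_image)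
  qed
  ultimately show ?thesis by (auto simp: forest_shapes_def forest_shape_def)
qed

text \<open>A set of cells with prescribed column sizes, used to realize every shape.\<close>
definition staircase :: "nat list \<Rightarrow> (nat \<times> nat) set" where
  "staircase l = {(b, j). b < length l \<and> j < l ! b}"

lemma staircase:
  assumes "\<forall>k\<in>set l. 0 < k"
  shows "fst ` staircase l = {..<length l}" "b < length l \<Longrightarrow> column (staircase l) b = l ! b"
    and "finite (staircase l)" "shape (staircase l) = mset l" "card (staircase l) = sum_list l"
proof -
  show f: "fst ` staircase l = {..<length l}"
    using assms by (force simp: staircase_def image_iff)
  show c: "column (staircase l) b = l ! b" if "b < length l" for b
    using that by (simp add: column_def staircase_def)
  have "staircase l = (SIGMA b:{..<length l}. {..<l ! b})" by (auto simp: staircase_def)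
  then show fin: "finite (staircase l)" by simp
  have "shape (staircase l) = image_mset ((!) l) (mset_set {..<length l})"
    unfolding shape_def f by (rule image_mset_cong) (simp add: c)
  also have "\<dots> = mset (map ((!) l) [0..<length l])"
    by (simp only: mset_map mset_upt) (simp add: lessThan_atLeast0)
  also have "\<dots> = mset l" by (simp add: map_nth)
  finally show s: "shape (staircase l) = mset l" .
  show "card (staircase l) = sum_list l" using sum_shape[OF fin] s by (simp add: sum_mset_sum_list)
qed

lemma ex_chart_staircase:
  assumes "finite X" "card X = card (staircase l)" "finite (staircase l)"
  shows "\<exists>\<kappa>. chart X \<kappa> \<and> \<kappa> ` X = staircase l"
proof -
  obtain \<kappa> where "bij_betw \<kappa> X (staircase l)"
    using finite_same_card_bij[OF assms(1,3,2)] by blast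
  then have k: "inj_on \<kappa> X" "\<kappa> ` X = staircase l" by (auto simp: bij_betw_def)
  have "(fst (\<kappa> x), j) \<in> staircase l" if "x \<in> X" "j < snd (\<kappa> x)" for x j
  proof -
    have "(fst (\<kappa> x), snd (\<kappa> x)) \<in> staircase l" using k(2) that(1) by auto
    then show ?thesis using that(2) by (simp add: staircase_def split: prod.splits)
  qed
  then show ?thesis using k by (auto simp: chart_def)
qed

lemma ex_forest_chart:
  assumes Q: "Q \<in> forest_shapes m n"
  shows "\<exists>\<kappa> \<nu>. forest_chart m n \<kappa> \<nu> \<and> forest_shape m n \<kappa> \<nu> = Q"
proof -
  obtain L where L: "mset L = Q" using ex_mset by blast
  have Ld: "0 < fst p" "snd p \<in> partitions m" if "p \<in> set L" for p
    using Q that L by (auto simp: forest_shapes_def case_prod_unfold)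
  let ?k = "map fst L"
  have kpos: "\<forall>k\<in>set ?k. 0 < k" using Ld(1) by auto
  have "sum_list ?k = n" using Q L by (auto simp: forest_shapes_def sum_mset_sum_list[symmetric])
  then obtain \<kappa> where \<kappa>: "chart {1..n} \<kappa>" "\<kappa> ` {1..n} = staircase ?k"
    using ex_chart_staircase[of "{1..n}" ?k] staircase(3,5)[OF kpos] by auto
  have "\<exists>\<mu> :: nat \<Rightarrow> nat \<times> nat. chart {1..m} \<mu> \<and> shape (\<mu> ` {1..m}) = snd (L ! b)" if b: "b < length L" for b
  proof -
    obtain l where l: "mset l = snd (L ! b)" using ex_mset by blast
    have "snd (L ! b) \<in> partitions m" using Ld(2) b by simp
    then have lp: "\<forall>k\<in>set l. 0 < k" "sum_list l = m"
      unfolding l[symmetric] by (auto simp: partitions_def sum_mset_sum_list)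
    then obtain \<mu> where "chart {1..m} \<mu>" "\<mu> ` {1..m} = staircase l"
      using ex_chart_staircase[of "{1..m}" l] staircase(3,5)[OF lp(1)] by auto
    then have "chart {1..m} \<mu> \<and> shape (\<mu> ` {1..m}) = snd (L ! b)"
      using staircase(4)[OF lp(1)] l by simp
    then show ?thesis by blast
  qed
  then obtain \<mu> :: "nat \<Rightarrow> nat \<Rightarrow> nat \<times> nat" where \<mu>: "\<And>b. b < length L \<Longrightarrow> chart {1..m} (\<mu> b) \<and> shape (\<mu> b ` {1..m}) = snd (L ! b)"
    by metis
  define \<nu> where "\<nu> x = \<mu> (fst (\<kappa> x))" for x
  have b: "fst (\<kappa> x) < length L" if "x \<in> {1..n}" for x
  proof -
    have "fst (\<kappa> x) \<in> fst ` \<kappa> ` {1..n}" using that by blast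
    then show ?thesis unfolding \<kappa>(2) staircase(1)[OF kpos] by simp
  qed
  have ch: "forest_chart m n \<kappa> \<nu>"
    unfolding forest_chart_def using \<kappa>(1) \<mu> b by (simp add: \<nu>_def)
  have im: "fst ` \<kappa> ` {1..n} = {..<length L}" using staircase(1)[OF kpos] \<kappa>(2) by simp
  have "forest_shape m n \<kappa> \<nu> = image_mset ((!) L) (mset_set {..<length L})"
    unfolding forest_shape_def im
  proof (rule image_mset_cong)
    fix b assume "b \<in># mset_set {..<length L}"
    then have bL: "b < length L" by simp
    then obtain x where x: "x \<in> {1..n}" "b = fst (\<kappa> x)" using im by (metis (no_types, lifting) image_iff lessThan_iff)
    have "cells m n \<kappa> \<nu> b = \<mu> b ` {1..m}" using cells_eq[OF ch x(1)] x(2) by (simp add: \<nu>_def)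
    then show "(column (\<kappa> ` {1..n}) b, shape (cells m n \<kappa> \<nu> b)) = L ! b"
      using \<mu>[OF bL] staircase(2)[OF kpos] bL \<kappa>(2) by (simp add: prod_eq_iff)
  qed
  also have "\<dots> = mset (map ((!) L) [0..<length L])"
    by (simp only: mset_map mset_upt) (simp add: lessThan_atLeast0)
  also have "\<dots> = Q" by (simp add: map_nth L)
  finally show ?thesis using ch by blast
qed

section \<open>Recovering the shape from the abstract semigroup\<close>

definition is_zero :: "('s, 'b) monoid_scheme \<Rightarrow> 's \<Rightarrow> bool" where
  "is_zero G z \<longleftrightarrow> z \<in> carrier G \<and> (\<forall>t\<in>carrier G. z \<otimes>\<^bsub>G\<^esub> t = z \<and> t \<otimes>\<^bsub>G\<^esub> z = z)"

definition idempotents :: "('s, 'b) monoid_scheme \<Rightarrow> 's set" where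
  "idempotents G = {e \<in> carrier G. e \<otimes>\<^bsub>G\<^esub> e = e}"

text \<open>Minimal nonzero idempotents. In a semigroup of compressions they are the identities on the first
  root of a block.\<close>
definition atoms :: "('s, 'b) monoid_scheme \<Rightarrow> 's set" where
  "atoms G = {a \<in> idempotents G. \<not> is_zero G a \<and>
     (\<forall>f\<in>idempotents G. f \<otimes>\<^bsub>G\<^esub> a = f \<longrightarrow> is_zero G f \<or> f = a)}"

text \<open>Idempotents \<open>d\<close> above an atom \<open>a\<close> with nothing but \<open>0\<close> and \<open>a\<close> strictly below. For compressions,
  \<open>d\<close> adds to the first root of a block either the first leaf of a leaf block over it or the second
  root of the block. The last condition excludes the second case: there, the map sending the second
  root to the first is a further element \<open>u\<close> with \<open>d u = u\<close> and \<open>u a = u\<close>.\<close>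
definition buds :: "('s, 'b) monoid_scheme \<Rightarrow> 's \<Rightarrow> 's set" where
  "buds G a = {d \<in> idempotents G. d \<noteq> a \<and> a \<otimes>\<^bsub>G\<^esub> d = a \<and>
     (\<forall>f\<in>idempotents G. f \<otimes>\<^bsub>G\<^esub> d = f \<longrightarrow> is_zero G f \<or> f = a \<or> f = d) \<and>
     (\<forall>u\<in>carrier G. d \<otimes>\<^bsub>G\<^esub> u = u \<longrightarrow> u \<otimes>\<^bsub>G\<^esub> a = u \<longrightarrow> is_zero G u \<or> u = a)}"

text \<open>For compressions this counts the maps from a single bare root of the block to its first root, which
  gives the size of the block.\<close>
definition stem_count :: "('s, 'b) monoid_scheme \<Rightarrow> 's \<Rightarrow> nat" where
  "stem_count G a = card {t \<in> carrier G. t \<otimes>\<^bsub>G\<^esub> a = t \<and> \<not> is_zero G t}"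

text \<open>For compressions this counts the maps from one root with one leaf to the first root with the first
  leaf of a leaf block, which gives the size of the block of roots times that of the leaf block.\<close>
definition branch_count :: "('s, 'b) monoid_scheme \<Rightarrow> 's \<Rightarrow> 's \<Rightarrow> nat" where
  "branch_count G a d = card {t \<in> carrier G. t \<otimes>\<^bsub>G\<^esub> d = t \<and> t \<otimes>\<^bsub>G\<^esub> a \<noteq> t}"

definition semigroup_shape :: "('s, 'b) monoid_scheme \<Rightarrow> (nat \<times> nat multiset) multiset" where
  "semigroup_shape G = image_mset
     (\<lambda>a. (stem_count G a, image_mset (\<lambda>d. branch_count G a d div stem_count G a) (mset_set (buds G a))))
     (mset_set (atoms G))"

text \<open>All ingredients are defined from the product alone.\<close>
lemma semigroup_shape_iso:
  assumes h: "h \<in> iso G H"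
    and closed: "\<And>x y. x \<in> carrier G \<Longrightarrow> y \<in> carrier G \<Longrightarrow> x \<otimes>\<^bsub>G\<^esub> y \<in> carrier G"
  shows "semigroup_shape H = semigroup_shape G"
proof -
  let ?C = "carrier G"
  have inj: "inj_on h ?C" and surj: "carrier H = h ` ?C"
    and hom: "\<And>x y. x \<in> ?C \<Longrightarrow> y \<in> ?C \<Longrightarrow> h x \<otimes>\<^bsub>H\<^esub> h y = h (x \<otimes>\<^bsub>G\<^esub> y)"
    using h by (auto simp: iso_def hom_def bij_betw_def)
  have eq: "h x \<otimes>\<^bsub>H\<^esub> h y = h z \<longleftrightarrow> x \<otimes>\<^bsub>G\<^esub> y = z" if "x \<in> ?C" "y \<in> ?C" "z \<in> ?C" for x y z
    using hom that closed inj_on_eq_iff[OF inj] by simp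
  have zero: "is_zero H (h x) \<longleftrightarrow> is_zero G x" if "x \<in> ?C" for x
    using that by (simp add: is_zero_def surj eq)
  have idem: "idempotents H = h ` idempotents G"
    using eq by (auto simp: idempotents_def surj)
  have iC: "idempotents G \<subseteq> ?C" by (auto simp: idempotents_def)
  have heq: "h x = h y \<longleftrightarrow> x = y" if "x \<in> ?C" "y \<in> ?C" for x y
    using that by (rule inj_on_eq_iff[OF inj])
  have all: "(\<forall>f\<in>h ` A. Q f) \<longleftrightarrow> (\<forall>f\<in>A. Q (h f))" for A Q by blast
  have filter: "{u \<in> h ` A. Q u} = h ` {x \<in> A. Q' x}" if "\<And>x. x \<in> A \<Longrightarrow> Q (h x) \<longleftrightarrow> Q' x" for A Q Q'
    using that by blast
  have ball_idem: "(\<forall>f\<in>idempotents G. Q f) \<longleftrightarrow> (\<forall>f\<in>idempotents G. Q' f)"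
    if "\<And>f. f \<in> ?C \<Longrightarrow> Q f \<longleftrightarrow> Q' f" for Q Q'
    using that iC by (intro ball_cong) auto
  have atoms: "atoms H = h ` atoms G"
    unfolding atoms_def idem all
    by (rule filter, intro conj_cong ball_idem) (use iC in \<open>auto simp: eq zero heq subset_iff\<close>)
  have buds: "buds H (h a) = h ` buds G a" if aC: "a \<in> ?C" for a
    unfolding buds_def idem surj all
    by (rule filter, intro conj_cong ball_idem ball_cong) (use iC aC in \<open>auto simp: eq zero heq subset_iff\<close>)
  have card_h: "card (h ` {x \<in> ?C. Q x}) = card {x \<in> ?C. Q x}" for Q
    by (rule card_image) (rule inj_on_subset[OF inj], blast)
  have stem_count: "stem_count H (h a) = stem_count G a" if aC: "a \<in> ?C" for a
  proof -
    have "{t \<in> carrier H. t \<otimes>\<^bsub>H\<^esub> h a = t \<and> \<not> is_zero H t} =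
        h ` {t \<in> ?C. t \<otimes>\<^bsub>G\<^esub> a = t \<and> \<not> is_zero G t}"
      unfolding surj by (rule filter) (simp add: eq zero aC)
    then show ?thesis by (simp add: stem_count_def card_h)
  qed
  have branch_count: "branch_count H (h a) (h d) = branch_count G a d" if C: "a \<in> ?C" "d \<in> ?C" for a d
  proof -
    have "{t \<in> carrier H. t \<otimes>\<^bsub>H\<^esub> h d = t \<and> t \<otimes>\<^bsub>H\<^esub> h a \<noteq> t} =
        h ` {t \<in> ?C. t \<otimes>\<^bsub>G\<^esub> d = t \<and> t \<otimes>\<^bsub>G\<^esub> a \<noteq> t}"
      unfolding surj by (rule filter) (simp add: eq C)
    then show ?thesis by (simp add: branch_count_def card_h)
  qed
  have aC: "atoms G \<subseteq> ?C" and bC: "\<And>a. buds G a \<subseteq> ?C" using iC by (auto simp: atoms_def buds_def)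
  have push: "mset_set (h ` A) = image_mset h (mset_set A)" if "A \<subseteq> ?C" for A
    by (rule image_mset_mset_set[symmetric]) (rule inj_on_subset[OF inj that])
  have in_C: "x \<in> ?C" if "x \<in># mset_set A" "A \<subseteq> ?C" for x A
    using that by (cases "finite A") auto
  have "semigroup_shape H = image_mset (\<lambda>a. (stem_count H (h a),
      image_mset (\<lambda>d. branch_count H (h a) (h d) div stem_count H (h a)) (mset_set (buds G a)))) (mset_set (atoms G))"
    unfolding semigroup_shape_def atoms push[OF aC] multiset.map_comp comp_def
  proof (rule image_mset_cong)
    fix a assume "a \<in># mset_set (atoms G)"
    then have "a \<in> ?C" by (rule in_C[OF _ aC])
    then show "(stem_count H (h a), image_mset (\<lambda>d. branch_count H (h a) d div stem_count H (h a)) (mset_set (buds H (h a)))) =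
        (stem_count H (h a), image_mset (\<lambda>d. branch_count H (h a) (h d) div stem_count H (h a)) (mset_set (buds G a)))"
      by (simp add: buds push[OF bC] multiset.map_comp comp_def)
  qed
  also have "\<dots> = semigroup_shape G"
    unfolding semigroup_shape_def
  proof (rule image_mset_cong)
    fix a assume "a \<in># mset_set (atoms G)"
    then have a: "a \<in> ?C" by (rule in_C[OF _ aC])
    have "image_mset (\<lambda>d. branch_count H (h a) (h d) div stem_count H (h a)) (mset_set (buds G a)) =
        image_mset (\<lambda>d. branch_count G a d div stem_count G a) (mset_set (buds G a))"
      using in_C[OF _ bC] a by (intro image_mset_cong) (simp add: branch_count stem_count)
    then show "(stem_count H (h a), image_mset (\<lambda>d. branch_count H (h a) (h d) div stem_count H (h a)) (mset_set (buds G a))) =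
        (stem_count G a, image_mset (\<lambda>d. branch_count G a d div stem_count G a) (mset_set (buds G a)))"
      by (simp add: stem_count a)
  qed
  finally show ?thesis .
qed

text \<open>At most \<open>snd (\<mu> x)\<close> points lie below \<open>x\<close>, so if the rank in \<open>D\<close> reaches that number, then \<open>D\<close>
  contains them all. This makes domains of idempotent compressions closed under going down in a block.\<close>
lemma rank_eq_snd_below:
  assumes "chart X \<mu>" "finite X" "D \<subseteq> X" "rank \<mu> D x = snd (\<mu> x)"
    and "u \<in> X" "fst (\<mu> u) = fst (\<mu> x)" "snd (\<mu> u) < snd (\<mu> x)"
  shows "u \<in> D"
proof -
  let ?L = "\<lambda>D. {y \<in> D. fst (\<mu> y) = fst (\<mu> x) \<and> snd (\<mu> y) < snd (\<mu> x)}"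
  have "?L D = ?L X"
  proof (rule card_seteq)
    show "finite (?L X)" using assms(2) by simp
    show "?L D \<subseteq> ?L X" using assms(3) by blast
    show "card (?L X) \<le> card (?L D)"
      using rank_le[OF assms(1) subset_refl, of x] assms(4) by (simp add: rank_def)
  qed
  then show ?thesis using assms(5,6,7) by blast
qed

lemma card_block:
  assumes "chart X \<mu>"
  shows "card {x \<in> X. fst (\<mu> x) = b} = column (\<mu> ` X) b"
proof -
  let ?X = "{x \<in> X. fst (\<mu> x) = b}"
  have "inj_on (snd \<circ> \<mu>) ?X"
  proof (rule inj_onI)
    fix u v assume "u \<in> ?X" "v \<in> ?X" "(snd \<circ> \<mu>) u = (snd \<circ> \<mu>) v"
    then have "\<mu> u = \<mu> v" "u \<in> X" "v \<in> X" by (auto simp: prod_eq_iff)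
    then show "u = v" by (rule chart_inj[OF assms])
  qed
  then have "card ((snd \<circ> \<mu>) ` ?X) = card ?X" by (rule card_image)
  moreover have "(snd \<circ> \<mu>) ` ?X = {j. (b, j) \<in> \<mu> ` X}"
  proof
    show "(snd \<circ> \<mu>) ` ?X \<subseteq> {j. (b, j) \<in> \<mu> ` X}"
    proof
      fix j assume "j \<in> (snd \<circ> \<mu>) ` ?X"
      then obtain x where "x \<in> X" "fst (\<mu> x) = b" "snd (\<mu> x) = j" by auto
      then have "x \<in> X" "\<mu> x = (b, j)" by (simp_all add: prod_eq_iff)
      then show "j \<in> {j. (b, j) \<in> \<mu> ` X}" by (metis imageI mem_Collect_eq)
    qed
    show "{j. (b, j) \<in> \<mu> ` X} \<subseteq> (snd \<circ> \<mu>) ` ?X"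
    proof
      fix j assume "j \<in> {j. (b, j) \<in> \<mu> ` X}"
      then obtain x where "x \<in> X" "\<mu> x = (b, j)" by (metis imageE mem_Collect_eq)
      then show "j \<in> (snd \<circ> \<mu>) ` ?X" by (intro image_eqI[of _ _ x]) auto
    qed
  qed
  ultimately show ?thesis unfolding column_def by (simp only:)
qed

lemma chart_root:
  assumes "chart X \<mu>" "b \<in> fst ` \<mu> ` X"
  shows "inv_into X \<mu> (b, 0) \<in> X" "\<mu> (inv_into X \<mu> (b, 0)) = (b, 0)"
proof -
  obtain x where x: "x \<in> X" "b = fst (\<mu> x)" using assms(2) by blast
  have "(b, 0) \<in> \<mu> ` X"
  proof (cases "snd (\<mu> x)")
    case 0
    then have "\<mu> x = (b, 0)" using x(2) by (simp add: prod_eq_iff)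
    then show ?thesis using x(1) by (metis imageI)
  qed (use assms(1) x in \<open>simp add: chart_def\<close>)
  then show "inv_into X \<mu> (b, 0) \<in> X" "\<mu> (inv_into X \<mu> (b, 0)) = (b, 0)"
    by (rule inv_into_into, rule f_inv_into_f)
qed

lemma rank_singleton [simp]: "rank \<mu> {x} x = 0"
  by (simp add: rank_def)

lemma right_id_iff: "id_map F \<circ>\<^sub>m t = t \<longleftrightarrow> ran t \<subseteq> F"
  by (auto simp: fun_eq_iff map_comp_def id_map_def ran_def split: option.splits)

lemma left_id_iff: "t \<circ>\<^sub>m id_map F = t \<longleftrightarrow> dom t \<subseteq> F"
proof
  show "dom t \<subseteq> F" if "t \<circ>\<^sub>m id_map F = t"
  proof
    fix p assume "p \<in> dom t"
    then have "(t \<circ>\<^sub>m id_map F) p \<noteq> None" using that by auto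
    then show "p \<in> F" by (auto simp: map_comp_def id_map_def split: if_splits)
  qed
  show "t \<circ>\<^sub>m id_map F = t" if "dom t \<subseteq> F"
    using that by (intro map_eqI) (auto simp: map_comp_Some_iff)
qed

lemma ran_id_map [simp]: "ran (id_map F) = F" by (auto simp: ran_def)

lemma id_map_inject [simp]: "id_map F = id_map F' \<longleftrightarrow> F = F'" by (metis dom_id_map)

locale charted_forest =
  fixes m n :: nat and \<kappa> :: "nat \<Rightarrow> nat \<times> nat" and \<nu> :: "nat \<Rightarrow> nat \<Rightarrow> nat \<times> nat"
  assumes ch: "forest_chart m n \<kappa> \<nu>"
begin

abbreviation "N \<equiv> {1..n}"
abbreviation "M \<equiv> {1..m}"
abbreviation "T \<equiv> compressions m n \<kappa> \<nu>"
abbreviation "G \<equiv> (forest_maps m n)\<lparr>carrier := T\<rparr>"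
abbreviation "B \<equiv> fst ` \<kappa> ` N"

lemmas C = forest_chartD[OF ch]

lemma empty_T: "Map.empty \<in> T"
  unfolding compressions_def by (auto intro: forest_carrierI)

lemma zero_iff: "is_zero G t \<longleftrightarrow> t = Map.empty"
proof
  assume "is_zero G t"
  then have "\<forall>s\<in>T. s \<circ>\<^sub>m t = t" by (simp add: is_zero_def)
  then have "Map.empty \<circ>\<^sub>m t = t" by (rule bspec[OF _ empty_T])
  moreover have "Map.empty \<circ>\<^sub>m t = Map.empty" by (simp add: map_comp_def fun_eq_iff split: option.splits)
  ultimately show "t = Map.empty" by simp
qed (use empty_T in \<open>simp add: is_zero_def\<close>)

text \<open>An injective idempotent fixes its image pointwise and hence is the identity of its domain.\<close>
lemma idempotentE:
  assumes "e \<in> idempotents G"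
  obtains F where "e = id_map F" "id_map F \<in> T" "F \<in> downsets m n"
proof -
  have e: "e \<in> T" "e \<circ>\<^sub>m e = e" using assms by (auto simp: idempotents_def)
  note F = forest_carrierD[OF compressionsD(1)[OF e(1)]]
  have "e p = Some q \<longleftrightarrow> p \<in> dom e \<and> q = p" for p q
  proof -
    have "q = p" if pq: "e p = Some q" for p q
    proof -
      have "(e \<circ>\<^sub>m e) p = Some q" using e(2) pq by simp
      then have "e q = Some q" using pq by (simp add: map_comp_def)
      then show ?thesis using F(3)[OF _ pq] by blast
    qed
    then show ?thesis by blast
  qed
  then have "e = id_map (dom e)" by (intro map_eqI) simp
  then show thesis using that[of "dom e"] e(1) dom_downset[OF compressionsD(1)[OF e(1)]] by simp
qed

lemma idempotentI: "id_map F \<in> T \<Longrightarrow> id_map F \<in> idempotents G"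
  by (simp add: idempotents_def right_id_iff)

lemma base_closed:
  assumes "id_map F \<in> T" "(x, None) \<in> F" "u \<in> N" "fst (\<kappa> u) = fst (\<kappa> x)" "snd (\<kappa> u) < snd (\<kappa> x)"
  shows "(u, None) \<in> F"
proof -
  have F: "F \<in> downsets m n" using dom_downset[OF compressionsD(1)[OF assms(1)]] by simp
  have "\<kappa> x = (fst (\<kappa> x), rank \<kappa> (base F) x)" using compressionsD(2)[OF assms(1), of x x] assms(2) by simp
  then have "rank \<kappa> (base F) x = snd (\<kappa> x)" by (metis snd_conv)
  with assms(3-5) have "u \<in> base F" by (intro rank_eq_snd_below[OF C(1) _ downset_parts(1)[OF F], of x]) auto
  then show ?thesis by (simp add: base_def)
qed

lemma fibre_closed:
  assumes "id_map F \<in> T" "(x, Some y) \<in> F" "v \<in> M" "fst (\<nu> x v) = fst (\<nu> x y)" "snd (\<nu> x v) < snd (\<nu> x y)"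
  shows "(x, Some v) \<in> F"
proof -
  have F: "F \<in> downsets m n" using dom_downset[OF compressionsD(1)[OF assms(1)]] by simp
  have x: "x \<in> N" using F assms(2) by (auto simp: downsets_def points_def)
  have "\<nu> x y = (fst (\<nu> x y), rank (\<nu> x) (fibre F x) y)"
    using compressionsD(3)[OF assms(1), of x y x y] assms(2) by simp
  then have "rank (\<nu> x) (fibre F x) y = snd (\<nu> x y)" by (metis snd_conv)
  with assms(3-5) have "v \<in> fibre F x"
    by (intro rank_eq_snd_below[OF C(2)[OF x] _ downset_parts(2)[OF F, of x], of y]) auto
  then show ?thesis by (simp add: fibre_def)
qed

text \<open>The first root of a block, and the first leaf of a leaf block over it.\<close>
definition root :: "nat \<Rightarrow> nat" where
  "root b = inv_into N \<kappa> (b, 0)"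

definition tip :: "nat \<Rightarrow> nat \<Rightarrow> nat" where
  "tip b c = inv_into M (\<nu> (root b)) (c, 0)"

abbreviation "cols b \<equiv> fst ` \<nu> (root b) ` M"

lemma root: "b \<in> B \<Longrightarrow> root b \<in> N" "b \<in> B \<Longrightarrow> \<kappa> (root b) = (b, 0)"
  using chart_root[OF C(1)] by (simp_all only: root_def)

lemma tip:
  assumes "b \<in> B" "c \<in> cols b"
  shows "tip b c \<in> M" "\<nu> (root b) (tip b c) = (c, 0)"
  using chart_root[OF C(2)[OF root(1)[OF assms(1)]] assms(2)] by (simp_all only: tip_def)

definition atom_map :: "nat \<Rightarrow> point \<rightharpoonup> point" where
  "atom_map b = id_map {(root b, None)}"

definition bud_map :: "nat \<Rightarrow> nat \<Rightarrow> point \<rightharpoonup> point" where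
  "bud_map b c = id_map {(root b, None), (root b, Some (tip b c))}"

text \<open>Elements with image \<open>{root b}\<close>, and with image \<open>{root b, tip b c}\<close>; they are the ones counted by
  \<open>stem_count\<close> and \<open>branch_count\<close>.\<close>
definition stem :: "nat \<Rightarrow> nat \<Rightarrow> point \<rightharpoonup> point" where
  "stem b x = [(x, None) \<mapsto> (root b, None)]"

definition branch :: "nat \<Rightarrow> nat \<Rightarrow> nat \<times> nat \<Rightarrow> point \<rightharpoonup> point" where
  "branch b c = (\<lambda>(x, y). [(x, None) \<mapsto> (root b, None), (x, Some y) \<mapsto> (root b, Some (tip b c))])"

lemma stem_T:
  assumes "x \<in> N" "b = fst (\<kappa> x)"
  shows "stem b x \<in> T"
proof -
  have b: "b \<in> B" using assms by blast
  have "base {(x, None)} = {x}" by (auto simp: base_def)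
  then show ?thesis
    unfolding compressions_def stem_def
    using assms root[OF b] by (auto intro!: forest_carrierI simp: points_def split: if_splits)
qed

lemma branch_T:
  assumes "x \<in> N" "b = fst (\<kappa> x)" "y \<in> M" "c = fst (\<nu> x y)" "c \<in> cols b"
  shows "branch b c (x, y) \<in> T"
proof -
  have b: "b \<in> B" using assms by blast
  have "base {(x, Some y), (x, None)} = {x}" "fibre {(x, Some y), (x, None)} x = {y}"
    by (auto simp: base_def fibre_def)
  then show ?thesis
    unfolding compressions_def branch_def
    using assms root[OF b] tip[OF b assms(5)]
    by (auto intro!: forest_carrierI simp: points_def split: if_splits)
qed

lemma atom_map_stem: "atom_map b = stem b (root b)"
  by (auto simp: atom_map_def stem_def id_map_def fun_eq_iff)

lemma bud_map_branch: "bud_map b c = branch b c (root b, tip b c)"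
  by (auto simp: bud_map_def branch_def id_map_def fun_eq_iff)

lemma atom_map_T: "b \<in> B \<Longrightarrow> atom_map b \<in> T"
  using stem_T[OF root(1)] root(2) by (simp add: atom_map_stem)

lemma bud_map_T: "b \<in> B \<Longrightarrow> c \<in> cols b \<Longrightarrow> bud_map b c \<in> T"
  using branch_T[OF root(1) _ tip(1), of b b b c c] root(2)[of b] tip(2)[of b c] by (simp add: bud_map_branch)

lemma atom_map_below:
  assumes "id_map F \<in> T" "(x, None) \<in> F"
  shows "fst (\<kappa> x) \<in> B" "(root (fst (\<kappa> x)), None) \<in> F"
proof -
  have "F \<in> downsets m n" using dom_downset[OF compressionsD(1)[OF assms(1)]] by simp
  then have x: "x \<in> N" using assms(2) by (auto simp: downsets_def points_def)
  then show b: "fst (\<kappa> x) \<in> B" by blast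
  show "(root (fst (\<kappa> x)), None) \<in> F"
  proof (cases "snd (\<kappa> x)")
    case 0
    then have "\<kappa> x = \<kappa> (root (fst (\<kappa> x)))" using root(2)[OF b] by (simp add: prod_eq_iff)
    then have "x = root (fst (\<kappa> x))" by (rule chart_inj[OF C(1) _ x root(1)[OF b]])
    then show ?thesis using assms(2) by simp
  next
    case (Suc j)
    then show ?thesis using base_closed[OF assms root(1)[OF b]] root(2)[OF b] by simp
  qed
qed

lemma bud_map_below:
  assumes "id_map F \<in> T" "(root b, Some y) \<in> F" "b \<in> B"
  shows "fst (\<nu> (root b) y) \<in> cols b" "(root b, Some (tip b (fst (\<nu> (root b) y)))) \<in> F"
proof -
  have "F \<in> downsets m n" using dom_downset[OF compressionsD(1)[OF assms(1)]] by simp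
  then have y: "y \<in> M" using assms(2) by (auto simp: downsets_def points_def)
  let ?c = "fst (\<nu> (root b) y)"
  show c: "?c \<in> cols b" using y by blast
  show "(root b, Some (tip b ?c)) \<in> F"
  proof (cases "snd (\<nu> (root b) y)")
    case 0
    then have "\<nu> (root b) y = \<nu> (root b) (tip b ?c)" using tip(2)[OF assms(3) c] by (simp add: prod_eq_iff)
    then have "y = tip b ?c" by (rule chart_inj[OF C(2)[OF root(1)[OF assms(3)]] _ y tip(1)[OF assms(3) c]])
    then show ?thesis using assms(2) by simp
  next
    case (Suc j)
    then show ?thesis using fibre_closed[OF assms(1,2) tip(1)[OF assms(3) c]] tip(2)[OF assms(3) c] by simp
  qed
qed

lemma atom_map_inject: "b \<in> B \<Longrightarrow> b' \<in> B \<Longrightarrow> atom_map b = atom_map b' \<Longrightarrow> b = b'"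
  using root(2) unfolding atom_map_def by (metis Pair_inject id_map_inject singleton_inject)

lemma atom_map_nonzero: "\<not> is_zero G (atom_map b)"
  by (simp add: zero_iff atom_map_stem stem_def)

text \<open>The domain of a nonzero idempotent contains a root, hence the first root of its block.\<close>
lemma atoms_eq: "atoms G = atom_map ` B"
proof
  show "atoms G \<subseteq> atom_map ` B"
  proof
    fix a assume a: "a \<in> atoms G"
    then have ai: "a \<in> idempotents G" "a \<noteq> Map.empty"
      and min: "\<And>f. f \<in> idempotents G \<Longrightarrow> a \<circ>\<^sub>m f = f \<Longrightarrow> is_zero G f \<or> f = a"
      by (auto simp: atoms_def zero_iff)
    obtain F where F: "a = id_map F" "id_map F \<in> T" "F \<in> downsets m n" using idempotentE[OF ai(1)] .
    have "F \<noteq> {}" using ai(2) F(1) by (auto simp: id_map_def fun_eq_iff)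
    then obtain x where x: "(x, None) \<in> F" using F(3) by (auto simp: downsets_def)
    note b = atom_map_below[OF F(2) x]
    have "atom_map (fst (\<kappa> x)) \<in> idempotents G"
      using idempotentI atom_map_T[OF b(1)] by (simp add: atom_map_def)
    moreover have "a \<circ>\<^sub>m atom_map (fst (\<kappa> x)) = atom_map (fst (\<kappa> x))"
      using b(2) by (simp add: F(1) right_id_iff) (simp add: atom_map_def)
    ultimately have "a = atom_map (fst (\<kappa> x))" using min atom_map_nonzero by blast
    then show "a \<in> atom_map ` B" using b(1) by blast
  qed
  show "atom_map ` B \<subseteq> atoms G"
  proof (rule image_subsetI)
    fix b assume b: "b \<in> B"
    have "is_zero G f \<or> f = atom_map b" if f: "f \<in> idempotents G" "atom_map b \<circ>\<^sub>m f = f" for f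
    proof -
      obtain F where F: "f = id_map F" using idempotentE[OF f(1)] by metis
      have "F \<subseteq> {(root b, None)}" using f(2) by (simp add: F atom_map_def right_id_iff)
      then have "F = {} \<or> F = {(root b, None)}" by blast
      then show ?thesis by (auto simp: F atom_map_def zero_iff id_map_def fun_eq_iff)
    qed
    then show "atom_map b \<in> atoms G"
      using idempotentI atom_map_T[OF b] atom_map_nonzero[of b] by (simp add: atoms_def atom_map_def)
  qed
qed

lemma stem_count_atom:
  assumes b: "b \<in> B"
  shows "stem_count G (atom_map b) = column (\<kappa> ` N) b"
proof -
  let ?X = "{x \<in> N. fst (\<kappa> x) = b}"
  have "{t \<in> T. atom_map b \<circ>\<^sub>m t = t \<and> \<not> is_zero G t} = stem b ` ?X"
  proof
    show "stem b ` ?X \<subseteq> {t \<in> T. atom_map b \<circ>\<^sub>m t = t \<and> \<not> is_zero G t}"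
      using stem_T by (auto simp: zero_iff atom_map_def right_id_iff stem_def)
    show "{t \<in> T. atom_map b \<circ>\<^sub>m t = t \<and> \<not> is_zero G t} \<subseteq> stem b ` ?X"
    proof
      fix t assume "t \<in> {t \<in> T. atom_map b \<circ>\<^sub>m t = t \<and> \<not> is_zero G t}"
      then have t: "t \<in> T" "ran t \<subseteq> {(root b, None)}" "t \<noteq> Map.empty"
        by (auto simp: zero_iff atom_map_def right_id_iff)
      note F = forest_carrierD[OF compressionsD(1)[OF t(1)]]
      obtain p q where pq: "t p = Some q" using t(3) by (auto simp: fun_eq_iff)
      then have p: "t p = Some (root b, None)" using t(2) ranI[of t p q, OF pq] by blast
      then obtain x where x: "p = (x, None)" using F(5)[of "fst p" "snd p" "root b" None] by (cases p) auto
      have "t q = Some q' \<longleftrightarrow> stem b x q = Some q'" for q q'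
      proof
        assume q: "t q = Some q'"
        then have "q' = (root b, None)" using t(2) ranI[of t q q', OF q] by blast
        then show "stem b x q = Some q'" using F(3)[OF q] p x by (simp add: stem_def)
      qed (use p x in \<open>auto simp: stem_def split: if_splits\<close>)
      then have "t = stem b x" by (rule map_eqI)
      moreover have "x \<in> N" using F(1)[OF p] x by (simp add: points_def)
      moreover have "fst (\<kappa> x) = b"
        using compressionsD(2)[OF t(1), of x "root b"] p x root(2)[OF b] by simp
      ultimately show "t \<in> stem b ` ?X" by blast
    qed
  qed
  moreover have "inj_on (stem b) ?X"
    by (rule inj_onI) (metis Pair_inject dom_fun_upd dom_empty option.distinct(1) singleton_inject stem_def)
  ultimately have "stem_count G (atom_map b) = card ?X" by (simp add: stem_count_def card_image)
  also have "\<dots> = column (\<kappa> ` N) b" by (rule card_block[OF C(1)])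
  finally show ?thesis .
qed

text \<open>Let \<open>d\<close> be a bud of the atom at \<open>b\<close>. A root from another block in its domain would put another
  atom below \<open>d\<close>, and a further root from the same block is ruled out by the stem starting at it.
  So \<open>d\<close> has one root only; a leaf over it brings the first leaf of its block along, and
  minimality leaves nothing else.\<close>
lemma buds_eq:
  assumes b: "b \<in> B"
  shows "buds G (atom_map b) = bud_map b ` cols b"
proof
  let ?\<rho> = "root b"
  show "bud_map b ` cols b \<subseteq> buds G (atom_map b)"
  proof (rule image_subsetI)
    fix c assume c: "c \<in> cols b"
    let ?F = "{(?\<rho>, None), (?\<rho>, Some (tip b c))}"
    have "is_zero G f \<or> f = atom_map b \<or> f = bud_map b c"
      if f: "f \<in> idempotents G" "bud_map b c \<circ>\<^sub>m f = f" for f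
    proof -
      obtain F where F: "f = id_map F" "F \<in> downsets m n" using idempotentE[OF f(1)] by metis
      have sub: "F \<subseteq> ?F" using f(2) by (simp add: F(1) bud_map_def right_id_iff)
      have "(?\<rho>, Some (tip b c)) \<in> F \<Longrightarrow> (?\<rho>, None) \<in> F" using F(2) by (auto simp: downsets_def)
      then have "F = {} \<or> F = {(?\<rho>, None)} \<or> F = ?F" using sub by blast
      then show ?thesis by (auto simp: F(1) atom_map_def bud_map_def zero_iff id_map_def fun_eq_iff)
    qed
    moreover have "is_zero G u \<or> u = atom_map b"
      if u: "u \<in> T" "u \<circ>\<^sub>m bud_map b c = u" "atom_map b \<circ>\<^sub>m u = u" for u
    proof -
      have d: "dom u \<subseteq> ?F" "ran u \<subseteq> {(?\<rho>, None)}"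
        using u(2,3) by (simp_all add: bud_map_def atom_map_def left_id_iff right_id_iff)
      note F = forest_carrierD[OF compressionsD(1)[OF u(1)]]
      have p: "p = (?\<rho>, None) \<and> q = (?\<rho>, None)" if pq: "u p = Some q" for p q
      proof -
        have q: "q = (?\<rho>, None)" using d(2) ranI[of u p q, OF pq] by blast
        then have "snd p = None" using F(5)[of "fst p" "snd p" ?\<rho> None] pq by simp
        moreover have "p \<in> ?F" using d(1) pq by blast
        ultimately show ?thesis using q by auto
      qed
      show ?thesis
      proof (cases "u = Map.empty")
        case False
        then obtain p q where "u p = Some q" by (auto simp: fun_eq_iff)
        then have u\<rho>: "u (?\<rho>, None) = Some (?\<rho>, None)" using p by metis
        have "u p = Some q \<longleftrightarrow> atom_map b p = Some q" for p q
          unfolding atom_map_def id_map_iff using p[of p q] u\<rho> by blast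
        then have "u = atom_map b" by (rule map_eqI)
        then show ?thesis by blast
      qed (simp add: zero_iff)
    qed
    moreover have "bud_map b c \<noteq> atom_map b" by (auto simp: bud_map_def atom_map_def)
    moreover have "bud_map b c \<circ>\<^sub>m atom_map b = atom_map b"
      by (simp add: bud_map_def right_id_iff) (simp add: atom_map_def)
    moreover have "bud_map b c \<in> idempotents G"
      using idempotentI bud_map_T[OF b c] by (simp add: bud_map_def)
    ultimately show "bud_map b c \<in> buds G (atom_map b)" by (simp add: buds_def)
  qed
  show "buds G (atom_map b) \<subseteq> bud_map b ` cols b"
  proof
    fix d assume "d \<in> buds G (atom_map b)"
    then have d: "d \<in> idempotents G" "d \<noteq> atom_map b" "d \<circ>\<^sub>m atom_map b = atom_map b"
      and low: "\<And>f. f \<in> idempotents G \<Longrightarrow> d \<circ>\<^sub>m f = f \<Longrightarrow> is_zero G f \<or> f = atom_map b \<or> f = d"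
      and left: "\<And>u. u \<in> T \<Longrightarrow> u \<circ>\<^sub>m d = u \<Longrightarrow> atom_map b \<circ>\<^sub>m u = u \<Longrightarrow> is_zero G u \<or> u = atom_map b"
      by (auto simp: buds_def)
    obtain F where F: "d = id_map F" "id_map F \<in> T" "F \<in> downsets m n" using idempotentE[OF d(1)] .
    have \<rho>: "(?\<rho>, None) \<in> F" using d(3) by (simp add: F(1) right_id_iff) (simp add: atom_map_def)
    have only: "x = ?\<rho>" if x: "(x, None) \<in> F" for x
    proof -
      let ?b = "fst (\<kappa> x)"
      note below = atom_map_below[OF F(2) x]
      have xN: "x \<in> N" using x F(3) by (auto simp: downsets_def points_def)
      have "atom_map ?b \<in> idempotents G" using idempotentI atom_map_T[OF below(1)] by (simp add: atom_map_def)
      moreover have "d \<circ>\<^sub>m atom_map ?b = atom_map ?b"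
        using below(2) by (simp add: F(1) right_id_iff) (simp add: atom_map_def)
      ultimately have "atom_map ?b = atom_map b \<or> atom_map ?b = d" using low atom_map_nonzero by blast
      then have "atom_map ?b = atom_map b"
      proof
        assume "atom_map ?b = d"
        then have "F = {(root ?b, None)}" by (simp add: atom_map_def F(1))
        then have "(?\<rho>, None :: nat option) = (root ?b, None)" using \<rho> by blast
        then show ?thesis by (simp add: atom_map_def)
      qed
      then have "b = ?b" using atom_map_inject[OF below(1) b] by simp
      then have "stem b x \<in> T" by (rule stem_T[OF xN])
      moreover have "stem b x \<circ>\<^sub>m d = stem b x" using x by (simp add: F(1) left_id_iff) (simp add: stem_def)
      moreover have "atom_map b \<circ>\<^sub>m stem b x = stem b x"
        by (simp add: atom_map_def right_id_iff) (simp add: stem_def)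
      moreover have "\<not> is_zero G (stem b x)" by (simp add: zero_iff stem_def)
      ultimately have "dom (stem b x) = dom (atom_map b)" using left by metis
      then show ?thesis by (simp add: atom_map_def) (simp add: stem_def)
    qed
    have "F \<noteq> {(?\<rho>, None)}" using d(2) by (simp add: F(1) atom_map_def)
    then obtain p where p: "p \<in> F" "p \<noteq> (?\<rho>, None)" using \<rho> by blast
    have "(fst p, None) \<in> F" using F(3) p(1) by (cases p) (auto simp: downsets_def)
    then have "fst p = ?\<rho>" by (rule only)
    then obtain y where "p = (?\<rho>, Some y)" using p(2) by (cases p; cases "snd p") auto
    then have y: "(?\<rho>, Some y) \<in> F" using p(1) by simp
    let ?c = "fst (\<nu> ?\<rho> y)"
    note below = bud_map_below[OF F(2) y b]
    have "bud_map b ?c \<in> idempotents G" using idempotentI bud_map_T[OF b below(1)] by (simp add: bud_map_def)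
    moreover have "d \<circ>\<^sub>m bud_map b ?c = bud_map b ?c"
      using below(2) \<rho> by (simp add: F(1) right_id_iff) (simp add: bud_map_def)
    moreover have "\<not> is_zero G (bud_map b ?c)" "bud_map b ?c \<noteq> atom_map b"
      by (auto simp: zero_iff bud_map_def atom_map_def id_map_def fun_eq_iff)
    ultimately have "d = bud_map b ?c" using low by blast
    then show "d \<in> bud_map b ` cols b" using below(1) by blast
  qed
qed

lemma branch_count_bud:
  assumes b: "b \<in> B" and c: "c \<in> cols b"
  shows "branch_count G (atom_map b) (bud_map b c) = column (\<kappa> ` N) b * column (\<nu> (root b) ` M) c"
proof -
  let ?\<rho> = "root b" and ?\<sigma> = "tip b c"
  let ?X = "{x \<in> N. fst (\<kappa> x) = b}"
  let ?Y = "\<lambda>x. {y \<in> M. fst (\<nu> x y) = c}"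
  have "{t \<in> T. bud_map b c \<circ>\<^sub>m t = t \<and> atom_map b \<circ>\<^sub>m t \<noteq> t} = branch b c ` Sigma ?X ?Y"
  proof
    show "branch b c ` Sigma ?X ?Y \<subseteq> {t \<in> T. bud_map b c \<circ>\<^sub>m t = t \<and> atom_map b \<circ>\<^sub>m t \<noteq> t}"
    proof (rule image_subsetI)
      fix p assume "p \<in> Sigma ?X ?Y"
      then obtain x y where p: "p = (x, y)" "x \<in> N" "b = fst (\<kappa> x)" "y \<in> M" "c = fst (\<nu> x y)" by auto
      have "branch b c p \<in> T" using branch_T p c by simp
      moreover have "ran (branch b c p) = {(?\<rho>, None), (?\<rho>, Some ?\<sigma>)}"
        by (auto simp: p(1) branch_def ran_def)
      ultimately show "branch b c p \<in> {t \<in> T. bud_map b c \<circ>\<^sub>m t = t \<and> atom_map b \<circ>\<^sub>m t \<noteq> t}"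
        by (auto simp: bud_map_def atom_map_def right_id_iff)
    qed
    show "{t \<in> T. bud_map b c \<circ>\<^sub>m t = t \<and> atom_map b \<circ>\<^sub>m t \<noteq> t} \<subseteq> branch b c ` Sigma ?X ?Y"
    proof
      fix t assume "t \<in> {t \<in> T. bud_map b c \<circ>\<^sub>m t = t \<and> atom_map b \<circ>\<^sub>m t \<noteq> t}"
      then have t: "t \<in> T" "ran t \<subseteq> {(?\<rho>, None), (?\<rho>, Some ?\<sigma>)}" "\<not> ran t \<subseteq> {(?\<rho>, None)}"
        by (auto simp: bud_map_def atom_map_def right_id_iff)
      note F = forest_carrierD[OF compressionsD(1)[OF t(1)]]
      have "(?\<rho>, Some ?\<sigma>) \<in> ran t" using t(2,3) by blast
      then obtain p where p: "t p = Some (?\<rho>, Some ?\<sigma>)" unfolding ran_def by blast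
      then obtain x y where xy: "p = (x, Some y)" using F(5)[of "fst p" "snd p" ?\<rho> "Some ?\<sigma>"] by (cases p) auto
      have px: "t (x, None) = Some (?\<rho>, None)" "t (x, Some y) = Some (?\<rho>, Some ?\<sigma>)"
        using F(4)[of x "Some y"] p xy by auto
      have "t q = Some q' \<longleftrightarrow> branch b c (x, y) q = Some q'" for q q'
      proof
        assume q: "t q = Some q'"
        then have "q' = (?\<rho>, None) \<or> q' = (?\<rho>, Some ?\<sigma>)" using t(2) ranI[of t q q', OF q] by blast
        then show "branch b c (x, y) q = Some q'" using F(3)[OF q] px by (auto simp: branch_def)
      qed (use px in \<open>auto simp: branch_def split: if_splits\<close>)
      then have "t = branch b c (x, y)" by (rule map_eqI)
      moreover have "x \<in> N" "y \<in> M" using F(1)[OF px(2)] by (auto simp: points_def)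
      moreover have "fst (\<kappa> x) = b" using compressionsD(2)[OF t(1) px(1)] root(2)[OF b] by simp
      moreover have "fst (\<nu> x y) = c" using compressionsD(3)[OF t(1) px(2)] tip(2)[OF b c] by simp
      ultimately show "t \<in> branch b c ` Sigma ?X ?Y" by blast
    qed
  qed
  moreover have "inj_on (branch b c) (Sigma ?X ?Y)"
  proof (rule inj_onI)
    fix p q assume eq: "branch b c p = branch b c q"
    have "dom (branch b c p) = {(fst p, None), (fst p, Some (snd p))}" for p
      by (auto simp: branch_def case_prod_unfold)
    then have "{(fst p, None), (fst p, Some (snd p))} = {(fst q, None), (fst q, Some (snd q))}"
      using eq by metis
    then show "p = q" by (auto simp: doubleton_eq_iff prod_eq_iff)
  qed
  ultimately have "branch_count G (atom_map b) (bud_map b c) = card (Sigma ?X ?Y)"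
    by (simp add: branch_count_def card_image)
  also have "\<dots> = (\<Sum>x\<in>?X. card (?Y x))" by simp
  also have "\<dots> = (\<Sum>x\<in>?X. column (\<nu> ?\<rho> ` M) c)"
  proof (rule sum.cong[OF refl])
    fix x assume x: "x \<in> ?X"
    then have "\<nu> x ` M = \<nu> ?\<rho> ` M" using C(3)[of x ?\<rho>] root[OF b] by simp
    then show "card (?Y x) = column (\<nu> ?\<rho> ` M) c" using card_block[OF C(2)[of x]] x by simp
  qed
  also have "\<dots> = column (\<kappa> ` N) b * column (\<nu> ?\<rho> ` M) c" using card_block[OF C(1)] by simp
  finally show ?thesis .
qed

lemma semigroup_shape_compressions: "semigroup_shape G = forest_shape m n \<kappa> \<nu>"
proof -
  have "mset_set (atoms G) = image_mset atom_map (mset_set B)"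
    unfolding atoms_eq by (rule image_mset_mset_set[symmetric]) (auto intro: inj_onI atom_map_inject)
  then have "semigroup_shape G = image_mset (\<lambda>b. (stem_count G (atom_map b),
      image_mset (\<lambda>d. branch_count G (atom_map b) d div stem_count G (atom_map b)) (mset_set (buds G (atom_map b)))))
      (mset_set B)"
    by (simp add: semigroup_shape_def image_mset.compositionality comp_def)
  also have "\<dots> = forest_shape m n \<kappa> \<nu>"
    unfolding forest_shape_def
  proof (rule image_mset_cong)
    fix b assume "b \<in># mset_set B"
    then have b: "b \<in> B" by simp
    have pos: "column (\<kappa> ` N) b > 0" by (rule column_pos[OF _ b]) simp
    have inj: "inj_on (bud_map b) (cols b)"
    proof (rule inj_onI)
      fix c c' assume c: "c \<in> cols b" "c' \<in> cols b" "bud_map b c = bud_map b c'"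
      have "(root b, Some (tip b c)) \<in> dom (bud_map b c)" by (simp add: bud_map_def)
      then have "tip b c = tip b c'" unfolding c(3) by (simp add: bud_map_def)
      then have "(c, 0) = (c', 0 :: nat)" using tip(2)[OF b c(1)] tip(2)[OF b c(2)] by metis
      then show "c = c'" by simp
    qed
    have "cells m n \<kappa> \<nu> b = \<nu> (root b) ` M" using cells_eq[OF ch root(1)[OF b]] root(2)[OF b] by simp
    moreover have "image_mset (\<lambda>d. branch_count G (atom_map b) d div stem_count G (atom_map b)) (mset_set (buds G (atom_map b)))
        = image_mset (\<lambda>c. branch_count G (atom_map b) (bud_map b c) div stem_count G (atom_map b)) (mset_set (cols b))"
      unfolding buds_eq[OF b] image_mset_mset_set[OF inj, symmetric]
      by (simp add: image_mset.compositionality comp_def)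
    moreover have "\<dots> = shape (\<nu> (root b) ` M)"
      unfolding shape_def by (rule image_mset_cong) (use pos in \<open>simp add: stem_count_atom[OF b] branch_count_bud[OF b]\<close>)
    ultimately show "(stem_count G (atom_map b),
        image_mset (\<lambda>d. branch_count G (atom_map b) d div stem_count G (atom_map b)) (mset_set (buds G (atom_map b))))
        = (column (\<kappa> ` N) b, shape (cells m n \<kappa> \<nu> b))"
      by (simp add: stem_count_atom[OF b])
  qed
  finally show ?thesis .
qed

end

section \<open>Counting shapes\<close>

lemma finite_partitions: "finite (partitions m)"
proof (rule finite_subset)
  show "partitions m \<subseteq> (\<Union>k\<le>m. multisets_of_size {..m} k)"
  proof
    fix M assume M: "M \<in> partitions m"
    have le: "k \<le> m" if "k \<in># M" for k
      using that M by (metis (mono_tags, lifting) partitions_def mem_Collect_eq sum_mset.remove le_add1)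
    have "size M \<le> \<Sum>\<^sub># M" if "\<forall>k\<in>#M. 0 < k" for M :: "nat multiset"
      using that by (induction M) auto
    then have "size M \<le> m" using M by (auto simp: partitions_def)
    then show "M \<in> (\<Union>k\<le>m. multisets_of_size {..m} k)"
      using le by (auto simp: multisets_of_size_def)
  qed
  show "finite (\<Union>k\<le>m. multisets_of_size {..m} k)" by blast
qed

text \<open>A multiset of pairs is the same as a family of multisets indexed by the first components.\<close>
definition slice :: "(nat \<times> 'a) multiset \<Rightarrow> nat \<Rightarrow> 'a multiset" where
  "slice Q i = image_mset snd (filter_mset (\<lambda>p. fst p = i) Q)"

definition assemble :: "nat \<Rightarrow> (nat \<Rightarrow> 'a multiset) \<Rightarrow> (nat \<times> 'a) multiset" where
  "assemble n F = (\<Sum>i=1..n. image_mset (Pair i) (F i))"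

lemma slice_image_Pair: "slice (image_mset (Pair i) A) k = (if i = k then A else {#})"
  by (simp add: slice_def filter_mset_image_mset image_mset.compositionality comp_def)

lemma slice_assemble: "slice (assemble n F) k = (if k \<in> {1..n} then F k else {#})"
proof -
  have add: "slice (A + B) k = slice A k + slice B k" for A B :: "(nat \<times> 'a) multiset"
    by (simp add: slice_def)
  have "slice (\<Sum>i\<in>I. image_mset (Pair i) (F i)) k = (\<Sum>i\<in>I. slice (image_mset (Pair i) (F i)) k)" for I
    by (induction I rule: infinite_finite_induct) (simp_all add: add, simp_all add: slice_def)
  then show ?thesis
    by (simp add: assemble_def slice_image_Pair)
qed

lemma assemble_slice:
  assumes "fst ` set_mset Q \<subseteq> {1..n}"
  shows "assemble n (slice Q) = Q"
proof -
  have "image_mset (Pair i) (slice Q i) = filter_mset (\<lambda>p. fst p = i) Q" for i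
    by (auto simp: slice_def image_mset.compositionality comp_def intro!: image_mset_cong[where g = id, simplified])
  moreover have "(\<Sum>i=1..n. filter_mset (\<lambda>p. fst p = i) Q) = Q"
  proof (rule multiset_eqI)
    fix p
    have "count (\<Sum>i=1..n. filter_mset (\<lambda>p. fst p = i) Q) p = (\<Sum>i=1..n. if fst p = i then count Q p else 0)"
      by (simp add: count_sum)
    also have "\<dots> = count Q p"
      using assms by (auto simp: count_eq_zero_iff)
    finally show "count (\<Sum>i=1..n. filter_mset (\<lambda>p. fst p = i) Q) p = count Q p" .
  qed
  ultimately show ?thesis by (simp add: assemble_def)
qed

text \<open>Splitting a shape into slices, with \<open>j i\<close> the size of the \<open>i\<close>-th one, leaves a free choice of a
  multiset of \<open>j i\<close> partitions of \<open>m\<close> for each \<open>i\<close>.\<close>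
lemma card_forest_shapes:
  "finite (forest_shapes m n)"
  "card (forest_shapes m n) =
     (\<Sum>j \<in> {j \<in> {1..n} \<rightarrow>\<^sub>E (UNIV :: nat set). (\<Sum>i=1..n. i * j i) = n}.
        \<Prod>i=1..n. (num_partitions m + j i - 1) choose (j i))"
proof -
  let ?J = "{j \<in> {1..n} \<rightarrow>\<^sub>E (UNIV :: nat set). (\<Sum>i=1..n. i * j i) = n}"
  let ?F = "\<lambda>j. \<Pi>\<^sub>E i\<in>{1..n}. multisets_of_size (partitions m) (j i)"
  have "?J \<subseteq> {1..n} \<rightarrow>\<^sub>E {..n}"
  proof
    fix j assume j: "j \<in> ?J"
    have "j i \<le> n" if i: "i \<in> {1..n}" for i
    proof -
      have "j i \<le> i * j i" using i by simp
      also have "\<dots> \<le> (\<Sum>i=1..n. i * j i)" by (rule member_le_sum[OF i]) auto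
      finally show ?thesis using j by simp
    qed
    then show "j \<in> {1..n} \<rightarrow>\<^sub>E {..n}" using j by (auto simp: PiE_iff)
  qed
  then have finJ: "finite ?J" by (rule finite_subset) (intro finite_PiE finite_atLeastAtMost finite_atMost)
  have finF: "finite (?F j)" for j
    by (intro finite_PiE) (auto simp: finite_partitions)
  have size_sum: "sum_mset (image_mset fst (assemble n F)) = (\<Sum>i=1..n. i * size (F i))" for F :: "nat \<Rightarrow> nat multiset multiset"
  proof -
    have "sum_mset (image_mset fst (\<Sum>i\<in>I. image_mset (Pair i) (F i))) = (\<Sum>i\<in>I. i * size (F i))" for I
      by (induction I rule: infinite_finite_induct)
        (simp_all add: image_mset.compositionality comp_def image_mset_const_eq)
    then show ?thesis by (simp add: assemble_def)
  qed
  have bij: "bij_betw (assemble n) (\<Union>j\<in>?J. ?F j) (forest_shapes m n)"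
  proof (rule bij_betw_byWitness[where f' = "\<lambda>Q. restrict (slice Q) {1..n}"])
    show "\<forall>F\<in>\<Union>j\<in>?J. ?F j. restrict (slice (assemble n F)) {1..n} = F"
      by (auto simp: slice_assemble fun_eq_iff PiE_iff extensional_def restrict_def)
    show "assemble n ` (\<Union>j\<in>?J. ?F j) \<subseteq> forest_shapes m n"
    proof (intro image_subsetI)
      fix F assume "F \<in> (\<Union>j\<in>?J. ?F j)"
      then obtain j where j: "j \<in> ?J" and F: "F \<in> ?F j" by blast
      have Fi: "size (F i) = j i" "set_mset (F i) \<subseteq> partitions m" if "i \<in> {1..n}" for i
        using F that by (auto simp: PiE_iff multisets_of_size_def)
      have "sum_mset (image_mset fst (assemble n F)) = n"
        using j Fi(1) by (simp add: size_sum)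
      moreover have "\<forall>p\<in>#assemble n F. 0 < fst p \<and> snd p \<in> partitions m"
        using Fi(2) by (fastforce simp: assemble_def set_mset_sum)
      ultimately show "assemble n F \<in> forest_shapes m n"
        by (simp add: forest_shapes_def case_prod_unfold)
    qed
    have le: "fst ` set_mset Q \<subseteq> {1..n}" if Q: "Q \<in> forest_shapes m n" for Q
    proof
      fix k assume "k \<in> fst ` set_mset Q"
      then obtain p where p: "p \<in># Q" "k = fst p" by blast
      then have "0 < k" using Q by (auto simp: forest_shapes_def case_prod_unfold)
      moreover have "k \<le> \<Sum>\<^sub># (image_mset fst Q)"
        using p by (metis le_add1 multi_member_split image_mset_add_mset sum_mset.add_mset)
      ultimately show "k \<in> {1..n}" using Q by (auto simp: forest_shapes_def)
    qed
    show "\<forall>Q\<in>forest_shapes m n. assemble n (restrict (slice Q) {1..n}) = Q"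
    proof
      fix Q assume Q: "Q \<in> forest_shapes m n"
      have "assemble n (restrict (slice Q) {1..n}) = assemble n (slice Q)" by (simp add: assemble_def)
      then show "assemble n (restrict (slice Q) {1..n}) = Q" using assemble_slice[OF le[OF Q]] by simp
    qed
    show "(\<lambda>Q. restrict (slice Q) {1..n}) ` forest_shapes m n \<subseteq> (\<Union>j\<in>?J. ?F j)"
    proof (intro image_subsetI)
      fix Q assume Q: "Q \<in> forest_shapes m n"
      define j where "j = restrict (\<lambda>i. size (slice Q i)) {1..n}"
      have "(\<Sum>i=1..n. i * size (slice Q i)) = n"
        using size_sum[of "slice Q"] assemble_slice[OF le[OF Q]] Q by (simp add: forest_shapes_def)
      then have "j \<in> ?J" by (simp add: j_def)
      moreover have "set_mset (slice Q i) \<subseteq> partitions m" for i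
        using Q by (auto simp: slice_def forest_shapes_def case_prod_unfold)
      then have "restrict (slice Q) {1..n} \<in> ?F j"
        by (auto simp: j_def multisets_of_size_def)
      ultimately show "restrict (slice Q) {1..n} \<in> (\<Union>j\<in>?J. ?F j)" by blast
    qed
  qed
  have disj: "?F j \<inter> ?F j' = {}" if jj: "j \<in> ?J" "j' \<in> ?J" "j \<noteq> j'" for j j'
  proof (rule ccontr)
    assume "?F j \<inter> ?F j' \<noteq> {}"
    then obtain F where F: "F \<in> ?F j" "F \<in> ?F j'" by blast
    have "j i = j' i" if "i \<in> {1..n}" for i
      using F that by (auto simp: PiE_iff multisets_of_size_def)
    then have "j = j'" using jj(1,2) by (intro PiE_ext[of j "{1..n}" "\<lambda>_. UNIV" j']) auto
    then show False using jj(3) by simp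
  qed
  show "finite (forest_shapes m n)" using bij_betw_finite[OF bij] finJ finF by blast
  have "card (forest_shapes m n) = card (\<Union>j\<in>?J. ?F j)" using bij_betw_same_card[OF bij] by simp
  also have "\<dots> = (\<Sum>j\<in>?J. card (?F j))"
    by (rule card_UN_disjoint[OF finJ]) (use finF disj in blast)+
  also have "\<dots> = (\<Sum>j\<in>?J. \<Prod>i=1..n. (num_partitions m + j i - 1) choose (j i))"
  proof -
    have "num_partitions m = card (partitions m)" by (simp add: num_partitions_def partitions_def)
    then show ?thesis by (simp add: card_PiE card_multisets_of_size finite_partitions)
  qed
  finally show "card (forest_shapes m n) = \<dots>" .
qed

section \<open>The number of isomorphism classes\<close>

text \<open>The shape is a complete isomorphism invariant, and every shape occurs.\<close>
lemma card_iso_classes_forest: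
  "card (iso_classes (forest_maps m n) (R_cross_sections (forest_maps m n))) = card (forest_shapes m n)"
proof -
  let ?F = "forest_maps m n"
  let ?A = "R_cross_sections ?F"
  let ?s = "\<lambda>T. semigroup_shape (?F\<lparr>carrier := T\<rparr>)"
  have s: "?s (compressions m n \<kappa> \<nu>) = forest_shape m n \<kappa> \<nu>" if "forest_chart m n \<kappa> \<nu>" for \<kappa> \<nu>
    by (rule charted_forest.semigroup_shape_compressions[OF charted_forest.intro[OF that]])
  have image: "?s ` ?A = forest_shapes m n"
  proof
    show "?s ` ?A \<subseteq> forest_shapes m n"
    proof (rule image_subsetI)
      fix T assume "T \<in> ?A"
      then obtain \<kappa> \<nu> where "forest_chart m n \<kappa> \<nu>" "T = compressions m n \<kappa> \<nu>"
        using cross_section_compressions by blast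
      then show "?s T \<in> forest_shapes m n" using s forest_shape_in by simp
    qed
    show "forest_shapes m n \<subseteq> ?s ` ?A"
    proof
      fix Q assume "Q \<in> forest_shapes m n"
      then obtain \<kappa> \<nu> where ch: "forest_chart m n \<kappa> \<nu>" and "forest_shape m n \<kappa> \<nu> = Q"
        using ex_forest_chart by blast
      then have "Q = ?s (compressions m n \<kappa> \<nu>)" using s by simp
      then show "Q \<in> ?s ` ?A" using compressions_cross_section[OF ch] by (rule image_eqI)
    qed
  qed
  have iso: "?F\<lparr>carrier := T\<rparr> \<cong> ?F\<lparr>carrier := U\<rparr> \<longleftrightarrow> ?s T = ?s U" if TU: "T \<in> ?A" "U \<in> ?A" for T U
  proof
    assume "?F\<lparr>carrier := T\<rparr> \<cong> ?F\<lparr>carrier := U\<rparr>"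
    then obtain h where "h \<in> iso (?F\<lparr>carrier := T\<rparr>) (?F\<lparr>carrier := U\<rparr>)"
      unfolding is_iso_def by blast
    then have "?s U = ?s T"
      by (rule semigroup_shape_iso) (use TU(1) in \<open>simp add: forest_R_cross_sections\<close>)
    then show "?s T = ?s U" by simp
  next
    assume eq: "?s T = ?s U"
    obtain \<kappa> \<nu> where T: "forest_chart m n \<kappa> \<nu>" "T = compressions m n \<kappa> \<nu>"
      using cross_section_compressions[OF TU(1)] by blast
    obtain \<kappa>' \<nu>' where U: "forest_chart m n \<kappa>' \<nu>'" "U = compressions m n \<kappa>' \<nu>'"
      using cross_section_compressions[OF TU(2)] by blast
    have "forest_shape m n \<kappa> \<nu> = forest_shape m n \<kappa>' \<nu>'" using eq s T U by simp
    then show "?F\<lparr>carrier := T\<rparr> \<cong> ?F\<lparr>carrier := U\<rparr>"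
      unfolding T(2) U(2) by (rule same_shape_iso[OF T(1) U(1)])
  qed
  have "card (iso_classes ?F ?A) = card (?s ` ?A)"
    unfolding iso_classes_def
    by (rule card_quotient_by_map) (use image card_forest_shapes(1) iso in simp_all)
  then show ?thesis by (simp only: image)
qed

theorem corollary1:
  fixes m n :: nat
  assumes "m > 0" and "n > 0"
  shows "card (iso_classes (partial_wreath (IS m) n) (R_cross_sections (partial_wreath (IS m) n))) =
           (\<Sum>j \<in> {j \<in> {1..n} \<rightarrow>\<^sub>E (UNIV :: nat set). (\<Sum>i=1..n. i * j i) = n}.
              \<Prod>i=1..n. (num_partitions m + j i - 1) choose (j i))
       \<and> card (iso_classes (partial_wreath (IS m) n) (L_cross_sections (partial_wreath (IS m) n))) =
           (\<Sum>j \<in> {j \<in> {1..n} \<rightarrow>\<^sub>E (UNIV :: nat set). (\<Sum>i=1..n. i * j i) = n}.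
              \<Prod>i=1..n. (num_partitions m + j i - 1) choose (j i))"
  by (simp only: card_cross_sections_forest card_iso_classes_forest card_forest_shapes(2) simp_thms)

end
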